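(* Let $d\ge2$, let $M$ be a $d\times d$ real matrix all of whose eigenvalues (in $\mathbb{C}$) are less than $1$ in modulus, let $u\in\mathbb{R}^d$ be a cyclic vector for $M$, and let $\mathcal{U}_M$ be the set of uniqueness of the iterated function system $\{v\mapsto Mv-u,\ v\mapsto Mv+u\}$. (1) If $M$ has a non-trivial Jordan block (i.e. the Jordan normal form of $M$ over $\mathbb{C}$ has a block of size at least $2$), then $\dim_H\mathcal{U}_M>0$. (2) If $M$ has an eigenvalue $\kappa$ with $\arg(\kappa)/\pi\notin\mathbb{Q}$, then $\dim_H\mathcal{U}_M>0$. (3) If $M$ has two eigenvalues $\kappa_1$ and $\kappa_2$ with $|\kappa_1|\ne|\kappa_2|$, then $\dim_H\mathcal{U}_M>0$. (4) Suppose $M$ has only distinct simple eigenvalues $\kappa_1,\dots,\kappa_d$, with $\arg(\kappa_j)/\pi\in\mathbb{Q}$ for all $j$, and suppose that $|\kappa_1|=\dots=|\kappa_d|$. Let $q\in\mathbb{N}$, $q\ge1$, be minimal such that $\kappa_j^q\in\mathbb{R}$ for all $1\le j\le d$. If there exist $j$ and $k$ such that $\kappa_j^q\kappa_k^q<0$, put $\beta=|\kappa_1|^{-2q}$; otherwise put $\beta=|\kappa_1|^{-q}$. Then the set of uniqueness $\mathcal{U}_M$ is: (a) finite and non-empty if $\beta\in(1,G]$; (b) infinite countable if $\beta\in(G,\beta_* )$; (c) an uncountable set of zero Hausdorff dimension if $\beta=\beta_*$; (d) a set of positive Hausdorff dimension if $\beta\in(\beta_*,\infty)$.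
   Context: A vector $u\in\mathbb{R}^d$ is cyclic for $M$ if $\operatorname{span}\{M^n u\mid n\ge 0\}=\mathbb{R}^d$. For a sequence $a_0a_1\dots\in\{\pm1\}^{\mathbb{N}}$ put $\pi_M(a_0a_1\dots)=\sum_{k=0}^\infty a_kM^ku$. The attractor of the iterated function system is $A_M=\{\pi_M(a_0a_1\dots)\mid a_n\in\{\pm1\}\}$. A sequence $a_0a_1\dots\in\{\pm1\}^{\mathbb{N}}$ with $x=\pi_M(a_0a_1\dots)$ is called an address of $x\in A_M$. The set of uniqueness $\mathcal{U}_M$ is the set of $x\in A_M$ which have a unique address. $\dim_H$ denotes Hausdorff dimension. $G=\frac{1+\sqrt5}{2}$, and $\beta_*\approx1.7872$ is the Komornik–Loreti constant, i.e. the unique solution $x>1$ of $\sum_{n=1}^\infty \mathfrak{m}_nx^{-n+1}=1$, where $(\mathfrak{m}_n)_{n\ge1}=0110\,1001\,1001\,0110\dots$ is the Thue–Morse sequence, i.e. the fixed point, starting with $0$, of the substitution $0\to01$, $1\to10$.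
   Formalization: In (1) the non-trivial Jordan block is required to belong to a nonzero eigenvalue, and in (3) both κ_1 and κ_2 are required to be nonzero; for singular M the claims can fail (M nilpotent; M = diag(0, 0.9)). *)

theory Defs
  imports "HOL-Analysis.Analysis" "Jordan_Normal_Form.Spectral_Radius"
begin

section \<open>Hausdorff dimension\<close>

text \<open>The gauge \<open>diam(U)^s\<close>, with the conventions that \<open>0^0 = 1\<close> and that the empty set has gauge 0
  (in HOL \<open>0 powr 0 = 0\<close>, so the case \<open>s = 0\<close> is separated).\<close>

definition hausdorff_gauge :: "real \<Rightarrow> 'a::metric_space set \<Rightarrow> ennreal" where
  "hausdorff_gauge s U =
     (if U = {} then 0 else if s = 0 then 1 else ennreal (diameter U powr s))"

text \<open>Boundedness is demanded separately because \<^const>\<open>diameter\<close> is unspecified on unbounded sets.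
  Finite covers are included, since members of the sequence may be empty.\<close>

definition hausdorff_content :: "real \<Rightarrow> real \<Rightarrow> 'a::metric_space set \<Rightarrow> ennreal" where
  "hausdorff_content s \<delta> E =
     (INF U\<in>{U :: nat \<Rightarrow> 'a set. E \<subseteq> (\<Union>i. U i) \<and> (\<forall>i. bounded (U i) \<and> diameter (U i) \<le> \<delta>)}.
        \<Sum>i. hausdorff_gauge s (U i))"

definition hausdorff_measure :: "real \<Rightarrow> 'a::metric_space set \<Rightarrow> ennreal" where
  "hausdorff_measure s E = (SUP \<delta>\<in>{0<..}. hausdorff_content s \<delta> E)"

definition hausdorff_dim :: "'a::metric_space set \<Rightarrow> ereal" where
  "hausdorff_dim E = (INF s\<in>{s. 0 \<le> s \<and> hausdorff_measure s E = 0}. ereal s)"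

section \<open>The iterated function system\<close>

text \<open>Powers of \<open>M\<close> are iterates of the linear map \<open>(*v) M\<close>; note that \<open>*\<close> and \<open>^\<close> on
  \<open>real^'n^'n\<close> would act entrywise.\<close>

definition cyclic_vector :: "real^'n^'n \<Rightarrow> real^'n \<Rightarrow> bool" where
  "cyclic_vector M u \<longleftrightarrow>
     Real_Vector_Spaces.span (range (\<lambda>n. ((\<lambda>v. M *v v) ^^ n) u)) = UNIV"

definition sign_seqs :: "(nat \<Rightarrow> real) set" where
  "sign_seqs = {a. \<forall>k. a k \<in> {-1, 1}}"

definition address_map :: "real^'n^'n \<Rightarrow> real^'n \<Rightarrow> (nat \<Rightarrow> real) \<Rightarrow> real^'n" where
  "address_map M u a = (\<Sum>k. a k *\<^sub>R ((\<lambda>v. M *v v) ^^ k) u)"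

definition attractor :: "real^'n^'n \<Rightarrow> real^'n \<Rightarrow> (real^'n) set" where
  "attractor M u = address_map M u ` sign_seqs"

definition uniqueness_set :: "real^'n^'n \<Rightarrow> real^'n \<Rightarrow> (real^'n) set" where
  "uniqueness_set M u =
     {x \<in> attractor M u. \<exists>!a. a \<in> sign_seqs \<and> x = address_map M u a}"

section \<open>Eigenvalues and Jordan blocks over the complex numbers\<close>

text \<open>To use the spectral theory for matrices indexed by natural numbers, the index type is
  enumerated. The enumeration is arbitrary: another one conjugates the resulting matrix by a
  permutation matrix, which changes neither spectrum, nor characteristic polynomial, nor
  Jordan normal form.\<close>

definition index_enum :: "nat \<Rightarrow> 'n::finite" where
  "index_enum = (SOME f. bij_betw f {0..<CARD('n)} UNIV)"

lemma bij_betw_index_enum: "bij_betw (index_enum :: nat \<Rightarrow> 'n::finite) {0..<CARD('n)} UNIV"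
proof -
  have "\<exists>f. bij_betw f {0..<CARD('n)} (UNIV :: 'n set)"
    by (rule ex_bij_betw_nat_finite) simp
  then show ?thesis
    unfolding index_enum_def by (rule someI_ex)
qed

definition complex_mat :: "real^'n^'n \<Rightarrow> complex mat" where
  "complex_mat M = Matrix.mat CARD('n) CARD('n)
     (\<lambda>(i, j). complex_of_real (vec_nth (vec_nth M (index_enum i)) (index_enum j)))"

text \<open>When \<open>M\<close> is singular, the eigenvalue 0 must be kept out of hypotheses about Jordan blocks
  and moduli (for arguments this is automatic, as \<open>Arg 0 = 0\<close>). If \<open>M\<close> is
  nilpotent with a cyclic vector, the address map ignores all but the first \<open>d\<close> signs, so
  no point has a unique address, although \<open>M\<close> is a single Jordan block of size \<open>d\<close>.
  If \<open>d = 2\<close> and \<open>M\<close> has eigenvalues 0 and \<open>\<lambda>\<close> with \<open>1 / golden_ratio \<le> \<lambda> < 1\<close>, then the component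
  belonging to 0 determines the first sign and nothing else, and the uniqueness set has four points,
  although the moduli of the eigenvalues differ.\<close>

section \<open>The constants\<close>

definition golden_ratio :: real where
  "golden_ratio = (1 + sqrt 5) / 2"

definition thue_morse_subst :: "nat \<Rightarrow> nat list" where
  "thue_morse_subst b = (if b = 0 then [0, 1] else [1, 0])"

text \<open>Indexed from 0: \<open>thue_morse n\<close> is the term of index \<open>n + 1\<close> of the sequence
  0110 1001 1001 0110 ... when that is indexed from 1.\<close>

fun thue_morse :: "nat \<Rightarrow> nat" where
  "thue_morse n = (if n = 0 then 0 else thue_morse_subst (thue_morse (n div 2)) ! (n mod 2))"

declare thue_morse.simps [simp del]

lemma thue_morse_0: "thue_morse 0 = 0"
  by (simp add: thue_morse.simps)

lemma thue_morse_fixed_point: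
  "thue_morse_subst (thue_morse n) = [thue_morse (2 * n), thue_morse (2 * n + 1)]"
proof -
  have even: "thue_morse (2 * n) = thue_morse_subst (thue_morse n) ! 0"
    by (cases "n = 0") (simp_all add: thue_morse.simps[of "2 * n"] thue_morse_0 thue_morse_subst_def)
  have odd: "thue_morse (2 * n + 1) = thue_morse_subst (thue_morse n) ! 1"
    by (subst thue_morse.simps) simp
  show ?thesis
    unfolding even odd by (simp add: thue_morse_subst_def)
qed

definition komornik_loreti :: real where
  "komornik_loreti = (THE x. 1 < x \<and> (\<lambda>n. real (thue_morse n) / x ^ n) sums 1)"

end

(*
  Proof idea. Write X k = M^k u. A linear functional w with w (X n) of sign a n separates the address a from
  every sequence that first differs from a at n, as soon as |w (X n)| exceeds the total weight |w (X k)| of the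
  later positions k where the sign of w (X k) disagrees with a k. The available sequences w (X k) include
  the real parts of complex combinations of kappa^k and, for a Jordan block, of k kappa^k.
  In cases (1)-(3) one follows the signs of Im (c kappa^k) for an eigenvalue kappa of angle near (or equal to)
  pi p / q; the sign may be chosen freely at multiples of a large L, since there Im (c kappa^k) is negligible and a
  small perturbation (by a shifted angle, by a smaller eigenvalue, or by k kappa^k) decides the sign at n.
  A free choice at all multiples of L together with exponential separation gives positive dimension.
  In case (4) some power M^N is the scalar plus or minus 1 / beta, so each residue class mod N of an address is an
  expansion in base beta. In a unique address all classes must be unique expansions; conversely a unique expansion
  may be planted in one class by letting the others maximise a functional vanishing on exactly that class. The
  trichotomy for unique expansions at the Komornik-Loreti constant follows from the renormalisation of
  their shifts by the Thue-Morse substitution.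
*)

theory Submission
  imports Defs
begin

section \<open>Base-\<open>\<beta>\<close> values and Hausdorff dimension\<close>


text \<open>What every construction controls is the surplus of |w (X n)| over the mismatch weight,
  relative to the norm of w. Uniqueness needs only a positive surplus at each n. Positive dimension
  needs it bounded below while the norms grow at most like r^-n: codes that first differ at j then
  give points at distance at least a constant times a fixed power s^j, and reading the code as a
  binary expansion is a Hoelder map onto [0, 1]. The functional may therefore be chosen afresh at
  each n, with its phase reset there; an error of angle accumulates only over the steps in which
  geometric decay has not yet made later terms harmless. In case (4) the minimality of q enters
  through the functional that isolates one class: it exists because no X k with 0 < k < N is
  parallel to X 0. At the Komornik-Loreti constant, one desubstitution halves the length of a word
  at the price of a factor linear in that length, so only 2^O((log n)^2) words of length n are
  possible; this gives dimension zero. The free exponents in the same hierarchy of substitutions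
  give uncountability.\<close>

lemma summable_beta_val:
  fixes \<beta> :: real and e :: "nat \<Rightarrow> bool"
  assumes "1 < \<beta>"
  shows "summable (\<lambda>k. of_bool (e k) / \<beta> ^ (k + 1))"
proof (rule summable_comparison_test')
  show "summable (\<lambda>k. (1/\<beta>) ^ k * (1/\<beta>))"
    using assms by (intro summable_mult2 summable_geometric) auto
  show "norm (of_bool (e k) / \<beta> ^ (k + 1)) \<le> (1/\<beta>) ^ k * (1/\<beta>)" for k
    using assms by (auto simp: power_one_over field_simps)
qed

definition beta_val :: "real \<Rightarrow> (nat \<Rightarrow> bool) \<Rightarrow> real" where
  "beta_val \<beta> e = (\<Sum>k. of_bool (e k) / \<beta> ^ (k + 1))"

lemma beta_val_sums:
  assumes "1 < \<beta>"
  shows "(\<lambda>k. of_bool (e k) / \<beta> ^ (k + 1)) sums beta_val \<beta> e"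
  unfolding beta_val_def by (rule summable_sums[OF summable_beta_val[OF assms]])

lemma geometric_tail_sums:
  fixes \<beta> :: real
  assumes "1 < \<beta>"
  shows "(\<lambda>k. 1 / \<beta> ^ (k + 1)) sums (1 / (\<beta> - 1))"
proof -
  have "(\<lambda>k. (1/\<beta>) ^ k * (1/\<beta>)) sums ((1 / (1 - 1/\<beta>)) * (1/\<beta>))"
    using assms by (intro sums_mult2 geometric_sums) auto
  moreover have "(1 / (1 - 1/\<beta>)) * (1/\<beta>) = 1 / (\<beta> - 1)"
    using assms by (simp add: field_simps)
  ultimately show ?thesis by (simp add: power_one_over field_simps)
qed

lemma beta_val_nonneg: "1 < \<beta> \<Longrightarrow> 0 \<le> beta_val \<beta> e"
  by (rule sums_le[OF _ sums_zero beta_val_sums]) auto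

lemma beta_val_le: "1 < \<beta> \<Longrightarrow> beta_val \<beta> e \<le> 1 / (\<beta> - 1)"
  by (rule sums_le[OF _ beta_val_sums geometric_tail_sums]) (auto simp: divide_simps)

lemma beta_val_split:
  assumes "1 < \<beta>"
  shows "beta_val \<beta> e = (\<Sum>k<n. of_bool (e k) / \<beta> ^ (k + 1)) + beta_val \<beta> (\<lambda>k. e (n + k)) / \<beta> ^ n"
proof -
  have "(\<lambda>k. (of_bool (e (n + k)) / \<beta> ^ (k + 1)) / \<beta> ^ n) sums (beta_val \<beta> (\<lambda>k. e (n + k)) / \<beta> ^ n)"
    by (intro sums_divide beta_val_sums assms)
  then have "(\<lambda>k. of_bool (e (k + n)) / \<beta> ^ (k + n + 1)) sums (beta_val \<beta> (\<lambda>k. e (n + k)) / \<beta> ^ n)"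
    by (simp add: power_add ac_simps)
  then have "(\<lambda>k. of_bool (e k) / \<beta> ^ (k + 1)) sums
      (beta_val \<beta> (\<lambda>k. e (n + k)) / \<beta> ^ n + (\<Sum>k<n. of_bool (e k) / \<beta> ^ (k + 1)))"
    by (subst (asm) sums_iff_shift) (simp add: ac_simps)
  from sums_unique2[OF this beta_val_sums[OF assms]] show ?thesis by simp
qed

text \<open>Greedy expansion: \<open>r n\<close> is the remainder after n digits, scaled by
  \<beta>^n, and the next digit is 1 whenever the remainder can afford it. The bound \<beta> \<le> 2
  gives 1 \<le> 1 / (\<beta> - 1), which keeps the remainder in range after a digit 0.\<close>

lemma beta_val_onto:
  assumes "1 < \<beta>" "\<beta> \<le> 2" "0 \<le> y" "y \<le> 1 / (\<beta> - 1)"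
  shows "\<exists>e. beta_val \<beta> e = y"
proof -
  define r where "r = rec_nat y (\<lambda>_ z. \<beta> * z - of_bool (1 \<le> \<beta> * z))"
  define e where "e n \<longleftrightarrow> 1 \<le> \<beta> * r n" for n
  have r0: "r 0 = y" and rS: "r (Suc n) = \<beta> * r n - of_bool (e n)" for n
    by (simp_all add: r_def e_def)
  have inv: "0 \<le> r n \<and> r n \<le> 1 / (\<beta> - 1)" for n
  proof (induction n)
    case 0 then show ?case using assms r0 by simp
  next
    case (Suc n)
    have "1 \<le> 1 / (\<beta> - 1)" using assms by simp
    moreover have "\<beta> * r n \<le> \<beta> * (1 / (\<beta> - 1))"
      using Suc assms by (intro mult_left_mono) auto
    moreover have "\<beta> * (1 / (\<beta> - 1)) = 1 + 1 / (\<beta> - 1)" using assms by (simp add: field_simps)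
    moreover have "0 \<le> \<beta> * r n" using Suc assms by simp
    ultimately show ?case unfolding rS e_def by (simp only: of_bool_def split: if_split) linarith
  qed
  have part: "(\<Sum>k<n. of_bool (e k) / \<beta> ^ (k + 1)) = y - r n / \<beta> ^ n" for n
  proof (induction n)
    case (Suc n)
    have "r (Suc n) / \<beta> ^ Suc n = r n / \<beta> ^ n - of_bool (e n) / \<beta> ^ (n + 1)"
      using assms by (simp add: rS diff_divide_distrib)
    then show ?case using Suc by simp
  qed (simp add: r0)
  have "(\<lambda>n. r n / \<beta> ^ n) \<longlonglongrightarrow> 0"
  proof (rule Lim_null_comparison)
    have "(\<lambda>n. (1 / (\<beta> - 1)) * (1/\<beta>) ^ n) \<longlonglongrightarrow> (1 / (\<beta> - 1)) * 0"
      using assms by (intro tendsto_mult tendsto_const LIMSEQ_power_zero) auto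
    then show "(\<lambda>n. (1 / (\<beta> - 1)) * (1/\<beta>) ^ n) \<longlonglongrightarrow> 0" by simp
    show "\<forall>\<^sub>F n in sequentially. norm (r n / \<beta> ^ n) \<le> (1 / (\<beta> - 1)) * (1/\<beta>) ^ n"
    proof (intro always_eventually allI)
      fix n
      have "r n / \<beta> ^ n \<le> (1 / (\<beta> - 1)) / \<beta> ^ n"
        using inv[of n] assms by (intro divide_right_mono) auto
      then show "norm (r n / \<beta> ^ n) \<le> (1 / (\<beta> - 1)) * (1/\<beta>) ^ n"
        using inv[of n] assms by (simp add: power_one_over)
    qed
  qed
  then have "(\<lambda>n. y - r n / \<beta> ^ n) \<longlonglongrightarrow> y - 0" by (intro tendsto_diff tendsto_const)
  then have "(\<lambda>k. of_bool (e k) / \<beta> ^ (k + 1)) sums y" unfolding sums_def part by simp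
  then show ?thesis using sums_unique2[OF beta_val_sums[OF assms(1)]] by blast
qed

section \<open>Hausdorff dimension from Hoelder maps and from finite covers\<close>

lemma diam_power_le_gauge:
  assumes "U \<noteq> {}" "bounded U" "diameter U \<le> 1" "0 \<le> t" "t \<le> s" "0 < s"
  shows "ennreal (diameter U powr s) \<le> hausdorff_gauge t U"
proof -
  have d: "0 \<le> diameter U" using assms by (simp add: diameter_ge_0)
  show ?thesis
  proof (cases "t = 0")
    case True
    have "diameter U powr s \<le> 1" using d assms by (simp add: powr_le1)
    then show ?thesis using assms True by (simp add: hausdorff_gauge_def ennreal_le_1)
  next
    case False
    have "diameter U powr s \<le> diameter U powr t"
      using d assms False by (cases "diameter U = 0") (auto intro!: powr_mono')
    then show ?thesis using assms False by (simp add: hausdorff_gauge_def ennreal_leI)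
  qed
qed

text \<open>If the t-dimensional measure vanished for some t < s, there would be a cover whose
  images under \<open>g\<close> lie in intervals of total length below 1, although these intervals
  cover [0, 1].\<close>

lemma hausdorff_dim_ge_if_Hoelder_onto:
  fixes E E0 :: "'a::metric_space set" and g :: "'a \<Rightarrow> real"
  assumes s: "s > 0" and C: "C > 0" and sub: "E0 \<subseteq> E"
    and onto: "{0..1} \<subseteq> g ` E0"
    and holder: "\<And>x y. x \<in> E0 \<Longrightarrow> y \<in> E0 \<Longrightarrow> \<bar>g x - g y\<bar> \<le> C * dist x y powr s"
  shows "ereal s \<le> hausdorff_dim E"
  unfolding hausdorff_dim_def
proof (rule INF_greatest, clarsimp)
  fix t assume t: "0 \<le> t" "hausdorff_measure t E = 0"
  show "s \<le> t"
  proof (rule ccontr)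
    assume "\<not> s \<le> t"
    have "hausdorff_content t 1 E \<le> 0"
      unfolding t(2)[symmetric] hausdorff_measure_def by (rule SUP_upper) simp
    moreover have "0 < ennreal (1 / (2 * C))" using C by simp
    ultimately have "hausdorff_content t 1 E < ennreal (1 / (2 * C))" by (metis le_zero_eq)
    then obtain U :: "nat \<Rightarrow> 'a set" where U: "E \<subseteq> (\<Union>i. U i)" "\<And>i. bounded (U i)" "\<And>i. diameter (U i) \<le> 1"
      and lt: "(\<Sum>i. hausdorff_gauge t (U i)) < ennreal (1 / (2 * C))"
      unfolding hausdorff_content_def INF_less_iff by auto
    define l where "l i = C * diameter (U i) powr s" for i
    define x where "x i = (SOME x. x \<in> U i \<inter> E0)" for i
    \<comment> \<open>The image of \<open>U i \<inter> E0\<close> need not be measurable; an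
      interval around one image point, with the Hoelder bound as half-width, contains it.\<close>
    define J where "J i = (if U i \<inter> E0 = {} then {} else {g (x i) - l i .. g (x i) + l i})" for i
    have l0: "0 \<le> l i" for i using C by (simp add: l_def)
    have "{0..1} \<subseteq> (\<Union>i. J i)"
    proof
      fix y :: real assume "y \<in> {0..1}"
      then obtain z where z: "z \<in> E0" "y = g z" using onto by blast
      then obtain i where i: "z \<in> U i" using U sub by blast
      then have x: "x i \<in> U i \<inter> E0" unfolding x_def using z(1) by (metis (mono_tags, lifting) IntI someI)
      have "\<bar>g z - g (x i)\<bar> \<le> C * dist z (x i) powr s" using holder z x by blast
      also have "dist z (x i) \<le> diameter (U i)" using diameter_bounded_bound[OF U(2) i] x by auto
      then have "C * dist z (x i) powr s \<le> l i"
        unfolding l_def using C s by (intro mult_left_mono powr_mono2) auto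
      finally have "y \<in> J i" using x z by (auto simp: J_def abs_if split: if_splits)
      then show "y \<in> (\<Union>i. J i)" by blast
    qed
    then have "emeasure lborel {0..1::real} \<le> emeasure lborel (\<Union>i. J i)"
      by (intro emeasure_mono) (auto simp: J_def)
    also have "\<dots> \<le> (\<Sum>i. emeasure lborel (J i))"
      by (intro emeasure_subadditive_countably) (auto simp: J_def)
    also have "\<dots> \<le> (\<Sum>i. ennreal (2 * C) * hausdorff_gauge t (U i))"
    proof (intro suminf_le allI)
      fix i
      show "emeasure lborel (J i) \<le> ennreal (2 * C) * hausdorff_gauge t (U i)"
      proof (cases "U i \<inter> E0 = {}")
        case True then show ?thesis by (simp add: J_def)
      next
        case False
        then have "emeasure lborel (J i) = ennreal (2 * l i)" using l0[of i] by (simp add: J_def)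
        also have "\<dots> = ennreal (2 * C) * ennreal (diameter (U i) powr s)"
          using C by (simp add: l_def ennreal_mult[symmetric] mult.assoc)
        also have "\<dots> \<le> ennreal (2 * C) * hausdorff_gauge t (U i)"
          using False U t \<open>\<not> s \<le> t\<close> s by (intro mult_left_mono diam_power_le_gauge) auto
        finally show ?thesis .
      qed
    qed auto
    also have "\<dots> = ennreal (2 * C) * (\<Sum>i. hausdorff_gauge t (U i))" by simp
    also have "\<dots> < ennreal (2 * C) * ennreal (1 / (2 * C))"
      using C lt by (intro ennreal_mult_strict_left_mono) auto
    also have "\<dots> = 1" using C by (simp add: ennreal_mult[symmetric])
    finally show False by simp
  qed
qed

lemma first_difference:
  fixes a b :: "nat \<Rightarrow> 'b"
  assumes "a \<noteq> b"
  obtains n where "\<forall>i<n. a i = b i" "a n \<noteq> b n"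
proof -
  from assms obtain k where "a k \<noteq> b k" by blast
  then have "a (LEAST k. a k \<noteq> b k) \<noteq> b (LEAST k. a k \<noteq> b k)" by (rule LeastI)
  moreover have "\<forall>i<(LEAST k. a k \<noteq> b k). a i = b i"
  proof (intro allI impI)
    fix i assume "i < (LEAST k. a k \<noteq> b k)"
    from not_less_Least[OF this] show "a i = b i" by blast
  qed
  ultimately show ?thesis by (rule that[rotated])
qed

text \<open>Codes that agree before j have binary values within 1 / 2^j, and the exponent s = ln 2 /
  ln (1 / r) turns \<open>r ^ j\<close> into exactly that, so decoding followed by binary evaluation
  is Hoelder. Numbers with two binary expansions do no harm, since only surjectivity onto [0, 1] is
  needed.\<close>

lemma hausdorff_dim_pos_if_separated:
  fixes f :: "(nat \<Rightarrow> bool) \<Rightarrow> 'a::metric_space"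
  assumes c: "0 < c" and r: "0 < r" "r < 1" and sub: "range f \<subseteq> E"
    and sep: "\<And>e e' j. (\<forall>i<j. e i = e' i) \<Longrightarrow> e j \<noteq> e' j \<Longrightarrow> c * r ^ j \<le> dist (f e) (f e')"
  shows "0 < hausdorff_dim E"
proof -
  define s where "s = ln 2 / ln (1 / r)"
  have "0 < ln (1 / r)" using r by (intro ln_gt_zero) simp
  then have s: "0 < s" by (simp add: s_def)
  have "r powr s = 1 / 2"
    using r \<open>0 < ln (1 / r)\<close> by (simp add: powr_def s_def ln_div exp_minus)
  then have rs: "(r ^ j) powr s = 1 / 2 ^ j" for j
  proof (induction j)
    case (Suc j)
    have "(r ^ Suc j) powr s = r powr s * (r ^ j) powr s" using r by (simp add: powr_mult)
    then show ?case using Suc \<open>r powr s = 1 / 2\<close> by simp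
  qed (use r in simp)
  define g where "g x = beta_val 2 (inv_into UNIV f x)" for x
  have "inj f"
  proof (rule injI, rule ccontr)
    fix e e' assume "f e = f e'" "e \<noteq> e'"
    then obtain j where "\<forall>i<j. e i = e' i" "e j \<noteq> e' j" using first_difference[of e e'] by metis
    then have "c * r ^ j \<le> dist (f e) (f e')" by (rule sep)
    moreover have "0 < c * r ^ j" using c r by simp
    ultimately show False using \<open>f e = f e'\<close> by simp
  qed
  then have g: "g (f e) = beta_val 2 e" for e by (simp add: g_def)
  have "ereal s \<le> hausdorff_dim E"
  proof (rule hausdorff_dim_ge_if_Hoelder_onto[OF s _ sub])
    show "0 < (1 / c) powr s" using c by simp
    show "{0..1} \<subseteq> g ` range f"
    proof
      fix y :: real assume "y \<in> {0..1}"
      then obtain e where "beta_val 2 e = y" using beta_val_onto[of 2 y] by auto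
      then show "y \<in> g ` range f" using g[of e] by (intro image_eqI[of _ _ "f e"]) simp_all
    qed
    fix x y assume "x \<in> range f" "y \<in> range f"
    then obtain e e' where e: "x = f e" "y = f e'" by blast
    show "\<bar>g x - g y\<bar> \<le> (1 / c) powr s * dist x y powr s"
    proof (cases "e = e'")
      case True then show ?thesis using e by simp
    next
      case False
      then obtain j where j: "\<forall>i<j. e i = e' i" "e j \<noteq> e' j" using first_difference[of e e'] by metis
      have sum_eq: "(\<Sum>k<j. of_bool (e k) / 2 ^ (k + 1)) = (\<Sum>k<j. of_bool (e' k) / 2 ^ (k + 1) :: real)"
        using j by (intro sum.cong) auto
      have "\<bar>beta_val 2 (\<lambda>k. e (j + k)) - beta_val 2 (\<lambda>k. e' (j + k))\<bar> \<le> 1"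
        using beta_val_nonneg[of 2 "\<lambda>k. e (j + k)"] beta_val_le[of 2 "\<lambda>k. e (j + k)"]
          beta_val_nonneg[of 2 "\<lambda>k. e' (j + k)"] beta_val_le[of 2 "\<lambda>k. e' (j + k)"] by auto
      then have "\<bar>g x - g y\<bar> \<le> 1 / 2 ^ j"
        unfolding e g beta_val_split[of 2 e j, simplified] beta_val_split[of 2 e' j, simplified]
        using sum_eq by (simp add: diff_divide_distrib[symmetric] divide_right_mono)
      also have "\<dots> = (r ^ j) powr s" by (simp add: rs)
      also have "\<dots> \<le> (dist x y / c) powr s"
        using sep[OF j] c r s e by (intro powr_mono2) (auto simp: field_simps)
      also have "\<dots> = (1 / c) powr s * dist x y powr s"
        using c by (simp add: powr_divide)
      finally show ?thesis .
    qed
  qed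
  then show ?thesis using s by (metis ereal_less(2) less_le_trans)
qed

lemma hausdorff_dim_eq_0_if_finite_covers:
  fixes E :: "'a::metric_space set"
  assumes cov: "\<And>s \<delta> \<epsilon>. 0 < s \<Longrightarrow> 0 < \<delta> \<Longrightarrow> 0 < \<epsilon> \<Longrightarrow>
      \<exists>F. finite F \<and> E \<subseteq> \<Union>F \<and> (\<forall>U\<in>F. bounded U \<and> diameter U \<le> \<delta>) \<and> (\<Sum>U\<in>F. diameter U powr s) \<le> \<epsilon>"
  shows "hausdorff_dim E = 0"
proof (rule antisym)
  show "0 \<le> hausdorff_dim E" unfolding hausdorff_dim_def by (rule INF_greatest) auto
  have null: "hausdorff_measure s E = 0" if s: "0 < s" for s
  proof -
    have "hausdorff_content s \<delta> E \<le> 0" if "0 < \<delta>" for \<delta>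
    proof (rule ennreal_le_epsilon)
      fix \<epsilon> :: real assume "0 < \<epsilon>"
      then obtain F where F: "finite F" "E \<subseteq> \<Union>F" "\<forall>U\<in>F. bounded U \<and> diameter U \<le> \<delta>"
        "(\<Sum>U\<in>F. diameter U powr s) \<le> \<epsilon>" using cov[OF s \<open>0 < \<delta>\<close> \<open>0 < \<epsilon>\<close>] by auto
      obtain h where h: "bij_betw h {..<card F} F"
        using ex_bij_betw_nat_finite[OF F(1)] by (auto simp: atLeast0LessThan)
      \<comment> \<open>Padding by empty sets costs nothing, because their gauge is 0.\<close>
      define U where "U i = (if i < card F then h i else {})" for i
      have hF: "h i \<in> F" if "i < card F" for i using bij_betwE[OF h] that by auto
      have "hausdorff_content s \<delta> E \<le> (\<Sum>i. hausdorff_gauge s (U i))"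
        unfolding hausdorff_content_def
      proof (rule INF_lower, safe)
        fix x assume "x \<in> E"
        then obtain V where "V \<in> F" "x \<in> V" using F by blast
        moreover from \<open>V \<in> F\<close> obtain i where "i < card F" "h i = V"
          using h unfolding bij_betw_def by (metis (no_types, lifting) imageE lessThan_iff)
        ultimately show "x \<in> (\<Union>i. U i)" by (auto simp: U_def)
      next
        fix i show "bounded (U i)" "diameter (U i) \<le> \<delta>"
          using F(3) hF[of i] \<open>0 < \<delta>\<close> by (cases "i < card F"; simp add: U_def)+
      qed
      also have "\<dots> = (\<Sum>i<card F. hausdorff_gauge s (U i))"
        by (rule suminf_finite) (auto simp: U_def hausdorff_gauge_def)
      also have "\<dots> \<le> (\<Sum>i<card F. ennreal (diameter (h i) powr s))"
        using s by (intro sum_mono) (auto simp: U_def hausdorff_gauge_def)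
      also have "\<dots> = ennreal (\<Sum>i<card F. diameter (h i) powr s)" by simp
      also have "(\<Sum>i<card F. diameter (h i) powr s) = (\<Sum>U\<in>F. diameter U powr s)"
        by (rule sum.reindex_bij_betw[OF h])
      finally show "hausdorff_content s \<delta> E \<le> 0 + ennreal \<epsilon>"
        using F(4) by (simp add: ennreal_leI order_trans)
    qed
    then show ?thesis
      unfolding hausdorff_measure_def by (intro antisym SUP_least) auto
  qed
  show "hausdorff_dim E \<le> 0"
  proof (rule ccontr)
    assume "\<not> hausdorff_dim E \<le> 0"
    then obtain s where s: "0 < ereal s" "ereal s < hausdorff_dim E"
      using ereal_dense2[of 0 "hausdorff_dim E"] by (auto simp: not_le)
    then have "hausdorff_dim E \<le> ereal s"
      unfolding hausdorff_dim_def using null[of s] by (intro INF_lower) auto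
    then show False using s by simp
  qed
qed

section \<open>The Thue-Morse substitution and admissible sequences\<close>


definition tm :: "nat \<Rightarrow> bool" where
  "tm n \<longleftrightarrow> thue_morse n = 1"

text \<open>The substitution 0 -> 01, 1 -> 10 read letter by letter: place n belongs to the image of
  letter \<open>n div 2\<close>, which is copied at even places and complemented at odd
  ones.\<close>

definition subst_seq :: "(nat \<Rightarrow> bool) \<Rightarrow> nat \<Rightarrow> bool" where
  "subst_seq e n \<longleftrightarrow> e (n div 2) \<noteq> odd n"

text \<open>The tail after position \<open>n\<close>, complemented if \<open>e n\<close> holds, so that the lexicographic and numerical
  conditions on tails take the same form for both digits.\<close>

definition flips :: "(nat \<Rightarrow> bool) \<Rightarrow> nat \<Rightarrow> nat \<Rightarrow> bool" where
  "flips e n k \<longleftrightarrow> e (n + 1 + k) \<noteq> e n"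

definition lex_le :: "nat \<Rightarrow> (nat \<Rightarrow> bool) \<Rightarrow> (nat \<Rightarrow> bool) \<Rightarrow> bool" where
  "lex_le m x y \<longleftrightarrow> (\<forall>j<m. (\<forall>i<j. x i = y i) \<longrightarrow> x j \<longrightarrow> y j)"

text \<open>The sequence 1101 0011..., which is an expansion of 1 in base
  \<open>komornik_loreti\<close>.\<close>

abbreviation tm_tail :: "nat \<Rightarrow> bool" where
  "tm_tail \<equiv> \<lambda>k. tm (Suc k)"

text \<open>Lexicographic counterpart of \<open>beta_val \<beta> (flips e n) \<le> 1\<close> at
  \<beta> = \<open>komornik_loreti\<close>, cut off at depth m. Inductions run on the depth, because
  one substitution turns depth m into \<open>2 * m + 1\<close>.\<close>

definition admissible :: "nat \<Rightarrow> (nat \<Rightarrow> bool) \<Rightarrow> bool" where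
  "admissible m e \<longleftrightarrow> (\<forall>n. lex_le m (flips e n) tm_tail)"

definition const_then :: "nat \<Rightarrow> bool \<Rightarrow> (nat \<Rightarrow> bool) \<Rightarrow> nat \<Rightarrow> bool" where
  "const_then p d e i = (if i < p then d else e (i - p))"

lemma thue_morse_eq_of_bool: "thue_morse n = of_bool (tm n)"
proof -
  have "thue_morse n = 0 \<or> thue_morse n = 1"
  proof (cases "even n")
    case True
    then obtain k where "n = 2 * k" by blast
    then show ?thesis using thue_morse_fixed_point[of k] by (auto simp: thue_morse_subst_def split: if_splits)
  next
    case False
    then obtain k where "n = 2 * k + 1" by (blast elim: oddE)
    then show ?thesis using thue_morse_fixed_point[of k] by (auto simp: thue_morse_subst_def split: if_splits)
  qed
  then show ?thesis by (auto simp: tm_def)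
qed

lemma tm_0: "\<not> tm 0"
  by (simp add: tm_def thue_morse_0)

lemma tm_double: "tm (2 * n) = tm n" and tm_double_plus1: "tm (2 * n + 1) = (\<not> tm n)"
  using thue_morse_fixed_point[of n] unfolding tm_def
  by (simp_all add: thue_morse_subst_def thue_morse_eq_of_bool[of n] split: if_splits)

lemma subst_seq_tm: "subst_seq tm = tm"
proof
  fix n show "subst_seq tm n = tm n"
    using tm_double[of "n div 2"] tm_double_plus1[of "n div 2"]
    by (cases "even n") (auto simp: subst_seq_def)
qed

lemma tm_step: "tm n = (tm (n div 2) \<noteq> odd n)"
  using fun_cong[OF subst_seq_tm, of n] by (simp add: subst_seq_def)

lemma tm_values: "tm (Suc 0)" "tm 2" "\<not> tm 3" "tm 4" "\<not> tm 5" "\<not> tm 6"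
  using tm_0 by (simp_all add: tm_step[of 1] tm_step[of "Suc 0"] tm_step[of 2] tm_step[of 3] tm_step[of 4] tm_step[of 5]
      tm_step[of 6])

lemma tm_block: "r < 2 ^ n \<Longrightarrow> tm (2 ^ n * p + r) = (tm p \<noteq> tm r)"
proof (induction n arbitrary: r)
  case 0 then show ?case by (simp add: tm_0)
next
  case (Suc n)
  have eq: "2 ^ Suc n * p + r = 2 * (2 ^ n * p) + r" by simp
  have "(2 ^ Suc n * p + r) div 2 = 2 ^ n * p + r div 2" unfolding eq by (simp del: mult_2)
  then have "tm (2 ^ Suc n * p + r) = (tm (2 ^ n * p + r div 2) \<noteq> odd r)"
    by (subst tm_step) simp
  also have "\<dots> = ((tm p \<noteq> tm (r div 2)) \<noteq> odd r)" using Suc by simp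
  finally show ?case using tm_step[of r] by auto
qed

lemma tm_pow2: "tm (2 ^ n)"
  by (induction n) (use tm_values tm_double in auto)

lemma flips_shift: "flips e (p + n) = flips (\<lambda>i. e (p + i)) n"
  by (auto simp: flips_def add.assoc)

text \<open>At an even place the partner in the same pair always differs, which gives the leading 1;
  the rest is the substituted image of \<open>flips e n\<close>. By \<open>tm_tail_step\<close> the
  Thue-Morse tail obeys the same recursion, so comparisons at even places descend to
  \<open>e\<close>.\<close>

lemma flips_subst_even:
  "flips (subst_seq e) (2 * n) 0" "flips (subst_seq e) (2 * n) (Suc j) = (flips e n (j div 2) \<noteq> odd j)"
  by (auto simp: flips_def subst_seq_def)

lemma tm_tail_step: "tm_tail (Suc j) = (tm_tail (j div 2) \<noteq> odd j)"
  by (simp add: tm_step[of "Suc (Suc j)"])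

lemma admissible_mono: "admissible m e \<Longrightarrow> m' \<le> m \<Longrightarrow> admissible m' e"
  by (auto simp: admissible_def lex_le_def)

text \<open>At even places the comparison is the image of one for \<open>e\<close>, and second
  letters of pairs carry no information. At odd places \<open>flips\<close> begins with the two
  distinct letters of the next pair, hence not with 11, and so falls below the tail 1101... within
  two digits.\<close>

lemma admissible_subst:
  assumes "admissible m e"
  shows "admissible (2 * m + 1) (subst_seq e)"
  unfolding admissible_def lex_le_def
proof (intro allI impI)
  fix n j assume j: "j < 2 * m + 1" and eq: "\<forall>i<j. flips (subst_seq e) n i = tm_tail i"
    and fl: "flips (subst_seq e) n j"
  show "tm_tail j"
  proof (cases "even n")
    case True
    then obtain l where n: "n = 2 * l" by blast
    show ?thesis
    proof (cases j)
      case 0 then show ?thesis by (simp add: tm_values)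
    next
      case (Suc i)
      show ?thesis
      proof (cases "odd i")
        case True
        then have "i - 1 < i" "(i - 1) div 2 = i div 2" "even (i - 1)" by (auto elim: oddE)
        moreover have "flips (subst_seq e) n (Suc (i - 1)) = tm_tail (Suc (i - 1))"
          using eq Suc \<open>i - 1 < i\<close> by blast
        ultimately have "flips e l (i div 2) = tm_tail (i div 2)"
          unfolding n flips_subst_even tm_tail_step by simp
        then show ?thesis using fl unfolding Suc n flips_subst_even tm_tail_step by simp
      next
        case False
        have "flips e l k = tm_tail k" if "k < i div 2" for k
        proof -
          have "Suc (2 * k) < j" using that Suc by simp
          then have "flips (subst_seq e) n (Suc (2 * k)) = tm_tail (Suc (2 * k))" using eq by blast
          then show ?thesis unfolding n flips_subst_even tm_tail_step by simp
        qed
        moreover have "flips e l (i div 2)" using fl False unfolding Suc n flips_subst_even by simp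
        moreover have "i div 2 < m" using j Suc by simp
        ultimately have "tm_tail (i div 2)" using assms unfolding admissible_def lex_le_def by blast
        then show ?thesis using False unfolding Suc tm_tail_step by simp
      qed
    qed
  next
    case False
    then obtain l where n: "n = 2 * l + 1" by (blast elim: oddE)
    have fo: "flips (subst_seq e) n k = ((e (l + 1 + k div 2) \<noteq> odd k) = e l)" for k
      by (auto simp: flips_def subst_seq_def n)
    consider "j = 0" | "j = 1" | "2 \<le> j" by linarith
    then show ?thesis
    proof cases
      case 3
      then have "flips (subst_seq e) n 0" "flips (subst_seq e) n 1"
        using eq by (auto simp: tm_values simp flip: numeral_2_eq_2)
      then show ?thesis unfolding fo by auto
    qed (auto simp: tm_values simp flip: numeral_2_eq_2)
  qed
qed

lemma admissible_tm: "admissible m tm"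
proof (induction m)
  case (Suc m)
  have "admissible (2 * m + 1) tm" using admissible_subst[OF Suc] by (simp add: subst_seq_tm)
  then show ?case by (rule admissible_mono) simp
qed (simp add: admissible_def lex_le_def)

lemma admissible_shift: "admissible m e \<Longrightarrow> admissible m (\<lambda>i. e (p + i))"
  unfolding admissible_def flips_shift[symmetric] by blast

lemma admissible_unsubst:
  assumes "admissible (2 * m + 1) (subst_seq e)"
  shows "admissible m e"
  unfolding admissible_def lex_le_def
proof (intro allI impI)
  fix n j assume j: "j < m" and eq: "\<forall>i<j. flips e n i = tm_tail i" and fl: "flips e n j"
  have "flips (subst_seq e) (2 * n) i = tm_tail i" if "i < Suc (2 * j)" for i
  proof (cases i)
    case 0 then show ?thesis using flips_subst_even(1) by (simp add: tm_values)
  next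
    case (Suc k)
    then have "k div 2 < j" using that by simp
    then show ?thesis using eq unfolding Suc flips_subst_even tm_tail_step by simp
  qed
  moreover have "flips (subst_seq e) (2 * n) (Suc (2 * j))" using fl unfolding flips_subst_even by simp
  moreover have "Suc (2 * j) < 2 * m + 1" using j by simp
  ultimately have "tm_tail (Suc (2 * j))" using assms unfolding admissible_def lex_le_def by blast
  then show "tm_tail j" unfolding tm_tail_step by simp
qed

text \<open>The hypotheses force one of the factors \<open>0111\<close>, \<open>011011\<close>, \<open>0110101\<close> (or a complement), which
  exceed the Thue-Morse bound \<open>1101001\<dots>\<close>.\<close>

lemma admissible_no_odd_gap:
  assumes adm: "admissible 6 e" and i: "0 < i" "e (i - 1) \<noteq> e i" "e i = e (i + 1)"
    and alt: "\<And>l. i < l \<Longrightarrow> l < i + 1 + 2 * s \<Longrightarrow> e l \<noteq> e (l + 1)"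
    and j: "e (i + 1 + 2 * s) = e (i + 2 + 2 * s)"
  shows False
proof -
  define x where "x = flips e (i - 1)"
  have x: "x k = (e (i + k) = e i)" for k using i by (auto simp: x_def flips_def)
  have lex: "tm_tail l" if "l < 6" "\<And>k. k < l \<Longrightarrow> x k = tm_tail k" "x l" for l
    using adm that unfolding admissible_def lex_le_def x_def by blast
  have x01: "x 0" "x 1" using i by (simp_all add: x)
  have tt: "tm_tail 0" "tm_tail 1" "\<not> tm_tail 2" "tm_tail 3" "\<not> tm_tail 4" "\<not> tm_tail 5"
    using tm_values by (simp_all add: numeral_eq_Suc)
  have less: "k < 2 \<longleftrightarrow> k = 0 \<or> k = 1" "k < 4 \<longleftrightarrow> k = 0 \<or> k = 1 \<or> k = 2 \<or> k = 3"
    "k < 5 \<longleftrightarrow> k = 0 \<or> k = 1 \<or> k = 2 \<or> k = 3 \<or> k = 4" for k :: nat by auto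
  consider "s = 0" | "s = 1" | "2 \<le> s" by linarith
  then show False
  proof cases
    case 1
    then have "x 2" using i j by (simp add: x)
    moreover have "x k = tm_tail k" if "k < 2" for k
      using x01 tt that by (auto simp: less(1))
    ultimately show False using lex[of 2] tt by auto
  next
    case 2
    have "e (i + 1) \<noteq> e (i + 2)" "e (i + 2) \<noteq> e (i + 3)"
      using alt[of "i + 1"] alt[of "i + 2"] 2 by (simp_all add: numeral_eq_Suc)
    then have "\<not> x 2" "x 3" "x 4" using i j 2 by (auto simp: x numeral_eq_Suc)
    moreover from this have "x k = tm_tail k" if "k < 4" for k
      using x01 tt that by (auto simp: less(2))
    ultimately show False using lex[of 4] tt by auto
  next
    case 3
    have "e (i + 1) \<noteq> e (i + 2)" "e (i + 2) \<noteq> e (i + 3)" "e (i + 3) \<noteq> e (i + 4)" "e (i + 4) \<noteq> e (i + 5)"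
      using alt[of "i + 1"] alt[of "i + 2"] alt[of "i + 3"] alt[of "i + 4"] 3 by (simp_all add: numeral_eq_Suc)
    then have "\<not> x 2" "x 3" "\<not> x 4" "x 5" using i by (auto simp: x)
    moreover from this have "x k = tm_tail k" if "k < 5" for k
      using x01 tt that by (auto simp: less(3))
    ultimately show False using lex[of 5] tt by auto
  qed
qed

text \<open>Two equal adjacent letters cannot form a pair of the substitution. After the initial
  constant run all such places have the same parity, because \<open>admissible_no_odd_gap\<close>
  excludes two successive ones at odd distance; the sequence is then cut into pairs at the other
  parity.\<close>

lemma admissible_desubst:
  assumes adm: "\<And>m. admissible m e" and nonconst: "e k0 \<noteq> e 0"
  shows "\<exists>p d e'. (\<forall>m. admissible m e') \<and> e = const_then p d (subst_seq e')"
proof -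
  define k where "k = (LEAST k. e k \<noteq> e 0)"
  have k: "e k \<noteq> e 0" unfolding k_def by (rule LeastI[of _ k0]) (rule nonconst)
  have bk: "e i = e 0" if "i < k" for i using not_less_Least[of i "\<lambda>k. e k \<noteq> e 0"] that by (auto simp: k_def)
  have k0: "0 < k" using k by (cases k) auto
  define D where "D i \<longleftrightarrow> k \<le> i \<and> e i = e (i + 1)" for i
  have same_parity: "even i = even j" if "D i" "D j" for i j
  proof (rule ccontr)
    assume par: "even i \<noteq> even j"
    define a where "a = (LEAST a. D a)"
    have a: "D a" "\<And>l. D l \<Longrightarrow> a \<le> l" unfolding a_def using \<open>D i\<close> by (auto intro: LeastI Least_le)
    \<comment> \<open>From two doubled letters of different parity, take the first one, b, whose
      parity differs from that of the very first, and the last doubled letter c before it: between c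
      and b the letters alternate, and the distance is odd.\<close>
    define b where "b = (LEAST b. D b \<and> even b \<noteq> even a)"
    have ex: "\<exists>b. D b \<and> even b \<noteq> even a" using that par by metis
    have b: "D b" "even b \<noteq> even a" using LeastI_ex[OF ex] unfolding b_def by auto
    have bmin: "even l = even a" if "D l" "l < b" for l
      using not_less_Least[of l "\<lambda>b. D b \<and> even b \<noteq> even a"] that by (auto simp: b_def)
    have "a < b" using a(2)[OF b(1)] b(2) by (cases "a = b") auto
    define c where "c = Max {l. D l \<and> l < b}"
    have fin: "finite {l. D l \<and> l < b}" by simp
    have "c \<in> {l. D l \<and> l < b}" unfolding c_def using \<open>a < b\<close> a(1) by (intro Max_in fin) auto
    then have c: "D c" "c < b" by auto
    have "l \<le> c" if "D l" "l < b" for l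
      unfolding c_def using that by (intro Max_ge[OF fin]) auto
    then have cmax: "\<not> D l" if "c < l" "l < b" for l using that by (meson not_less)
    have kc: "k \<le> c" using c by (simp add: D_def)
    have "e (c - 1) \<noteq> e c"
    proof
      assume eq: "e (c - 1) = e c"
      show False
      proof (cases "c = k")
        case True then show False using eq bk[of "k - 1"] k k0 by auto
      next
        case False
        then have "D (c - 1)" using eq kc k0 by (auto simp: D_def)
        then have "even (c - 1) = even a" using bmin[of "c - 1"] c by auto
        moreover have "even c = even a" using bmin[of c] c by auto
        ultimately show False using kc k0 by (cases c) auto
      qed
    qed
    moreover have "even c = even a" using bmin[of c] c by auto
    then have "odd (b - c)" using b c by auto
    then obtain s where "b - c = 2 * s + 1" by (blast elim: oddE)
    then have s: "b = c + 1 + 2 * s" using c by simp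
    moreover have "e l \<noteq> e (l + 1)" if "c < l" "l < c + 1 + 2 * s" for l
      using cmax[of l] that s kc by (auto simp: D_def)
    moreover have "0 < c" "e c = e (c + 1)" using kc k0 c(1) by (auto simp: D_def)
    moreover have "e (c + 1 + 2 * s) = e (c + 2 + 2 * s)" using b(1) by (simp add: s D_def)
    ultimately show False using admissible_no_odd_gap[OF adm, of c s] by blast
  qed
  \<comment> \<open>Pairs start at \<open>k - 1\<close> if a doubled letter occurs at even distance
    from \<open>k\<close>, and at \<open>k\<close> otherwise. In the first case the pair at
    \<open>k - 1\<close> is the first change of letters itself.\<close>
  obtain p where p: "p \<le> k" "k \<le> Suc p" "\<And>n. e (p + 2 * n) \<noteq> e (p + 2 * n + 1)"
  proof (cases "\<exists>n. D (k + 2 * n)")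
    case True
    then obtain n where n: "D (k + 2 * n)" by blast
    have "e (k - 1 + 2 * l) \<noteq> e (k - 1 + 2 * l + 1)" for l
    proof (cases "l = 0")
      case True then show ?thesis using k bk[of "k - 1"] k0 by simp
    next
      case False
      then have "\<not> D (k - 1 + 2 * l)" using same_parity[OF n, of "k - 1 + 2 * l"] k0 by (cases k) auto
      then show ?thesis using False by (auto simp: D_def)
    qed
    then show ?thesis using that[of "k - 1"] k0 by auto
  next
    case False
    then show ?thesis using that[of k] by (auto simp: D_def)
  qed
  define e' where "e' n = e (p + 2 * n)" for n
  have sub: "subst_seq e' n = e (p + n)" for n
  proof (cases "even n")
    case True then show ?thesis by (auto simp: subst_seq_def e'_def)
  next
    case False
    then obtain l where "n = 2 * l + 1" by (blast elim: oddE)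
    then show ?thesis using p(3)[of l] by (auto simp: subst_seq_def e'_def)
  qed
  have "admissible m e'" for m
    by (rule admissible_unsubst) (use admissible_shift[OF adm, of "2 * m + 1" p] in \<open>simp add: sub[abs_def]\<close>)
  moreover have "e = const_then p (e 0) (subst_seq e')"
  proof
    fix i show "e i = const_then p (e 0) (subst_seq e') i"
      using p(1) bk[of i] by (cases "i < p") (simp_all add: const_then_def sub)
  qed
  ultimately show ?thesis by (intro exI[of _ p] exI[of _ "e 0"] exI[of _ e'] conjI allI)
qed

section \<open>Unique expansions in base \<open>\<beta>\<close>\<close>


text \<open>Switching digit n changes the value by \<beta>^-(n+1), and later digits can compensate
  at most \<open>beta_val \<beta> (flips e n)\<close> times that amount. The condition thus forces a
  unique expansion; \<open>not_univoque_ambiguous\<close> shows that it is also necessary for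
  \<beta> \<le> 2.\<close>

definition univoque :: "real \<Rightarrow> (nat \<Rightarrow> bool) set" where
  "univoque \<beta> = {e. \<forall>n. beta_val \<beta> (flips e n) < 1}"

lemma beta_val_mono:
  assumes "1 < \<beta>" "\<And>k. x k \<Longrightarrow> y k"
  shows "beta_val \<beta> x \<le> beta_val \<beta> y"
  by (rule sums_le[OF _ beta_val_sums beta_val_sums]) (use assms in \<open>auto intro!: divide_right_mono\<close>)

lemma beta_val_pos:
  assumes "1 < \<beta>" "x k"
  shows "0 < beta_val \<beta> x"
proof -
  have "0 < 1 / \<beta> ^ (k + 1)" using assms by simp
  also have "\<dots> \<le> beta_val \<beta> x"
  proof -
    have "sum (\<lambda>k. of_bool (x k) / \<beta> ^ (k + 1)) {k} \<le> (\<Sum>k. of_bool (x k) / \<beta> ^ (k + 1))"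
      by (rule sum_le_suminf[OF summable_beta_val]) (use assms in auto)
    then show ?thesis using assms by (simp add: beta_val_def)
  qed
  finally show ?thesis .
qed

text \<open>One power of the base already yields the factor \<beta> / \<gamma>. It turns values at
  most 1 in base \<beta> into a uniform bound below 1 in a larger base.\<close>

lemma beta_val_scale:
  assumes "1 < \<beta>" "\<beta> \<le> \<gamma>"
  shows "beta_val \<gamma> x \<le> (\<beta> / \<gamma>) * beta_val \<beta> x"
proof -
  have "(\<lambda>k. (\<beta> / \<gamma>) * (of_bool (x k) / \<beta> ^ (k + 1))) sums ((\<beta> / \<gamma>) * beta_val \<beta> x)"
    by (intro sums_mult beta_val_sums assms)
  moreover have "(\<lambda>k. of_bool (x k) / \<gamma> ^ (k + 1)) sums beta_val \<gamma> x"
    using assms by (intro beta_val_sums) auto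
  moreover have le: "of_bool (x k) / \<gamma> ^ (k + 1) \<le> (\<beta> / \<gamma>) * (of_bool (x k) / \<beta> ^ (k + 1))" for k
  proof -
    have "1 / \<gamma> ^ k \<le> 1 / \<beta> ^ k" using assms by (intro divide_left_mono power_mono mult_pos_pos) auto
    then have "1 / \<gamma> ^ k / \<gamma> \<le> 1 / \<beta> ^ k / \<gamma>" using assms by (intro divide_right_mono) auto
    then show ?thesis using assms by (simp add: field_simps)
  qed
  ultimately show ?thesis using sums_le[OF le] by simp
qed

lemma beta_val_strict_antimono:
  assumes "1 < \<beta>" "\<beta> < \<gamma>" "x k"
  shows "beta_val \<gamma> x < beta_val \<beta> x"
proof -
  have "beta_val \<gamma> x \<le> (\<beta> / \<gamma>) * beta_val \<beta> x" using assms by (intro beta_val_scale) auto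
  also have "\<dots> < 1 * beta_val \<beta> x"
    using assms beta_val_pos[of \<beta> x k] by (intro mult_strict_right_mono) auto
  finally show ?thesis by simp
qed

lemma beta_val_antimono: "1 < \<beta> \<Longrightarrow> \<beta> \<le> \<gamma> \<Longrightarrow> beta_val \<gamma> x \<le> beta_val \<beta> x"
  using beta_val_strict_antimono[of \<beta> \<gamma> x]
  by (cases "\<exists>k. x k") (force simp: beta_val_def)+

section \<open>The Komornik-Loreti constant as a root\<close>

lemma komornik_loreti_sums_iff:
  assumes "1 < x"
  shows "(\<lambda>n. real (thue_morse n) / x ^ n) sums 1 \<longleftrightarrow> beta_val x tm_tail = 1"
proof -
  have "(\<lambda>n. real (thue_morse n) / x ^ n) sums 1 \<longleftrightarrow> (\<lambda>k. of_bool (tm_tail k) / x ^ (k + 1)) sums 1"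
    using sums_Suc_iff[of "\<lambda>n. real (thue_morse n) / x ^ n" 1] by (simp add: thue_morse_eq_of_bool tm_0)
  also have "\<dots> \<longleftrightarrow> beta_val x tm_tail = 1"
    using beta_val_sums[OF assms, of tm_tail] sums_unique2 by metis
  finally show ?thesis .
qed

lemma ex1_komornik_loreti: "\<exists>!x. 1 < x \<and> beta_val x tm_tail = 1" and ex_komornik_loreti_le_2:
  "\<exists>x. 1 < x \<and> x \<le> 2 \<and> beta_val x tm_tail = 1"
proof -
  \<comment> \<open>As a power series in z = 1 / x the function is continuous and reaches 1 between
    z = 1/2 and z = 2/3: at 2/3 the first two letters of the tail already give 2/3 + 4/9 >
    1.\<close>
  define h where "h z = (\<Sum>n. of_bool (tm n) * z ^ n)" for z :: real
  have h: "h (1 / x) = beta_val x tm_tail" if "1 < x" for x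
  proof -
    have "(\<lambda>k. of_bool (tm_tail k) * (1 / x) ^ Suc k) sums beta_val x tm_tail"
      using beta_val_sums[OF that, of tm_tail] by (simp add: power_one_over field_simps)
    then have "(\<lambda>n. of_bool (tm n) * (1 / x) ^ n) sums beta_val x tm_tail"
      by (subst (asm) sums_Suc_iff) (simp add: tm_0)
    then show ?thesis unfolding h_def by (rule sums_unique[symmetric])
  qed
  have "isCont h z" if "1/2 \<le> z" "z \<le> 2/3" for z
    unfolding h_def
  proof (rule isCont_powser)
    show "summable (\<lambda>n. of_bool (tm n) * (3/4 :: real) ^ n)"
      by (rule summable_comparison_test'[OF summable_geometric[of "3/4 :: real"]]) auto
  qed (use that in auto)
  moreover have "h (1/2) \<le> 1" using h[of 2] beta_val_le[of 2 tm_tail] by simp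
  moreover have "1 \<le> h (2/3)"
  proof -
    have "h (2/3) = beta_val (3/2) tm_tail" using h[of "3/2"] by simp
    also have "\<dots> = 2/3 + (4/9) + beta_val (3/2) (\<lambda>k. tm_tail (2 + k)) / (3/2)\<^sup>2"
      using beta_val_split[of "3/2" tm_tail 2] tm_values by (simp add: numeral_2_eq_2 power2_eq_square)
    also have "1 \<le> \<dots>"
      using divide_nonneg_nonneg[OF beta_val_nonneg[of "3/2" "\<lambda>k. tm_tail (2 + k)"], of "(3/2)\<^sup>2"] by auto
    finally show ?thesis .
  qed
  ultimately obtain z where z: "1/2 \<le> z" "z \<le> 2/3" "h z = 1"
    using IVT[of h "1/2" 1 "2/3"] by auto
  then show *: "\<exists>x. 1 < x \<and> x \<le> 2 \<and> beta_val x tm_tail = 1"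
    using h[of "1/z"] by (intro exI[of _ "1/z"]) (auto simp: field_simps)
  show "\<exists>!x. 1 < x \<and> beta_val x tm_tail = 1"
  proof (rule ex_ex1I)
    fix x y assume "1 < x \<and> beta_val x tm_tail = 1" "1 < y \<and> beta_val y tm_tail = 1"
    then show "x = y"
      using beta_val_strict_antimono[of x y tm_tail 0] beta_val_strict_antimono[of y x tm_tail 0] tm_values
      by (cases x y rule: linorder_cases) auto
  qed (use * in blast)
qed

lemma komornik_loreti:
  "1 < komornik_loreti" "komornik_loreti \<le> 2" "beta_val komornik_loreti tm_tail = 1"
proof -
  have "komornik_loreti = (THE x. 1 < x \<and> beta_val x tm_tail = 1)"
    unfolding komornik_loreti_def by (rule arg_cong[of _ _ The]) (use komornik_loreti_sums_iff in blast)
  then show "1 < komornik_loreti" "beta_val komornik_loreti tm_tail = 1" "komornik_loreti \<le> 2"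
    using theI'[OF ex1_komornik_loreti] ex1_komornik_loreti ex_komornik_loreti_le_2 by auto
qed

text \<open>Comparing \<open>flips e n\<close> with the Thue-Morse tail at the first difference bounds the excess
  over 1 by a fraction of the excess at a later position, so it vanishes.\<close>

lemma beta_val_flips_admissible:
  assumes adm: "\<And>m. admissible m e"
  shows "beta_val komornik_loreti (flips e n) \<le> 1"
    and "flips e n \<noteq> tm_tail \<Longrightarrow> beta_val komornik_loreti (flips e n) < 1"
proof -
  let ?b = komornik_loreti
  note b = komornik_loreti
  have decomp: "\<exists>j T. 0 < T \<and> beta_val ?b (flips e n) = 1 - (1 + T - beta_val ?b (flips e (n + 1 + j))) / ?b ^ (j + 1)"
    if ne: "flips e n \<noteq> tm_tail" for n
  proof -
    define j where "j = (LEAST j. flips e n j \<noteq> tm_tail j)"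
    have "\<exists>j. flips e n j \<noteq> tm_tail j" using ne by blast
    then have dj: "flips e n j \<noteq> tm_tail j" unfolding j_def by (rule LeastI_ex)
    have agree: "flips e n i = tm_tail i" if "i < j" for i
      using not_less_Least[of i "\<lambda>j. flips e n j \<noteq> tm_tail j"] that by (auto simp: j_def)
    have "\<not> flips e n j"
      using adm[of "Suc j"] dj agree unfolding admissible_def lex_le_def by blast
    then have fj: "\<not> flips e n j" "tm_tail j" using dj by auto
    \<comment> \<open>At the first difference \<open>flips e n\<close> has a 0, so its continuation
      is again of the form \<open>flips\<close>, taken at that later position.\<close>
    have sh: "(\<lambda>k. flips e n (j + 1 + k)) = flips e (n + 1 + j)"
      using fj(1) by (auto simp: flips_def add_ac)
    define T where "T = beta_val ?b (\<lambda>k. tm_tail (j + 1 + k))"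
    \<comment> \<open>The tail has ones at all places 2^l - 1, so what follows j has a positive
      value T.\<close>
    obtain l where "j + 2 \<le> (2::nat) ^ l" using less_exp[of "j + 2"] by (meson less_imp_le)
    then have eq: "Suc (j + 1 + (2 ^ l - (j + 2))) = 2 ^ l" by simp
    have "tm_tail (j + 1 + (2 ^ l - (j + 2)))" using tm_pow2[of l] by (simp only: eq)
    then have T: "0 < T" unfolding T_def using b by (intro beta_val_pos) auto
    have "(\<Sum>k<j. of_bool (flips e n k) / ?b ^ (k + 1)) = (\<Sum>k<j. of_bool (tm_tail k) / ?b ^ (k + 1))"
      using agree by (intro sum.cong) auto
    then have "beta_val ?b (flips e n) = (\<Sum>k<j. of_bool (tm_tail k) / ?b ^ (k + 1)) + beta_val ?b (flips e (n + 1 + j)) / ?b ^ (j + 1)"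
      using beta_val_split[OF b(1), of "flips e n" "j + 1"] fj unfolding sh by simp
    moreover have "1 = (\<Sum>k<j. of_bool (tm_tail k) / ?b ^ (k + 1)) + 1 / ?b ^ (j + 1) + T / ?b ^ (j + 1)"
      using beta_val_split[OF b(1), of tm_tail "j + 1"] fj unfolding b(3) T_def by simp
    ultimately have "beta_val ?b (flips e n) = 1 - (1 + T - beta_val ?b (flips e (n + 1 + j))) / ?b ^ (j + 1)"
      by (simp add: diff_divide_distrib add_divide_distrib)
    then show ?thesis using T by blast
  qed
  \<comment> \<open>B is the trivial bound for all values; each passage to a later position gains a
    factor at least 1 / \<open>komornik_loreti\<close>, so the excess over 1 is at most B times any
    power of it.\<close>
  define B where "B = 1 / (?b - 1)"
  have B: "0 < B" using b by (simp add: B_def)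
  have approx: "beta_val ?b (flips e n) \<le> 1 + B / ?b ^ k" for n k
  proof (induction k arbitrary: n)
    case 0
    then show ?case using beta_val_le[OF b(1), of "flips e n"] by (simp add: B_def)
  next
    case (Suc k)
    show ?case
    proof (cases "flips e n = tm_tail")
      case True then show ?thesis using b B by simp
    next
      case False
      then obtain j T where T: "0 < T" and
        eq: "beta_val ?b (flips e n) = 1 - (1 + T - beta_val ?b (flips e (n + 1 + j))) / ?b ^ (j + 1)"
        using decomp by blast
      have "- (1 + T - beta_val ?b (flips e (n + 1 + j))) \<le> B / ?b ^ k"
        using Suc[of "n + 1 + j"] T by linarith
      then have "- (1 + T - beta_val ?b (flips e (n + 1 + j))) / ?b ^ (j + 1) \<le> B / ?b ^ k / ?b ^ (j + 1)"
        using b by (intro divide_right_mono) auto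
      also have "\<dots> \<le> B / ?b ^ k / ?b ^ 1"
        using b B by (intro divide_left_mono power_increasing) (auto intro!: mult_pos_pos)
      finally have "- ((1 + T - beta_val ?b (flips e (n + 1 + j))) / ?b ^ (j + 1)) \<le> B / ?b ^ Suc k"
        by (simp only: minus_divide_left power_Suc power_one_right divide_divide_eq_left mult.commute)
      then show ?thesis unfolding eq by linarith
    qed
  qed
  have le: "beta_val ?b (flips e n) \<le> 1" for n
  proof (rule LIMSEQ_le_const)
    have "(\<lambda>k. 1 + B * (1 / ?b) ^ k) \<longlonglongrightarrow> 1 + B * 0"
      using b by (intro tendsto_add tendsto_mult tendsto_const LIMSEQ_power_zero) auto
    then show "(\<lambda>k. 1 + B / ?b ^ k) \<longlonglongrightarrow> 1" by (simp add: power_one_over)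
  qed (use approx in auto)
  then show "beta_val ?b (flips e n) \<le> 1" .
  assume "flips e n \<noteq> tm_tail"
  then obtain j T where T: "0 < T" and
    eq: "beta_val ?b (flips e n) = 1 - (1 + T - beta_val ?b (flips e (n + 1 + j))) / ?b ^ (j + 1)"
    using decomp by blast
  have "0 < (1 + T - beta_val ?b (flips e (n + 1 + j))) / ?b ^ (j + 1)"
    using T le[of "n + 1 + j"] b by (intro divide_pos_pos) auto
  then show "beta_val ?b (flips e n) < 1" unfolding eq by simp
qed

text \<open>At a first violation \<open>flips e n\<close> has a 1 against a 0 of the Thue-Morse
  tail. What follows that 0 in the tail is itself a \<open>flips\<close> of \<open>tm\<close>, of
  value at most 1, so the extra 1 makes up for it: \<open>flips e n\<close> has value at least 1 in
  base \<open>komornik_loreti\<close>, hence in every smaller base.\<close>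

lemma univoque_admissible:
  assumes \<beta>: "1 < \<beta>" "\<beta> \<le> komornik_loreti" and e: "e \<in> univoque \<beta>"
  shows "admissible m e"
  unfolding admissible_def lex_le_def
proof (intro allI impI, rule ccontr)
  let ?b = komornik_loreti
  fix n j assume eq: "\<forall>i<j. flips e n i = tm_tail i" and fl: "flips e n j" and ntm: "\<not> tm_tail j"
  have "flips tm (Suc j) = (\<lambda>k. tm_tail (j + 1 + k))" using ntm by (auto simp: flips_def add_ac)
  then have le1: "beta_val ?b (\<lambda>k. tm_tail (j + 1 + k)) \<le> 1"
    using beta_val_flips_admissible(1)[OF admissible_tm, of "Suc j"] by simp
  define x where "x k \<longleftrightarrow> k < j \<and> tm_tail k \<or> k = j" for k
  have "1 = (\<Sum>k<j. of_bool (tm_tail k) / ?b ^ (k + 1)) + beta_val ?b (\<lambda>k. tm_tail (j + 1 + k)) / ?b ^ (j + 1)"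
    using beta_val_split[OF komornik_loreti(1), of tm_tail "j + 1"] ntm unfolding komornik_loreti(3) by simp
  also have "\<dots> \<le> (\<Sum>k<j. of_bool (tm_tail k) / ?b ^ (k + 1)) + 1 / ?b ^ (j + 1)"
    using le1 komornik_loreti(1) by (intro add_left_mono divide_right_mono) auto
  also have "\<dots> = beta_val ?b x"
  proof -
    have "beta_val ?b (\<lambda>k. x (j + 1 + k)) = 0" by (simp add: x_def beta_val_def)
    then show ?thesis
      using beta_val_split[OF komornik_loreti(1), of x "j + 1"] by (simp add: x_def)
  qed
  also have "\<dots> \<le> beta_val \<beta> x" by (rule beta_val_antimono[OF \<beta>])
  also have "\<dots> \<le> beta_val \<beta> (flips e n)"
    using eq fl by (intro beta_val_mono \<beta>) (auto simp: x_def)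
  finally show False using e unfolding univoque_def by (auto simp: not_less[symmetric])
qed

section \<open>Unique expansions below the Komornik-Loreti constant\<close>

lemma const_in_univoque: "(\<lambda>_. d) \<in> univoque \<beta>"
  by (simp add: univoque_def flips_def beta_val_def)

lemma beta_val_even:
  assumes "1 < \<beta>"
  shows "beta_val \<beta> even = \<beta> / (\<beta>\<^sup>2 - 1)"
proof -
  have "1 < \<beta>\<^sup>2" using assms by (simp add: one_less_power)
  moreover have "beta_val \<beta> even = 1 / \<beta> + beta_val \<beta> odd / \<beta>"
    by (subst beta_val_split[OF assms, of even 1]) simp
  moreover have "beta_val \<beta> odd = beta_val \<beta> even / \<beta>"
    by (subst beta_val_split[OF assms, of odd 1]) simp
  moreover from this have "beta_val \<beta> odd / \<beta> = beta_val \<beta> even / \<beta>\<^sup>2"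
    by (simp only: power2_eq_square divide_divide_eq_left)
  ultimately have "1 < \<beta>\<^sup>2" "beta_val \<beta> even = 1 / \<beta> + beta_val \<beta> even / \<beta>\<^sup>2" by linarith+
  then show ?thesis using assms by (simp add: field_simps power2_eq_square)
qed

lemma golden_ratio_square: "golden_ratio\<^sup>2 = golden_ratio + 1" "1 < golden_ratio"
  by (auto simp: golden_ratio_def power2_eq_square field_simps)

lemma golden_ratio_le_iff:
  assumes "1 < \<beta>"
  shows "\<beta> \<le> golden_ratio \<longleftrightarrow> \<beta>\<^sup>2 \<le> \<beta> + 1"
proof -
  have "(\<beta> - golden_ratio) * (\<beta> + golden_ratio - 1) = \<beta>\<^sup>2 - \<beta> - 1"
    using golden_ratio_square by (simp add: algebra_simps power2_eq_square)
  then have "\<beta>\<^sup>2 \<le> \<beta> + 1 \<longleftrightarrow> (\<beta> - golden_ratio) * (\<beta> + golden_ratio - 1) \<le> 0" by linarith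
  also have "\<dots> \<longleftrightarrow> \<beta> - golden_ratio \<le> 0"
    using assms golden_ratio_square(2) by (simp add: mult_le_0_iff)
  finally show ?thesis by simp
qed

lemma ex_change:
  fixes e :: "nat \<Rightarrow> 'b"
  assumes "e \<noteq> (\<lambda>_. e 0)"
  shows "\<exists>q. e (Suc q) \<noteq> e q"
proof (rule ccontr)
  assume "\<nexists>q. e (Suc q) \<noteq> e q"
  then have "e n = e 0" for n by (induction n) auto
  then show False using assms by blast
qed

text \<open>If two equal letters follow a change, \<open>flips\<close> starts with 11 and has value
  at least 1 / \<beta> + 1 / \<beta>^2 \<ge> 1. So one change forces the next for ever, and then
  \<open>flips\<close> is 1010..., whose value \<beta> / (\<beta>^2 - 1) is again at least
  1.\<close>

lemma univoque_trivial:
  assumes \<beta>: "1 < \<beta>" "\<beta> \<le> golden_ratio" and e: "e \<in> univoque \<beta>"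
  shows "e = (\<lambda>_. e 0)"
proof (rule ccontr)
  have sq: "\<beta>\<^sup>2 \<le> \<beta> + 1" using golden_ratio_le_iff \<beta> by simp
  assume "e \<noteq> (\<lambda>_. e 0)"
  from ex_change[OF this] obtain q where q: "e (Suc q) \<noteq> e q" by blast
  have step: "e (Suc (Suc n)) \<noteq> e (Suc n)" if "e (Suc n) \<noteq> e n" for n
  proof
    assume "e (Suc (Suc n)) = e (Suc n)"
    then have "flips e n 0" "flips e n 1" using that by (auto simp: flips_def)
    then have "1 / \<beta> + 1 / \<beta>\<^sup>2 \<le> beta_val \<beta> (flips e n)"
      using beta_val_split[OF \<beta>(1), of "flips e n" 2] beta_val_nonneg[OF \<beta>(1)] \<beta>(1)
      by (simp add: numeral_2_eq_2)
    moreover have "1 \<le> 1 / \<beta> + 1 / \<beta>\<^sup>2" using sq \<beta> by (simp add: field_simps power2_eq_square)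
    moreover have "beta_val \<beta> (flips e n) < 1" using e by (simp add: univoque_def)
    ultimately show False by linarith
  qed
  have "e (q + Suc k) \<noteq> e (q + k)" for k
    by (induction k) (use q step in auto)
  then have alt: "e (q + k) = (e q = even k)" for k
    by (induction k) auto
  have "flips e q k = even k" for k using alt[of "Suc k"] by (auto simp: flips_def)
  then have "flips e q = even" by blast
  moreover have "beta_val \<beta> (flips e q) < 1" using e by (simp add: univoque_def)
  ultimately have "\<beta> / (\<beta>\<^sup>2 - 1) < 1" using beta_val_even[OF \<beta>(1)] by simp
  moreover have "1 < \<beta>\<^sup>2" using \<beta> by (simp add: one_less_power)
  ultimately show False using sq by (simp add: field_simps)
qed

text \<open>The sequences 0^k 0101... serve: their \<open>flips\<close> are 1010... or 0^p 0101...,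
  and above \<open>golden_ratio\<close> both have value below 1.\<close>

lemma infinite_univoque:
  assumes "golden_ratio < \<beta>"
  shows "infinite (univoque \<beta>)"
proof -
  have \<beta>: "1 < \<beta>" using assms golden_ratio_square by simp
  have "1 < \<beta>\<^sup>2" using \<beta> by (simp add: one_less_power)
  then have ev: "beta_val \<beta> even < 1"
    using golden_ratio_le_iff[OF \<beta>] assms by (simp add: beta_val_even[OF \<beta>] divide_simps)
  have "beta_val \<beta> odd = beta_val \<beta> even / \<beta>"
    using beta_val_split[OF \<beta>, of odd 1] by simp
  also have "\<dots> \<le> beta_val \<beta> even"
    using \<beta> beta_val_nonneg[OF \<beta>, of even] by (simp add: divide_le_eq mult_le_cancel_left1)
  finally have od: "beta_val \<beta> odd < 1" using ev by simp
  define x where "x k = const_then k False odd" for k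
  have "x k \<in> univoque \<beta>" for k
    unfolding univoque_def mem_Collect_eq
  proof
    fix n
    show "beta_val \<beta> (flips (x k) n) < 1"
    proof (cases "k \<le> n")
      case True
      then have "flips (x k) n = even" by (auto simp: flips_def x_def const_then_def)
      then show ?thesis using ev by simp
    next
      case False
      define p where "p = k - 1 - n"
      have "flips (x k) n i = const_then p False odd i" for i
        using False by (cases "n + 1 + i < k") (auto simp: flips_def x_def const_then_def p_def)
      then have fl: "flips (x k) n = const_then p False odd" by blast
      have "beta_val \<beta> (const_then p False odd) = beta_val \<beta> odd / \<beta> ^ p"
        using beta_val_split[OF \<beta>, of "const_then p False odd" p] by (simp add: const_then_def)
      also have "\<dots> \<le> beta_val \<beta> odd"
        using \<beta> beta_val_nonneg[OF \<beta>, of odd] by (simp add: divide_le_eq mult_le_cancel_left1)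
      finally show ?thesis using od fl by simp
    qed
  qed
  moreover have "inj x"
  proof (rule injI)
    fix k l assume eq: "x k = x l"
    have "x k (Suc k)" "x l (Suc l)" "\<And>i. i \<le> k \<Longrightarrow> \<not> x k i" "\<And>i. i \<le> l \<Longrightarrow> \<not> x l i"
      by (auto simp: x_def const_then_def)
    then show "k = l" using eq by (metis not_less_eq_eq le_antisym)
  qed
  ultimately show ?thesis by (meson image_subsetI infinite_iff_countable_subset)
qed

text \<open>Sequences that become constant after at most n desubstitutions, each of which may
  discard a constant prefix. The finite depth keeps the set countable.\<close>

fun renormalised :: "nat \<Rightarrow> (nat \<Rightarrow> bool) set" where
  "renormalised 0 = range (\<lambda>d _. d)"
| "renormalised (Suc n) = range (\<lambda>d _. d) \<union> (\<lambda>(p, d, e). const_then p d (subst_seq e)) ` (UNIV \<times> UNIV \<times> renormalised n)"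

lemma countable_renormalised: "countable (renormalised n)"
  by (induction n) auto

text \<open>A change of letters is a Thue-Morse pattern of length 2, and each substitution doubles
  the length of the pattern.\<close>

lemma not_renormalised_contains_tm:
  assumes "\<And>m. admissible m e" "e \<notin> renormalised n"
  shows "\<exists>q. \<forall>i < 2 ^ Suc n. (e (q + i) \<noteq> e q) = tm i"
  using assms
proof (induction n arbitrary: e)
  case 0
  have "e \<noteq> (\<lambda>_. e 0)" using 0(2) by (metis rangeI renormalised.simps(1))
  from ex_change[OF this] obtain q where "e (Suc q) \<noteq> e q" by blast
  then have "\<forall>i < 2 ^ Suc 0. (e (q + i) \<noteq> e q) = tm i"
    using tm_0 tm_values by (auto simp: less_Suc_eq numeral_2_eq_2)
  then show ?case by blast
next
  case (Suc n)
  have "\<exists>k. e k \<noteq> e 0"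
  proof (rule ccontr)
    assume "\<nexists>k. e k \<noteq> e 0"
    then have "e = (\<lambda>_. e 0)" by blast
    then have "e \<in> range (\<lambda>d _. d)" by (rule range_eqI)
    then show False using Suc.prems by simp
  qed
  then obtain p d e' where e': "\<And>m. admissible m e'" "e = const_then p d (subst_seq e')"
    using admissible_desubst[OF Suc.prems(1)] by blast
  have "e' \<notin> renormalised n"
  proof
    assume "e' \<in> renormalised n"
    then have "e \<in> (\<lambda>(p, d, e). const_then p d (subst_seq e)) ` (UNIV \<times> UNIV \<times> renormalised n)"
      unfolding e'(2) by (intro image_eqI[of _ _ "(p, d, e')"]) auto
    then show False using Suc.prems(2) by simp
  qed
  then obtain q where q: "\<forall>i < 2 ^ Suc n. (e' (q + i) \<noteq> e' q) = tm i" using Suc.IH e'(1) by blast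
  have ee: "e (p + 2 * q + i) = (e' (q + i div 2) \<noteq> odd i)" for i
    unfolding e'(2) by (simp add: const_then_def subst_seq_def add.assoc)
  have "(e (p + 2 * q + i) \<noteq> e (p + 2 * q)) = tm i" if "i < 2 ^ Suc (Suc n)" for i
  proof -
    have "i div 2 < 2 ^ Suc n" using that by auto
    then have "(e' (q + i div 2) \<noteq> e' q) = tm (i div 2)" using q by blast
    then show ?thesis using ee[of i] ee[of 0] tm_step[of i] by auto
  qed
  then show ?case by blast
qed

text \<open>Below the constant a finite prefix of the Thue-Morse tail already has value above 1. A
  sequence outside \<open>renormalised n\<close> contains a longer Thue-Morse pattern, so for large
  n no unique expansion lies outside.\<close>

lemma countable_univoque:
  assumes \<beta>: "1 < \<beta>" "\<beta> < komornik_loreti"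
  shows "countable (univoque \<beta>)"
proof -
  have "1 < beta_val \<beta> tm_tail"
    using beta_val_strict_antimono[OF \<beta>, of tm_tail 0] tm_values komornik_loreti by simp
  moreover have "(\<lambda>n. \<Sum>k<n. of_bool (tm_tail k) / \<beta> ^ (k + 1)) \<longlonglongrightarrow> beta_val \<beta> tm_tail"
    using beta_val_sums[OF \<beta>(1)] unfolding sums_def .
  ultimately have "\<forall>\<^sub>F n in sequentially. 1 < (\<Sum>k<n. of_bool (tm_tail k) / \<beta> ^ (k + 1))"
    using order_tendstoD(1) by blast
  then obtain N where N: "1 < (\<Sum>k<N. of_bool (tm_tail k) / \<beta> ^ (k + 1))"
    by (auto simp: eventually_sequentially)
  obtain n where "N < 2 ^ n" using less_exp by blast
  have "univoque \<beta> \<subseteq> renormalised n"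
  proof (rule subsetI, rule ccontr)
    fix e assume e: "e \<in> univoque \<beta>" "e \<notin> renormalised n"
    obtain q where q: "\<forall>i < 2 ^ Suc n. (e (q + i) \<noteq> e q) = tm i"
      using not_renormalised_contains_tm[OF univoque_admissible[OF \<beta>(1) _ e(1)] e(2)] \<beta> by auto
    have "flips e q k = tm_tail k" if "k < N" for k
    proof -
      have "Suc k < 2 ^ Suc n" using that \<open>N < 2 ^ n\<close> by simp
      then have "(e (q + Suc k) \<noteq> e q) = tm (Suc k)" using q by blast
      then show ?thesis by (simp add: flips_def)
    qed
    then have "(\<Sum>k<N. of_bool (tm_tail k) / \<beta> ^ (k + 1)) = (\<Sum>k<N. of_bool (flips e q k) / \<beta> ^ (k + 1))"
      by (intro sum.cong) auto
    also have "\<dots> \<le> beta_val \<beta> (flips e q)"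
      unfolding beta_val_split[OF \<beta>(1), of "flips e q" N] using beta_val_nonneg[OF \<beta>(1)] \<beta>(1) by simp
    also have "\<dots> < 1" using e by (simp add: univoque_def)
    finally show False using N by simp
  qed
  then show ?thesis using countable_renormalised countable_subset by blast
qed

section \<open>Unique expansions at and above the Komornik-Loreti constant\<close>


text \<open>The word \<open>0\<^sup>a \<theta>(0\<^sup>b \<theta>(\<dots>))\<close> with exponents \<open>c 0, c 1, \<dots>\<close> in \<open>{0, 1}\<close>, where \<open>\<theta>\<close> is the substitution.\<close>

function tower :: "(nat \<Rightarrow> bool) \<Rightarrow> nat \<Rightarrow> bool" where
  "tower c 0 = False"
| "tower c (Suc j) = (tower (\<lambda>k. c (Suc k)) ((if c 0 then j else Suc j) div 2) \<noteq> odd (if c 0 then j else Suc j))"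
  by pat_completeness auto
termination by (relation "Wellfounded.measure snd") auto

lemma tower_eq: "tower c = const_then (of_bool (c 0)) False (subst_seq (tower (\<lambda>k. c (Suc k))))"
proof
  fix j show "tower c j = const_then (of_bool (c 0)) False (subst_seq (tower (\<lambda>k. c (Suc k)))) j"
    by (cases j) (simp_all add: const_then_def subst_seq_def)
qed

lemma admissible_const_then:
  assumes "admissible m y" "\<not> y 0"
  shows "admissible m (const_then 1 False y)"
  unfolding admissible_def
proof
  fix n
  show "lex_le m (flips (const_then 1 False y) n) tm_tail"
  proof (cases n)
    case 0
    then have "flips (const_then 1 False y) n = y" by (auto simp: flips_def const_then_def)
    then show ?thesis using assms(2) tm_values(1) unfolding lex_le_def by (metis gr0I)
  next
    case (Suc l)
    then have "flips (const_then 1 False y) n = flips y l" by (auto simp: flips_def const_then_def)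
    then show ?thesis using assms(1) by (simp add: admissible_def)
  qed
qed

text \<open>The infinite nesting is harmless, because depth m sees only finitely many layers:
  passing one layer outwards raises the depth from m to at least \<open>Suc m\<close>.\<close>

lemma admissible_tower: "admissible m (tower c)"
proof (induction m arbitrary: c)
  case 0 then show ?case by (simp add: admissible_def lex_le_def)
next
  case (Suc m)
  let ?y = "subst_seq (tower (\<lambda>k. c (Suc k)))"
  have "admissible (2 * m + 1) ?y" by (rule admissible_subst[OF Suc])
  then have y: "admissible (Suc m) ?y" by (rule admissible_mono) simp
  have y0: "\<not> ?y 0" by (simp add: subst_seq_def)
  show ?case
  proof (cases "c 0")
    case True
    then show ?thesis using admissible_const_then[OF y y0] by (subst tower_eq) simp
  next
    case False
    have "const_then 0 False ?y = ?y" by (rule ext) (simp add: const_then_def)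
    then show ?thesis using y False by (subst tower_eq) simp
  qed
qed

lemma subst_seq_inj: "subst_seq x = subst_seq y \<Longrightarrow> x = y"
proof
  fix n assume "subst_seq x = subst_seq y"
  then have "subst_seq x (2 * n) = subst_seq y (2 * n)" by simp
  then show "x n = y n" by (simp add: subst_seq_def)
qed

text \<open>Digit 1 tells whether a 0 was prepended: it is 0 in that case, and otherwise it is the
  second letter of 01. Removing this layer leaves the next tower.\<close>

lemma tower_inj: "inj tower"
proof (rule injI, rule ext)
  fix c c' :: "nat \<Rightarrow> bool" and k
  assume "tower c = tower c'"
  then show "c k = c' k"
  proof (induction k arbitrary: c c')
    case (0 c c')
    have "tower c 1 = (\<not> c 0)" for c by (simp add: One_nat_def)
    from this[of c] this[of c'] show ?case using fun_cong[OF 0, of 1] by blast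
  next
    case (Suc k c c')
    have "tower c 1 = (\<not> c 0)" for c by (simp add: One_nat_def)
    from this[of c] this[of c'] have c0: "c 0 = c' 0" using fun_cong[OF Suc.prems, of 1] by blast
    have "tower b (of_bool (b 0) + i) = subst_seq (tower (\<lambda>k. b (Suc k))) i" for b i
      by (subst tower_eq) (simp add: const_then_def)
    note * = this
    have "subst_seq (tower (\<lambda>k. c (Suc k))) i = subst_seq (tower (\<lambda>k. c' (Suc k))) i" for i
      unfolding *[symmetric] c0 Suc.prems ..
    then have "tower (\<lambda>k. c (Suc k)) = tower (\<lambda>k. c' (Suc k))" by (rule subst_seq_inj[OF ext])
    from Suc.IH[OF this] show ?case .
  qed
qed

lemma uncountable_bool_sequences: "uncountable (UNIV :: (nat \<Rightarrow> bool) set)"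
proof
  assume "countable (UNIV :: (nat \<Rightarrow> bool) set)"
  then obtain g :: "nat \<Rightarrow> nat \<Rightarrow> bool" where "range g = UNIV"
    using uncountable_def by blast
  then obtain n where "g n = (\<lambda>k. \<not> g k k)" by (metis UNIV_I rangeE)
  then show False by metis
qed

text \<open>For every tower the values of \<open>flips\<close> are at most 1, and they are less than
  1 unless the sequence continues after some place with the Thue-Morse tail or its complement. Such
  a sequence is determined by a finite prefix, so only countably many towers are lost.\<close>

lemma uncountable_univoque_komornik_loreti: "uncountable (univoque komornik_loreti)"
proof -
  define f where "f w i = (if i < length w then w ! i else tm_tail (i - length w) \<noteq> last w)"
    for w :: "bool list" and i
  have "e \<in> range f" if "flips e n = tm_tail" for e n
  proof
    show "e = f (map e [0..<Suc n])"
    proof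
      fix i
      show "e i = f (map e [0..<Suc n]) i"
      proof (cases "i < Suc n")
        case True then show ?thesis by (simp add: f_def del: upt_Suc)
      next
        case False
        have "flips e n (i - Suc n) = tm_tail (i - Suc n)" using that by simp
        then show ?thesis using False by (auto simp: f_def flips_def)
      qed
    qed
  qed simp
  then have "tower c \<in> univoque komornik_loreti" if "tower c \<notin> range f" for c
    unfolding univoque_def mem_Collect_eq
    using that by (intro allI beta_val_flips_admissible(2)[OF admissible_tower]) auto
  then have "range tower - univoque komornik_loreti \<subseteq> range f" by auto
  then have "countable (range tower - univoque komornik_loreti)" by (rule countable_subset) simp
  moreover have "uncountable (range tower)"
    using tower_inj uncountable_bool_sequences by (simp add: countable_image_inj_eq)
  ultimately show ?thesis
    using uncountable_minus_countable[of "range tower" "univoque komornik_loreti"] by blast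
qed

section \<open>Counting admissible words\<close>

definition admissible_words :: "nat \<Rightarrow> bool list set" where
  "admissible_words n = (\<lambda>e. map e [0..<n]) ` {e. \<forall>m. admissible m e}"

lemma finite_admissible_words: "finite (admissible_words n)"
  by (rule finite_subset[OF _ finite_lists_length_eq[of UNIV n]]) (auto simp: admissible_words_def)

text \<open>By \<open>admissible_desubst\<close> a word of length 2n is given by the length and
  letter of a constant prefix and by a word of length n, whose image still covers all remaining
  places after the shift. A constant word is encoded by a prefix of length 2n.\<close>

lemma card_admissible_words_double:
  "card (admissible_words (2 * n)) \<le> (2 * n + 1) * 2 * card (admissible_words n)"
proof -
  define g where "g = (\<lambda>(p, d, w). map (\<lambda>i. if i < p then d else w ! ((i - p) div 2) \<noteq> odd (i - p)) [0..<2 * n])"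
  let ?A = "{..2 * n} \<times> (UNIV :: bool set) \<times> admissible_words n"
  have adm_const: "admissible m (\<lambda>_. False)" for m
    by (auto simp: admissible_def lex_le_def flips_def)
  have "admissible_words (2 * n) \<subseteq> g ` ?A"
  proof
    fix w assume "w \<in> admissible_words (2 * n)"
    then obtain e where e: "\<And>m. admissible m e" "w = map e [0..<2 * n]"
      by (auto simp: admissible_words_def)
    show "w \<in> g ` ?A"
    proof (cases "\<exists>k. e k \<noteq> e 0")
      case False
      then have "w = g (2 * n, e 0, map (\<lambda>_. False) [0..<n])"
        unfolding e(2) g_def by auto
      moreover have "map (\<lambda>_. False) [0..<n] \<in> admissible_words n"
        unfolding admissible_words_def using adm_const by blast
      ultimately show ?thesis by (intro image_eqI) auto
    next
      case True
      then obtain p d e' where e': "\<And>m. admissible m e'" "e = const_then p d (subst_seq e')"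
        using admissible_desubst[OF e(1)] by blast
      have "w = g (min p (2 * n), d, map e' [0..<n])"
        unfolding e(2) e'(2) g_def by (auto simp: const_then_def subst_seq_def)
      moreover have "map e' [0..<n] \<in> admissible_words n"
        unfolding admissible_words_def using e'(1) by blast
      ultimately show ?thesis by (intro image_eqI) auto
    qed
  qed
  then have "card (admissible_words (2 * n)) \<le> card (g ` ?A)"
    by (rule card_mono[rotated]) (simp add: finite_admissible_words)
  also have "\<dots> \<le> card ?A" by (rule card_image_le) (simp add: finite_admissible_words)
  also have "\<dots> = (2 * n + 1) * 2 * card (admissible_words n)"
    by (simp add: card_cartesian_product)
  finally show ?thesis .
qed

text \<open>The bound is subexponential in the word length 2^n. Its exponent fits the doubling step
  because (n + 2)^2 + (n + 3) \<le> (n + 3)^2.\<close>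

lemma card_admissible_words_power: "card (admissible_words (2 ^ n)) \<le> 2 ^ ((n + 2)\<^sup>2)"
proof (induction n)
  case 0
  have "card (admissible_words 1) \<le> card {xs :: bool list. set xs \<subseteq> UNIV \<and> length xs = 1}"
    by (rule card_mono[OF finite_lists_length_eq]) (auto simp: admissible_words_def)
  also have "\<dots> = 2" using card_lists_length_eq[of "UNIV :: bool set" 1] by simp
  also have "(2 :: nat) \<le> 2 ^ ((0 + 2)\<^sup>2)" by (simp add: power2_eq_square)
  finally show ?case by simp
next
  case (Suc n)
  have "card (admissible_words (2 ^ Suc n)) \<le> (2 ^ Suc n + 1) * 2 * card (admissible_words (2 ^ n))"
    using card_admissible_words_double[of "2 ^ n"] by simp
  also have "\<dots> \<le> 2 ^ (n + 3) * 2 ^ ((n + 2)\<^sup>2)"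
  proof (rule mult_mono[OF _ Suc])
    have "(1 :: nat) \<le> 2 ^ Suc n" by simp
    then have "(2 ^ Suc n + 1) * 2 \<le> (2 ^ Suc n + 2 ^ Suc n) * (2 :: nat)" by (intro mult_right_mono add_left_mono) auto
    also have "\<dots> = 2 ^ (n + 3)" by (simp add: power_add)
    finally show "(2 ^ Suc n + 1) * 2 \<le> (2 :: nat) ^ (n + 3)" .
  qed auto
  also have "\<dots> = 2 ^ (n + 3 + (n + 2)\<^sup>2)" by (simp add: power_add)
  also have "\<dots> \<le> 2 ^ ((Suc n + 2)\<^sup>2)"
    by (rule power_increasing) (auto simp: power2_eq_square algebra_simps)
  finally show ?case .
qed

text \<open>All four pairs of consecutive blocks occur in the Thue-Morse sequence, so any concatenation of the
  block of length \<open>2 ^ n\<close> and its complement looks locally like the Thue-Morse sequence.\<close>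

definition tm_blocks :: "nat \<Rightarrow> (nat \<Rightarrow> bool) \<Rightarrow> nat \<Rightarrow> bool" where
  "tm_blocks n e i \<longleftrightarrow> e (i div 2 ^ n) \<noteq> tm (i mod 2 ^ n)"

text \<open>The first 2^n digits of each \<open>flips\<close> are those of some \<open>flips\<close>
  of \<open>tm\<close>, of value at most \<open>komornik_loreti / \<beta>\<close> < 1, and for large
  n all further digits weigh less than half of the margin. Positive dimension needs this bound to be
  uniform in \<open>e\<close> and \<open>i\<close>.\<close>

lemma tm_blocks_bound:
  assumes "komornik_loreti < \<beta>"
  shows "\<exists>n \<mu>. \<mu> < 1 \<and> (\<forall>e i. beta_val \<beta> (flips (tm_blocks n e) i) \<le> \<mu>)"
proof -
  let ?b = komornik_loreti
  have \<beta>: "1 < \<beta>" using assms komornik_loreti(1) by simp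
  have lim: "(\<lambda>N. (1 / (\<beta> - 1)) * (1 / \<beta>) ^ N) \<longlonglongrightarrow> (1 / (\<beta> - 1)) * 0"
    using \<beta> by (intro tendsto_mult tendsto_const LIMSEQ_power_zero) auto
  have "(1 / (\<beta> - 1)) * 0 < (1 - ?b / \<beta>) / 2" using assms komornik_loreti(1) by simp
  from order_tendstoD(2)[OF lim this]
  have "\<forall>\<^sub>F N in sequentially. (1 / (\<beta> - 1)) * (1 / \<beta>) ^ N < (1 - ?b / \<beta>) / 2" .
  then obtain n where n: "\<And>N. n \<le> N \<Longrightarrow> (1 / (\<beta> - 1)) * (1 / \<beta>) ^ N < (1 - ?b / \<beta>) / 2"
    by (auto simp: eventually_sequentially)
  define K :: nat where "K = 2 ^ n"
  have K: "0 < K" by (simp add: K_def)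
  have "n \<le> K" unfolding K_def using less_exp[of n] by simp
  define \<mu> where "\<mu> = ?b / \<beta> + (1 - ?b / \<beta>) / 2"
  have "beta_val \<beta> (flips (tm_blocks n e) i) \<le> \<mu>" for e i
  proof -
    define p r where "p = i div K" and "r = i mod K"
    have i: "i = K * p + r" and r: "r < K" using K by (auto simp: p_def r_def)
    \<comment> \<open>The letters of \<open>tm\<close> at 0 and 1 differ, those at 1 and 2 agree; so
      two consecutive blocks occur in \<open>tm\<close> up to a common complement, starting at block
      0 or 1.\<close>
    define q :: nat where "q = (if e p = e (Suc p) then 1 else 0)"
    have q: "(tm q \<noteq> tm (Suc q)) = (e p \<noteq> e (Suc p))"
      using tm_0 tm_values by (simp add: q_def numeral_2_eq_2)
    have blk: "tm_blocks n e (K * p + s) = (tm (K * q + s) \<noteq> (e p \<noteq> tm q))" if "s < 2 * K" for s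
    proof (cases "s < K")
      case True
      then show ?thesis using tm_block[of s n q] by (auto simp: tm_blocks_def K_def)
    next
      case False
      then obtain t where t: "s = K + t" by (metis le_Suc_ex not_less)
      have "t < K" using that t by simp
      moreover have "K * p + s = K * Suc p + t" "K * q + s = K * Suc q + t" using t by simp_all
      ultimately show ?thesis using tm_block[of t n "Suc q"] q
        by (auto simp: tm_blocks_def K_def simp del: mult_Suc_right)
    qed
    have fl: "flips (tm_blocks n e) i j = flips tm (K * q + r) j" if "j < K" for j
    proof -
      have "tm_blocks n e (K * p + (r + 1 + j)) = (tm (K * q + (r + 1 + j)) \<noteq> (e p \<noteq> tm q))"
        using that r by (intro blk) simp
      moreover have "tm_blocks n e (K * p + r) = (tm (K * q + r) \<noteq> (e p \<noteq> tm q))"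
        using r by (intro blk) simp
      moreover have "i + 1 + j = K * p + (r + 1 + j)" "K * q + r + 1 + j = K * q + (r + 1 + j)"
        unfolding i by simp_all
      ultimately show ?thesis unfolding flips_def i by metis
    qed
    have "beta_val \<beta> (flips (tm_blocks n e) i) = (\<Sum>k<K. of_bool (flips tm (K * q + r) k) / \<beta> ^ (k + 1))
        + beta_val \<beta> (\<lambda>k. flips (tm_blocks n e) i (K + k)) / \<beta> ^ K"
      unfolding beta_val_split[OF \<beta>, of "flips (tm_blocks n e) i" K] using fl by simp
    also have "\<dots> \<le> beta_val \<beta> (flips tm (K * q + r)) + (1 / (\<beta> - 1)) * (1 / \<beta>) ^ K"
    proof (rule add_mono)
      show "(\<Sum>k<K. of_bool (flips tm (K * q + r) k) / \<beta> ^ (k + 1)) \<le> beta_val \<beta> (flips tm (K * q + r))"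
        unfolding beta_val_split[OF \<beta>, of "flips tm (K * q + r)" K] using beta_val_nonneg[OF \<beta>] \<beta> by simp
      have "beta_val \<beta> (\<lambda>k. flips (tm_blocks n e) i (K + k)) / \<beta> ^ K \<le> (1 / (\<beta> - 1)) / \<beta> ^ K"
        using \<beta> by (intro divide_right_mono beta_val_le) auto
      then show "beta_val \<beta> (\<lambda>k. flips (tm_blocks n e) i (K + k)) / \<beta> ^ K \<le> (1 / (\<beta> - 1)) * (1 / \<beta>) ^ K"
        by (simp add: power_one_over)
    qed
    also have "beta_val \<beta> (flips tm (K * q + r)) \<le> (?b / \<beta>) * beta_val ?b (flips tm (K * q + r))"
      using assms komornik_loreti(1) by (intro beta_val_scale) auto
    also have "\<dots> \<le> (?b / \<beta>) * 1"
      using \<beta> komornik_loreti(1) by (intro mult_left_mono beta_val_flips_admissible(1)[OF admissible_tm]) auto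
    finally have "beta_val \<beta> (flips (tm_blocks n e) i) \<le> (?b / \<beta>) * 1 + (1 / (\<beta> - 1)) * (1 / \<beta>) ^ K"
      by simp
    then show ?thesis using n[OF \<open>n \<le> K\<close>] unfolding \<mu>_def by linarith
  qed
  moreover have "\<mu> < 1" using assms komornik_loreti(1) by (simp add: \<mu>_def field_simps)
  ultimately show ?thesis by blast
qed

section \<open>Separation of addresses by linear functionals\<close>


definition signed_sum :: "(nat \<Rightarrow> 'a::real_normed_vector) \<Rightarrow> (nat \<Rightarrow> real) \<Rightarrow> 'a" where
  "signed_sum X a = (\<Sum>k. a k *\<^sub>R X k)"

definition unique_sums :: "(nat \<Rightarrow> 'a::real_normed_vector) \<Rightarrow> 'a set" where
  "unique_sums X = {x. \<exists>!a. a \<in> sign_seqs \<and> x = signed_sum X a}"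

lemma sign_seqs_abs: "a \<in> sign_seqs \<Longrightarrow> \<bar>a k\<bar> = 1"
  by (auto simp: sign_seqs_def dest: spec[of _ k])

lemma sign_seqs_cases: "a \<in> sign_seqs \<Longrightarrow> a k = 1 \<or> a k = -1"
  by (auto simp: sign_seqs_def)

lemma summable_signed:
  fixes X :: "nat \<Rightarrow> 'a::banach"
  assumes "summable (\<lambda>k. norm (X k))" "a \<in> sign_seqs"
  shows "summable (\<lambda>k. a k *\<^sub>R X k)"
  by (rule summable_norm_cancel) (use assms in \<open>simp add: sign_seqs_abs\<close>)

lemma summable_inner_right:
  fixes X :: "nat \<Rightarrow> 'a::real_inner"
  assumes "summable (\<lambda>k. norm (X k))"
  shows "summable (\<lambda>k. \<bar>inner v (X k)\<bar>)"
  by (rule summable_comparison_test'[OF summable_mult[OF assms, of "norm v"]])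
    (simp add: Cauchy_Schwarz_ineq2)

text \<open>Half of the most that a competing sequence can win back after position n by choosing the
  sign of w wherever a does not have it.\<close>

definition mismatch_cost :: "(nat \<Rightarrow> real) \<Rightarrow> (nat \<Rightarrow> real) \<Rightarrow> nat \<Rightarrow> real" where
  "mismatch_cost a w n = (\<Sum>k. max 0 (- (a (n + 1 + k) * w (n + 1 + k))))"

lemma summable_mismatch:
  assumes "summable (\<lambda>k. \<bar>w k\<bar> :: real)" "a \<in> sign_seqs"
  shows "summable (\<lambda>k. max 0 (- (a (n + 1 + k) * w (n + 1 + k))))"
proof (rule summable_comparison_test')
  show "summable (\<lambda>k. \<bar>w (k + (n + 1))\<bar>)" using assms(1) by (subst summable_iff_shift)
  show "norm (max 0 (- (a (n + 1 + k) * w (n + 1 + k)))) \<le> \<bar>w (k + (n + 1))\<bar>" for k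
    using sign_seqs_cases[OF assms(2), of "n + 1 + k"] by (auto simp: add_ac max_def abs_if)
qed

text \<open>In the difference evaluated by v the terms before n vanish, the term at n is doubled,
  and each later term is 0 or twice a k w k, hence at least minus twice its mismatch. Cauchy-Schwarz
  turns this into a distance.\<close>

lemma signed_sum_separation:
  fixes X :: "nat \<Rightarrow> 'a::{banach,real_inner}"
  assumes sm: "summable (\<lambda>k. norm (X k))" and a: "a \<in> sign_seqs" and b: "b \<in> sign_seqs"
    and eq: "\<forall>i<n. a i = b i" and ne: "a n \<noteq> b n"
  shows "2 * (a n * inner v (X n) - mismatch_cost a (\<lambda>k. inner v (X k)) n)
           \<le> norm v * norm (signed_sum X a - signed_sum X b)"
proof -
  define w where "w k = inner v (X k)" for k
  have sw: "summable (\<lambda>k. \<bar>w k\<bar>)" unfolding w_def by (rule summable_inner_right[OF sm])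
  define D where "D k = (a k - b k) * w k" for k
  have "(\<lambda>k. inner v ((a k - b k) *\<^sub>R X k)) sums inner v (signed_sum X a - signed_sum X b)"
    unfolding signed_sum_def
    by (intro bounded_linear.sums[OF bounded_linear_inner_right])
      (simp add: scaleR_diff_left sums_diff summable_sums summable_signed sm a b)
  then have D: "D sums inner v (signed_sum X a - signed_sum X b)"
    by (simp add: D_def[abs_def] w_def)
  have "(\<lambda>k. D (k + Suc n)) sums (inner v (signed_sum X a - signed_sum X b) - (\<Sum>k<Suc n. D k))"
    using D by (rule sums_split_initial_segment)
  moreover have "(\<Sum>k<Suc n. D k) = D n" using eq by (simp add: D_def)
  moreover have "D n = 2 * (a n * w n)"
    using ne sign_seqs_cases[OF a, of n] sign_seqs_cases[OF b, of n] by (auto simp: D_def)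
  ultimately have S: "(\<lambda>k. D (k + Suc n)) sums (inner v (signed_sum X a - signed_sum X b) - 2 * (a n * w n))"
    by simp
  have M: "(\<lambda>k. - 2 * max 0 (- (a (n + 1 + k) * w (n + 1 + k)))) sums (- 2 * mismatch_cost a w n)"
    unfolding mismatch_cost_def by (intro sums_mult summable_sums summable_mismatch sw a)
  have le: "- 2 * max 0 (- (a (n + 1 + k) * w (n + 1 + k))) \<le> D (k + Suc n)" for k
    using sign_seqs_cases[OF a, of "n + 1 + k"] sign_seqs_cases[OF b, of "n + 1 + k"]
    by (auto simp: D_def max_def add_ac)
  have "- 2 * mismatch_cost a w n \<le> inner v (signed_sum X a - signed_sum X b) - 2 * (a n * w n)"
    by (rule sums_le[OF le M S])
  then show ?thesis
    using norm_cauchy_schwarz[of v "signed_sum X a - signed_sum X b"] by (simp add: w_def[abs_def])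
qed

text \<open>The functionals may grow like r^-n: dividing by their norm still leaves a separation of
  order r^n at the first difference n. By \<open>first\<close>, that n is at most linear in the
  first difference of the codes, so the separation is exponential in the latter.\<close>

lemma hausdorff_dim_unique_sums_pos:
  fixes X :: "nat \<Rightarrow> 'a::{banach,real_inner}" and \<Phi> :: "(nat \<Rightarrow> bool) \<Rightarrow> nat \<Rightarrow> real"
  assumes sm: "summable (\<lambda>k. norm (X k))" and \<Phi>: "\<And>e. \<Phi> e \<in> sign_seqs"
    and first: "\<And>e e' j. (\<forall>i<j. e i = e' i) \<Longrightarrow> e j \<noteq> e' j \<Longrightarrow>
      \<exists>n \<le> L * Suc j. (\<forall>i<n. \<Phi> e i = \<Phi> e' i) \<and> \<Phi> e n \<noteq> \<Phi> e' n"
    and c: "0 < c" and r: "0 < r" "r < 1"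
    and witness: "\<And>e n. \<exists>v. r ^ n * norm v \<le> C \<and>
      c \<le> \<Phi> e n * inner v (X n) - mismatch_cost (\<Phi> e) (\<lambda>k. inner v (X k)) n"
  shows "0 < hausdorff_dim (unique_sums X)"
proof -
  obtain C' where C': "0 < C'" "C \<le> C'" by (metis less_add_one max.cobounded1 max.cobounded2 order_less_le_trans zero_less_one)
  define c' where "c' = 2 * c / C'"
  have c'0: "0 < c'" using c C' by (simp add: c'_def)
  have sep: "c' * r ^ n \<le> norm (signed_sum X (\<Phi> e) - signed_sum X b)"
    if b: "b \<in> sign_seqs" and n: "\<forall>i<n. \<Phi> e i = b i" "\<Phi> e n \<noteq> b n" for e b n
  proof -
    obtain v where v: "r ^ n * norm v \<le> C" and
      "c \<le> \<Phi> e n * inner v (X n) - mismatch_cost (\<Phi> e) (\<lambda>k. inner v (X k)) n"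
      using witness by blast
    then have "2 * c \<le> norm v * norm (signed_sum X (\<Phi> e) - signed_sum X b)"
      using signed_sum_separation[OF sm \<Phi> b n, of v] by simp
    then have "2 * c * r ^ n \<le> norm v * norm (signed_sum X (\<Phi> e) - signed_sum X b) * r ^ n"
      using r by (intro mult_right_mono) auto
    also have "\<dots> = (r ^ n * norm v) * norm (signed_sum X (\<Phi> e) - signed_sum X b)" by simp
    also have "\<dots> \<le> C' * norm (signed_sum X (\<Phi> e) - signed_sum X b)"
      using v C' by (intro mult_right_mono) auto
    finally show ?thesis using C' by (simp add: c'_def field_simps)
  qed
  show ?thesis
  proof (rule hausdorff_dim_pos_if_separated)
    show "0 < c' * r ^ L" using c'0 r by simp
    \<comment> \<open>For L = 0 the rate \<open>r ^ L\<close> would be 1, whereas the criterion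
      requires a rate below 1.\<close>
    define r' where "r' = (if L = 0 then r else r ^ L)"
    show "0 < r'" using r by (simp add: r'_def)
    show "r' < 1" using r by (auto simp: r'_def power_less_one_iff)
    show "range (\<lambda>e. signed_sum X (\<Phi> e)) \<subseteq> unique_sums X"
    proof safe
      fix e
      show "signed_sum X (\<Phi> e) \<in> unique_sums X"
        unfolding unique_sums_def mem_Collect_eq
      proof (rule ex1I[of _ "\<Phi> e"])
        fix b assume b: "b \<in> sign_seqs \<and> signed_sum X (\<Phi> e) = signed_sum X b"
        show "b = \<Phi> e"
        proof (rule ccontr)
          assume "b \<noteq> \<Phi> e"
          then obtain n where "\<forall>i<n. \<Phi> e i = b i" "\<Phi> e n \<noteq> b n" using first_difference[of "\<Phi> e" b] by metis
          from sep[OF _ this] b have "c' * r ^ n \<le> 0" by simp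
          moreover have "0 < c' * r ^ n" using c'0 r by simp
          ultimately show False by simp
        qed
      qed (simp add: \<Phi>)
    qed
    fix e e' :: "nat \<Rightarrow> bool" and j
    assume "\<forall>i<j. e i = e' i" "e j \<noteq> e' j"
    from first[OF this] obtain n where n: "n \<le> L * Suc j" "\<forall>i<n. \<Phi> e i = \<Phi> e' i" "\<Phi> e n \<noteq> \<Phi> e' n"
      by blast
    have "r ^ L * r' ^ j \<le> r ^ L * (r ^ L) ^ j"
      using r by (cases "L = 0") (auto simp: r'_def power_le_one)
    also have "\<dots> = r ^ (L * Suc j)" by (simp only: power_mult[symmetric] power_add[symmetric] mult_Suc_right)
    also have "\<dots> \<le> r ^ n" using n r by (intro power_decreasing) auto
    finally have "c' * r ^ L * r' ^ j \<le> c' * r ^ n" using c'0 by (simp add: mult.assoc)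
    also have "\<dots> \<le> dist (signed_sum X (\<Phi> e)) (signed_sum X (\<Phi> e'))"
      unfolding dist_norm by (rule sep[OF \<Phi> n(2,3)])
    finally show "c' * r ^ L * r' ^ j \<le> dist (signed_sum X (\<Phi> e)) (signed_sum X (\<Phi> e'))" .
  qed
qed

definition free_at_multiples :: "nat \<Rightarrow> (nat \<Rightarrow> real) \<Rightarrow> (nat \<Rightarrow> bool) \<Rightarrow> nat \<Rightarrow> real" where
  "free_at_multiples L s e k = (if L dvd k then (if e (k div L) then 1 else - 1) else s k)"

lemma hausdorff_dim_pos_free_at_multiples:
  fixes X :: "nat \<Rightarrow> 'a::{banach,real_inner}"
  assumes sm: "summable (\<lambda>k. norm (X k))" and s: "s \<in> sign_seqs" and L: "0 < L"
    and c: "0 < c" and r: "0 < r" "r < 1"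
    and witness: "\<And>a n. a \<in> sign_seqs \<Longrightarrow> (\<And>k. \<not> L dvd k \<Longrightarrow> a k = s k) \<Longrightarrow>
      \<exists>v. r ^ n * norm v \<le> C \<and> c \<le> a n * inner v (X n) - mismatch_cost a (\<lambda>k. inner v (X k)) n"
  shows "0 < hausdorff_dim (unique_sums X)"
proof (rule hausdorff_dim_unique_sums_pos[OF sm _ _ c r])
  show sg: "free_at_multiples L s e \<in> sign_seqs" for e
    using s by (auto simp: sign_seqs_def free_at_multiples_def)
  show "\<exists>v. r ^ n * norm v \<le> C \<and> c \<le> free_at_multiples L s e n * inner v (X n)
      - mismatch_cost (free_at_multiples L s e) (\<lambda>k. inner v (X k)) n" for e n
    by (rule witness[OF sg]) (simp add: free_at_multiples_def)
  fix e e' :: "nat \<Rightarrow> bool" and j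
  assume e: "\<forall>i<j. e i = e' i" "e j \<noteq> e' j"
  have "free_at_multiples L s e i = free_at_multiples L s e' i" if "i < L * j" for i
  proof -
    have "i div L < j" using that L by (simp add: less_mult_imp_div_less mult.commute)
    then show ?thesis using e by (simp add: free_at_multiples_def)
  qed
  moreover have "free_at_multiples L s e (L * j) \<noteq> free_at_multiples L s e' (L * j)"
    using e L by (simp add: free_at_multiples_def)
  ultimately show "\<exists>n\<le>L * Suc j. (\<forall>i<n. free_at_multiples L s e i = free_at_multiples L s e' i) \<and>
      free_at_multiples L s e n \<noteq> free_at_multiples L s e' n"
    by (intro exI[of _ "L * j"]) auto
qed

text \<open>The common shape of the later estimates: a clear stretch of length T with one possible
  exception l, and a summable bound beyond. If there is no exception, l = T and e = 0 are used,
  since only l < T matters.\<close>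

lemma mismatch_cost_le:
  assumes sw: "summable (\<lambda>k. \<bar>w k\<bar>)" and a: "a \<in> sign_seqs"
    and g: "summable g" "\<And>j. max 0 (- (a (n + 1 + j) * w (n + 1 + j))) \<le> g j"
    and exc: "\<And>j. j < T \<Longrightarrow> j \<noteq> l \<Longrightarrow> 0 \<le> a (n + 1 + j) * w (n + 1 + j)"
    and e: "0 \<le> e" "l < T \<Longrightarrow> - (a (n + 1 + l) * w (n + 1 + l)) \<le> e"
  shows "mismatch_cost a w n \<le> e + (\<Sum>j. g (j + T))"
proof -
  define f where "f j = max 0 (- (a (n + 1 + j) * w (n + 1 + j)))" for j
  have sf: "summable f" unfolding f_def by (rule summable_mismatch[OF sw a])
  have "mismatch_cost a w n = (\<Sum>j. f (j + T)) + (\<Sum>j<T. f j)"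
    unfolding mismatch_cost_def f_def[symmetric] by (rule suminf_split_initial_segment[OF sf])
  also have "(\<Sum>j. f (j + T)) \<le> (\<Sum>j. g (j + T))"
    using g(2) unfolding f_def[symmetric] by (intro suminf_le) (simp_all add: summable_iff_shift sf g(1))
  also have "(\<Sum>j<T. f j) \<le> (\<Sum>j<T. if j = l then e else 0)"
    using exc e by (intro sum_mono) (auto simp: f_def)
  also have "\<dots> \<le> e" using e(1) by (simp add: sum.delta)
  finally show ?thesis by simp
qed

text \<open>f is a complex linear coordinate along X. The uniform B ensures that a coefficient of
  size r^-n yields a functional whose norm has that order.\<close>

definition realizes :: "(nat \<Rightarrow> 'a::real_inner) \<Rightarrow> (nat \<Rightarrow> complex) \<Rightarrow> real \<Rightarrow> bool" where
  "realizes X f B \<longleftrightarrow> 0 \<le> B \<and> (\<forall>c. \<exists>v. norm v \<le> B * cmod c \<and> (\<forall>k. inner v (X k) = Re (c * f k)))"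

lemma realizes_nonneg: "realizes X f B \<Longrightarrow> 0 \<le> B"
  by (simp add: realizes_def)

lemma realizesE:
  assumes "realizes X f B"
  obtains v where "norm v \<le> B * cmod c" "\<And>k. inner v (X k) = Re (c * f k)"
  using assms unfolding realizes_def by blast

lemma realizes2E:
  assumes "realizes X f B" "realizes X g D"
  obtains v where "norm v \<le> B * cmod c + D * cmod d" "\<And>k. inner v (X k) = Re (c * f k) + Re (d * g k)"
proof -
  obtain v v' where "norm v \<le> B * cmod c" "\<And>k. inner v (X k) = Re (c * f k)"
    "norm v' \<le> D * cmod d" "\<And>k. inner v' (X k) = Re (d * g k)"
    using realizesE[OF assms(1)] realizesE[OF assms(2)] by metis
  then have "norm (v + v') \<le> B * cmod c + D * cmod d"
    "inner (v + v') (X k) = Re (c * f k) + Re (d * g k)" for k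
    using norm_triangle_ineq[of v v'] by (auto simp: inner_add_left)
  then show ?thesis by (rule that)
qed

section \<open>Irrational angles\<close>


lemma frac_angle_reduce:
  fixes p :: int and q m :: nat
  assumes "0 < q"
  obtains t i :: int where "real m * (pi * p / q) = pi * t + pi * i / q" "0 \<le> i" "i < int q"
    "i = (int m * p) mod int q"
proof
  define j where "j = int m * p"
  have "real_of_int j = real_of_int (j div int q * int q + j mod int q)" by simp
  then have "real_of_int j = real_of_int (j div int q) * q + real_of_int (j mod int q)"
    by (simp only: of_int_add of_int_mult of_int_of_nat_eq)
  moreover have "real m * (pi * p / q) = pi * real_of_int j / q" by (simp add: j_def)
  ultimately show "real m * (pi * p / q) = pi * real_of_int (j div int q) + pi * real_of_int (j mod int q) / q"
    using assms by (simp add: field_simps)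
qed (use assms in auto)

lemma frac_angle_nonzero:
  fixes p :: int and q m :: nat
  assumes "coprime p (int q)" "\<not> q dvd m"
  shows "(int m * p) mod int q \<noteq> 0"
proof
  assume "(int m * p) mod int q = 0"
  then have "int q dvd int m * p" by auto
  then have "int q dvd int m"
    using assms(1) by (simp add: coprime_commute coprime_dvd_mult_left_iff)
  then show False using assms(2) by simp
qed

lemma sin_pi_int_plus: "sin (pi * of_int t + y) = cos (pi * of_int t) * sin y" for t :: int and y :: real
proof -
  have "sin (pi * of_int t) = 0" by (metis mult.commute sin_times_pi_eq_0 Ints_of_int)
  then show ?thesis by (simp add: sin_add)
qed

lemma cos_pi_int_abs: "\<bar>cos (pi * of_int t)\<bar> = 1" for t :: int
  using cos_int_times_real[of t] by (simp add: mult.commute)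

text \<open>Unless q divides m, the angle is a nonzero multiple of pi / q modulo pi, hence at
  distance at least pi / q from every zero of the sine. Smaller perturbations therefore cannot
  change the sign of the sine.\<close>

lemma frac_angle_bounds:
  fixes p :: int and q m :: nat
  assumes "coprime p (int q)" "\<not> q dvd m" "0 < q"
  obtains t :: int and y :: real
  where "real m * (pi * p / q) = pi * t + y" "pi / q \<le> y" "y \<le> pi - pi / q"
proof -
  obtain t i :: int where eq: "real m * (pi * p / q) = pi * t + pi * i / q" and i: "0 \<le> i" "i < int q"
    "i = (int m * p) mod int q"
    using frac_angle_reduce[OF assms(3)] by blast
  have i1: "1 \<le> i" "i \<le> int q - 1" using frac_angle_nonzero[OF assms(1,2)] i by auto
  have "pi * 1 / q \<le> pi * i / q" using i1 by (intro divide_right_mono mult_left_mono) auto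
  moreover have "pi * i / q \<le> pi * (q - 1) / q"
  proof -
    have "real_of_int i \<le> real q - 1" using i1(2) by linarith
    then show ?thesis by (intro divide_right_mono mult_left_mono) auto
  qed
  moreover have "pi * (q - 1) / q = pi - pi / q" using assms(3) by (simp add: field_simps)
  ultimately show ?thesis using that[of t "pi * i / q"] eq by simp
qed

lemma sin_frac_same_sign:
  fixes p :: int and q m :: nat and x :: real
  assumes "coprime p (int q)" "\<not> q dvd m" "0 < q" "\<bar>x\<bar> < pi / q"
  shows "0 < sin (real m * (pi * p / q)) * sin (real m * (pi * p / q) + x)"
proof -
  obtain t :: int and y where eq: "real m * (pi * p / q) = pi * t + y" and y: "pi / q \<le> y" "y \<le> pi - pi / q"
    using frac_angle_bounds[OF assms(1-3)] by blast
  have piq: "0 < pi / q" using assms(3) by simp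
  have "0 < sin (y)" using y piq by (intro sin_gt_zero) linarith+
  moreover have "0 < sin (y + x)" using y assms(4) by (intro sin_gt_zero) linarith+
  moreover have "sin (real m * (pi * p / q)) * sin (real m * (pi * p / q) + x)
      = (cos (pi * t))\<^sup>2 * (sin (y) * sin (y + x))"
    unfolding eq add.assoc sin_pi_int_plus by (simp add: power2_eq_square)
  moreover have "(cos (pi * t))\<^sup>2 = 1" using cos_pi_int_abs[of t] by (metis one_power2 power2_abs)
  ultimately show ?thesis by simp
qed

lemma sin_frac_abs_ge:
  fixes p :: int and q m :: nat
  assumes "coprime p (int q)" "\<not> q dvd m" "0 < q"
  shows "sin (pi / q) \<le> \<bar>sin (real m * (pi * p / q))\<bar>"
proof -
  obtain t :: int and y where eq: "real m * (pi * p / q) = pi * t + y" and y: "pi / q \<le> y" "y \<le> pi - pi / q"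
    using frac_angle_bounds[OF assms(1-3)] by blast
  have piq: "0 < pi / q" using assms(3) by simp
  have "sin (pi / q) \<le> sin (y)"
  proof (cases "y \<le> pi / 2")
    case True
    then show ?thesis using y piq by (intro sin_monotone_2pi_le) linarith+
  next
    case False
    have "sin (pi / q) \<le> sin (pi - y)"
      using y piq False by (intro sin_monotone_2pi_le) linarith+
    then show ?thesis by simp
  qed
  also have "\<dots> \<le> \<bar>sin (y)\<bar>" by simp
  also have "\<dots> = \<bar>sin (real m * (pi * p / q))\<bar>"
    unfolding eq sin_pi_int_plus abs_mult cos_pi_int_abs by simp
  finally show ?thesis .
qed

lemma frac_angle_multiple:
  fixes p :: int and q m :: nat
  assumes "0 < q" "q dvd m"
  shows "sin (real m * (pi * p / q)) = 0" "\<bar>cos (real m * (pi * p / q))\<bar> = 1"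
    "\<bar>sin (real m * (pi * p / q) + x)\<bar> = \<bar>sin x\<bar>"
proof -
  obtain l where "m = q * l" using assms(2) by blast
  then have eq: "real m * (pi * p / q) = pi * of_int (int l * p)" using assms(1) by simp
  show "sin (real m * (pi * p / q)) = 0" using sin_pi_int_plus[of "int l * p" 0] unfolding eq by simp
  show "\<bar>cos (real m * (pi * p / q))\<bar> = 1" unfolding eq by (rule cos_pi_int_abs)
  show "\<bar>sin (real m * (pi * p / q) + x)\<bar> = \<bar>sin x\<bar>"
    unfolding eq sin_pi_int_plus abs_mult cos_pi_int_abs by simp
qed

lemma sin_ge_half: "0 \<le> x \<Longrightarrow> x \<le> pi / 3 \<Longrightarrow> x / 2 \<le> sin x"
proof -
  assume x: "0 \<le> x" "x \<le> pi / 3"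
  have "(\<lambda>x. sin x - x / 2) 0 \<le> (\<lambda>x. sin x - x / 2) x"
  proof (rule DERIV_nonneg_imp_nondecreasing[OF x(1)])
    fix y assume y: "0 \<le> y" "y \<le> x"
    have "cos (pi / 3) \<le> cos y" using x y by (intro cos_monotone_0_pi_le) auto
    then show "\<exists>d. ((\<lambda>x. sin x - x / 2) has_real_derivative d) (at y) \<and> 0 \<le> d"
      by (intro exI[of _ "cos y - 1/2"] conjI) (auto intro!: derivative_eq_intros simp: cos_60)
  qed
  then show ?thesis by simp
qed

lemma geometric_shift_suminf:
  fixes \<rho> :: real
  assumes "0 \<le> \<rho>" "\<rho> < 1"
  shows "summable (\<lambda>j. \<rho> ^ (j + 1))" "(\<Sum>j. \<rho> ^ (j + T + 1)) = \<rho> ^ (T + 1) / (1 - \<rho>)"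
proof -
  have "(\<lambda>j. \<rho> ^ (T + 1) * \<rho> ^ j) sums (\<rho> ^ (T + 1) * (1 / (1 - \<rho>)))"
    using assms by (intro sums_mult geometric_sums) auto
  then show "(\<Sum>j. \<rho> ^ (j + T + 1)) = \<rho> ^ (T + 1) / (1 - \<rho>)"
    by (simp add: sums_iff power_add mult_ac)
  show "summable (\<lambda>j. \<rho> ^ (j + 1))"
    using assms summable_mult[OF summable_geometric[of \<rho>], of \<rho>] by simp
qed

lemma next_multiple:
  fixes q n :: nat
  assumes "0 < q"
  obtains j0 where "j0 < q" "\<And>j. j < q \<Longrightarrow> q dvd n + 1 + j \<Longrightarrow> j = j0"
proof -
  have le: "i \<le> j" if "i < q" "q dvd n + 1 + j" "q dvd n + 1 + i" for i j
  proof (rule ccontr)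
    assume "\<not> i \<le> j"
    moreover have "q dvd (n + 1 + i) - (n + 1 + j)" using that by (intro dvd_diff_nat)
    ultimately show False using that(1) nat_dvd_not_less[of "i - j" q] by simp
  qed
  then have uniq: "j = i" if "j < q" "i < q" "q dvd n + 1 + j" "q dvd n + 1 + i" for i j
    using that by (meson le_antisym)
  show ?thesis
  proof (cases "\<exists>j<q. q dvd n + 1 + j")
    case True then show ?thesis using uniq that by blast
  next
    case False then show ?thesis using that[of 0] assms by blast
  qed
qed

text \<open>Dirichlet approximation gives p / q within 1 / q^2 of the angle divided by pi, with q as
  large as desired, so the angle drifts from the rational one by less than pi / q during q steps.
  The margins needed are of order 1 / q, while the terms after about q / 2 steps are exponentially
  small in q. The free positions are the multiples of q.\<close>

lemma hausdorff_dim_pos_irrational: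
  fixes X :: "nat \<Rightarrow> 'a::{banach,real_inner}" and \<kappa> :: complex
  assumes sm: "summable (\<lambda>k. norm (X k))" and re: "realizes X (\<lambda>k. \<kappa> ^ k) B"
    and \<kappa>: "cmod \<kappa> < 1" and irr: "Arg \<kappa> / pi \<notin> \<rat>"
  shows "0 < hausdorff_dim (unique_sums X)"
proof -
  define \<rho> \<theta> where "\<rho> = cmod \<kappa>" and "\<theta> = Arg \<kappa>"
  have "\<kappa> \<noteq> 0" using irr by (auto simp: Arg_zero)
  then have \<rho>: "0 < \<rho>" "\<rho> < 1" using \<kappa> by (auto simp: \<rho>_def)
  have \<kappa>_eq: "\<kappa> = rcis \<rho> \<theta>" by (simp add: \<rho>_def \<theta>_def rcis_cmod_Arg)
  \<comment> \<open>This limit is designed to give \<rho>^(T+1) / (1 - \<rho>) < (1 - \<rho>) / (2q)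
    for T = \<open>q div 2\<close>, with q estimated by 2T + 1.\<close>
  have "(\<lambda>x. (2 * (of_nat x * \<rho> ^ x) + \<rho> ^ x) * 2 * (\<rho> / (1 - \<rho>))) \<longlonglongrightarrow> (2 * 0 + 0) * 2 * (\<rho> / (1 - \<rho>))"
    using \<rho> by (intro tendsto_intros powser_times_n_limit_0 LIMSEQ_power_zero) auto
  then have lim: "(\<lambda>x. (2 * (of_nat x * \<rho> ^ x) + \<rho> ^ x) * 2 * (\<rho> / (1 - \<rho>))) \<longlonglongrightarrow> 0" by simp
  have "0 < 1 - \<rho>" using \<rho> by simp
  from order_tendstoD(2)[OF lim this] obtain x0 where
    x0: "\<And>x. x0 \<le> x \<Longrightarrow> (2 * (of_nat x * \<rho> ^ x) + \<rho> ^ x) * 2 * (\<rho> / (1 - \<rho>)) < 1 - \<rho>"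
    by (auto simp: eventually_sequentially)
  have "infinite (approx_set (\<theta> / pi))" using irr rational_iff_finite_approx_set by (simp add: \<theta>_def)
  from infinite_approx_set[OF this] obtain p k where pk: "(p, k) \<in> approx_set (\<theta> / pi)" "int (2 * x0 + 3) < k"
    by blast
  define q where "q = nat k"
  have k: "k = int q" and q3: "2 * x0 + 3 < q" using pk(2) by (auto simp: q_def)
  have cop: "coprime p (int q)" and "\<bar>\<theta> / pi - p / q\<bar> < 1 / (real q)\<^sup>2"
    using pk(1) k by (auto simp: approx_set_def)
  have q0: "0 < q" using q3 by simp
  define \<phi> where "\<phi> = pi * p / q"
  define \<delta> where "\<delta> = \<theta> - \<phi>"
  have "\<delta> = pi * (\<theta> / pi - p / q)" by (simp add: \<delta>_def \<phi>_def field_simps)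
  then have "\<bar>\<delta>\<bar> = pi * \<bar>\<theta> / pi - p / q\<bar>" by (simp add: abs_mult)
  also have "\<dots> < pi * (1 / (real q)\<^sup>2)"
    using \<open>\<bar>\<theta> / pi - p / q\<bar> < 1 / (real q)\<^sup>2\<close> by (intro mult_strict_left_mono) auto
  finally have \<delta>: "\<bar>\<delta>\<bar> < pi / q / q" by (simp add: power2_eq_square)
  define T where "T = q div 2"
  have "x0 \<le> T" "real q \<le> 2 * T + 1" "T \<le> q - 1" "0 < T" using q3 by (auto simp: T_def)
  have tail: "\<rho> ^ (T + 1) / (1 - \<rho>) < (1 - \<rho>) / (2 * q)"
  proof -
    have "real q * (2 * (\<rho> ^ T * (\<rho> / (1 - \<rho>)))) \<le> (2 * T + 1) * (2 * (\<rho> ^ T * (\<rho> / (1 - \<rho>))))"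
      using \<open>real q \<le> 2 * T + 1\<close> \<rho> by (intro mult_right_mono) auto
    also have "\<dots> = (2 * (of_nat T * \<rho> ^ T) + \<rho> ^ T) * 2 * (\<rho> / (1 - \<rho>))"
      by (simp add: algebra_simps add_divide_distrib)
    also have "\<dots> < 1 - \<rho>" by (rule x0[OF \<open>x0 \<le> T\<close>])
    finally show ?thesis using q0 by (simp add: field_simps)
  qed
  have sinq: "1 / q \<le> sin (pi / q)" "1 / (2 * q) \<le> sin (pi / (2 * q))"
  proof -
    have "pi / q \<le> pi / 3" using q3 by (intro divide_left_mono) auto
    moreover have "pi / (2 * q) \<le> pi / 3" using q3 by (intro divide_left_mono) auto
    ultimately have "pi / q / 2 \<le> sin (pi / q)" "pi / (2 * q) / 2 \<le> sin (pi / (2 * q))"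
      using sin_ge_half[of "pi / q"] sin_ge_half[of "pi / (2 * q)"] by simp_all
    moreover have "1 / q \<le> pi / q / 2" "1 / (2 * q) \<le> pi / (2 * q) / 2"
      using q0 pi_ge_two by (auto simp: field_simps)
    ultimately show "1 / q \<le> sin (pi / q)" "1 / (2 * q) \<le> sin (pi / (2 * q))" by linarith+
  qed
  define c where "c = (1 - \<rho>) / (2 * q) - \<rho> ^ (T + 1) / (1 - \<rho>)"
  have c0: "0 < c" using tail by (simp add: c_def)
  define s where "s m = (if q dvd m then 1 else sgn (sin (real m * \<phi>)))" for m
  have sin_nz: "sin (real m * \<phi>) \<noteq> 0" if "\<not> q dvd m" for m
    using sin_frac_same_sign[OF cop that q0, of 0] q0 by (auto simp: \<phi>_def)
  have s: "s \<in> sign_seqs" using sin_nz by (auto simp: sign_seqs_def s_def sgn_if)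
  show ?thesis
  proof (rule hausdorff_dim_pos_free_at_multiples[OF sm s q0 c0 \<rho>])
    fix a n assume a: "a \<in> sign_seqs" and as: "\<And>k. \<not> q dvd k \<Longrightarrow> a k = s k"
    \<comment> \<open>The coefficient resets the phase at n to the rational angle
      \<open>n * \<phi>\<close>, shifted by \<eta>; after k further steps the deviation from the
      rational pattern is only \<open>k * \<delta> + \<eta>\<close>.\<close>
    have functional: "\<exists>v. \<rho> ^ n * norm v \<le> B \<and> (\<forall>k. inner v (X (n + k)) = \<rho> ^ k * sin (n * \<phi> + k * \<theta> + \<eta>))" for \<eta>
    proof -
      define d where "d = rcis (1 / \<rho> ^ n) (n * \<phi> - n * \<theta> + \<eta> - pi / 2)"
      obtain v where v: "norm v \<le> B * cmod d" "\<And>k. inner v (X k) = Re (d * \<kappa> ^ k)"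
        using realizesE[OF re] by blast
      have "cmod d = 1 / \<rho> ^ n" using \<rho> by (simp add: d_def)
      then have "\<rho> ^ n * norm v \<le> \<rho> ^ n * (B * (1 / \<rho> ^ n))"
        using v(1) \<rho> by (intro mult_left_mono) auto
      also have "\<dots> = B" using \<rho> by simp
      finally have "\<rho> ^ n * norm v \<le> B" .
      moreover have "inner v (X (n + k)) = \<rho> ^ k * sin (n * \<phi> + k * \<theta> + \<eta>)" for k
      proof -
        have "d * \<kappa> ^ (n + k) = rcis (1 / \<rho> ^ n * \<rho> ^ (n + k)) (n * \<phi> - n * \<theta> + \<eta> - pi / 2 + (n + k) * \<theta>)"
          unfolding d_def \<kappa>_eq DeMoivre2 rcis_mult by simp
        also have "1 / \<rho> ^ n * \<rho> ^ (n + k) = \<rho> ^ k" using \<rho> by (simp add: power_add)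
        also have "n * \<phi> - n * \<theta> + \<eta> - pi / 2 + (n + k) * \<theta> = (n * \<phi> + k * \<theta> + \<eta>) - pi / 2"
          by (simp add: algebra_simps)
        finally show ?thesis unfolding v(2) by (simp only: Re_rcis cos_diff cos_pi_half sin_pi_half) simp
      qed
      ultimately show ?thesis by blast
    qed
    have same: "0 \<le> a (n + k) * (\<rho> ^ k * sin (n * \<phi> + k * \<theta> + \<eta>))"
      if "\<not> q dvd n + k" "\<bar>k * \<delta> + \<eta>\<bar> < pi / q" for k \<eta>
    proof -
      have eq: "n * \<phi> + k * \<theta> + \<eta> = real (n + k) * \<phi> + (k * \<delta> + \<eta>)"
        by (simp add: \<delta>_def algebra_simps)
      have "0 < sin (real (n + k) * \<phi>) * sin (real (n + k) * \<phi> + (k * \<delta> + \<eta>))"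
        using sin_frac_same_sign[OF cop that(1) q0 that(2)] by (simp add: \<phi>_def)
      then have "0 \<le> s (n + k) * sin (n * \<phi> + k * \<theta> + \<eta>)"
        unfolding eq s_def using that(1) by (auto simp: sgn_if zero_less_mult_iff split: if_splits)
      then have "0 \<le> \<rho> ^ k * (s (n + k) * sin (n * \<phi> + k * \<theta> + \<eta>))" using \<rho> by simp
      then show ?thesis using as[OF that(1)] by (simp add: mult_ac)
    qed
    have kd: "\<bar>real k * \<delta>\<bar> \<le> real k * (pi / q / q)" for k
      unfolding abs_mult abs_of_nat by (intro mult_left_mono) (use \<delta> in linarith, simp)
    have bound: "max 0 (- (a (n + 1 + j) * (\<rho> ^ (j + 1) * sin y))) \<le> \<rho> ^ (j + 1)" for j y
    proof -
      have "\<bar>a (n + 1 + j) * (\<rho> ^ (j + 1) * sin y)\<bar> \<le> 1 * (\<rho> ^ (j + 1) * 1)"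
        unfolding abs_mult using \<rho> by (intro mult_mono) (auto simp: sign_seqs_abs[OF a])
      then show ?thesis using \<rho> by auto
    qed
    show "\<exists>v. \<rho> ^ n * norm v \<le> B \<and> c \<le> a n * inner v (X n) - mismatch_cost a (\<lambda>k. inner v (X k)) n"
    proof (cases "q dvd n")
      case True
      \<comment> \<open>Half of the tolerance pi / q decides the sign at n, where the unshifted
        functional vanishes; the other half is left for the drift during \<open>q div 2\<close>
        steps.\<close>
      define \<eta> where "\<eta> = a n * cos (n * \<phi>) * (pi / (2 * q))"
      have cn: "\<bar>cos (n * \<phi>)\<bar> = 1" "sin (n * \<phi>) = 0"
        using frac_angle_multiple(1,2)[OF q0 True, of p] by (simp_all add: \<phi>_def)
      obtain v where v: "\<rho> ^ n * norm v \<le> B" "\<And>k. inner v (X (n + k)) = \<rho> ^ k * sin (n * \<phi> + k * \<theta> + \<eta>)"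
        using functional by blast
      have w: "inner v (X (n + 1 + j)) = \<rho> ^ (j + 1) * sin (n * \<phi> + (j + 1) * \<theta> + \<eta>)" for j
        using v(2)[of "j + 1"] by (simp add: add_ac)
      have ac: "a n * cos (n * \<phi>) = 1 \<or> a n * cos (n * \<phi>) = - 1"
        using cn(1) sign_seqs_cases[OF a, of n] by (auto simp: abs_if split: if_splits)
      have ab\<eta>: "\<bar>\<eta>\<bar> = pi / q / 2" using ac by (auto simp: \<eta>_def)
      have "a n * inner v (X n) = sin (pi / (2 * q))"
        using v(2)[of 0] ac cn(2) sign_seqs_cases[OF a, of n] by (auto simp: \<eta>_def sin_add)
      moreover have "mismatch_cost a (\<lambda>k. inner v (X k)) n \<le> 0 + (\<Sum>j. \<rho> ^ (j + T + 1))"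
      proof (rule mismatch_cost_le[OF summable_inner_right[OF sm] a geometric_shift_suminf(1), where l = T])
        show "max 0 (- (a (n + 1 + j) * inner v (X (n + 1 + j)))) \<le> \<rho> ^ (j + 1)" for j
          unfolding w by (rule bound)
        fix j assume j: "j < T"
        have "\<not> q dvd n + (j + 1)"
          using True j \<open>T \<le> q - 1\<close> by (metis add.commute dvd_add_right_iff less_diff_conv nat_dvd_not_less order_less_le_trans zero_less_Suc Suc_eq_plus1)
        moreover have "\<bar>real (j + 1) * \<delta> + \<eta>\<bar> < pi / q"
        proof -
          have "real (j + 1) * \<bar>\<delta>\<bar> < real (j + 1) * (pi / q / q)" using \<delta> by (intro mult_strict_left_mono) auto
          also have "\<dots> \<le> (q / 2) * (pi / q / q)"
            using j by (intro mult_right_mono) (auto simp: T_def)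
          also have "\<dots> = pi / q / 2" using q0 by simp
          finally have lt: "\<bar>real (j + 1) * \<delta>\<bar> < pi / q / 2" by (simp add: abs_mult)
          have "\<bar>real (j + 1) * \<delta> + \<eta>\<bar> \<le> \<bar>real (j + 1) * \<delta>\<bar> + \<bar>\<eta>\<bar>" by (rule abs_triangle_ineq)
          also have "\<dots> < pi / q / 2 + pi / q / 2" unfolding ab\<eta> by (rule add_strict_right_mono[OF lt])
          also have "\<dots> = pi / q" by (rule field_sum_of_halves)
          finally show ?thesis .
        qed
        ultimately show "0 \<le> a (n + 1 + j) * inner v (X (n + 1 + j))"
          unfolding w using same[of "j + 1" \<eta>] by (simp add: add_ac)
      qed (use \<rho> in auto)
      moreover have "(1 - \<rho>) / (2 * q) \<le> 1 / (2 * q)" using \<rho> q0 by (intro divide_right_mono) auto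
      ultimately have "c \<le> a n * inner v (X n) - mismatch_cost a (\<lambda>k. inner v (X k)) n"
        using geometric_shift_suminf(2)[of \<rho> T] \<rho> sinq(2) unfolding c_def by linarith
      then show ?thesis using v(1) by blast
    next
      case False
      obtain v where v: "\<rho> ^ n * norm v \<le> B" "\<And>k. inner v (X (n + k)) = \<rho> ^ k * sin (n * \<phi> + k * \<theta> + 0)"
        using functional by blast
      have w: "inner v (X (n + 1 + j)) = \<rho> ^ (j + 1) * sin (n * \<phi> + (j + 1) * \<theta> + 0)" for j
        using v(2)[of "j + 1"] by (simp add: add_ac)
      \<comment> \<open>At most one of the next q - 1 positions is a multiple of q. Its sign is
        free, but the functional is at most \<open>\<rho> * sin (pi / q)\<close> there, against a
        leading term of at least \<open>sin (pi / q)\<close>.\<close>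
      obtain j0 where j0: "j0 < q" "\<And>j. j < q \<Longrightarrow> q dvd n + 1 + j \<Longrightarrow> j = j0"
        using next_multiple[OF q0] by blast
      have "0 < 1 / real q" using q0 by simp
      then have sp: "0 < sin (pi / q)" using sinq(1) by linarith
      have "a n * inner v (X n) = \<bar>sin (n * \<phi>)\<bar>"
        using v(2)[of 0] as[OF False] False by (simp add: s_def abs_sgn mult.commute)
      then have "sin (pi / q) \<le> a n * inner v (X n)"
        using sin_frac_abs_ge[OF cop False q0] by (simp add: \<phi>_def)
      moreover have "mismatch_cost a (\<lambda>k. inner v (X k)) n \<le> \<rho> * sin (pi / q) + (\<Sum>j. \<rho> ^ (j + (q - 1) + 1))"
      proof (rule mismatch_cost_le[OF summable_inner_right[OF sm] a geometric_shift_suminf(1), where l = j0])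
        show "max 0 (- (a (n + 1 + j) * inner v (X (n + 1 + j)))) \<le> \<rho> ^ (j + 1)" for j
          unfolding w by (rule bound)
        have small: "\<bar>real (j + 1) * \<delta>\<bar> < pi / q" if "j < q - 1" for j
        proof -
          have "\<bar>real (j + 1) * \<delta>\<bar> \<le> real (j + 1) * (pi / q / q)" by (rule kd)
          also have "\<dots> < q * (pi / q / q)" using that q0 by (intro mult_strict_right_mono) auto
          finally show ?thesis using q0 by simp
        qed
        show "0 \<le> a (n + 1 + j) * inner v (X (n + 1 + j))" if "j < q - 1" "j \<noteq> j0" for j
        proof -
          have "j < q" using that(1) by simp
          then have "\<not> q dvd n + (j + 1)" using j0(2)[of j] that(2) by (auto simp: add_ac)
          then show ?thesis unfolding w using same[of "j + 1" 0] small[OF that(1)] by (simp add: add_ac)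
        qed
        show "- (a (n + 1 + j0) * inner v (X (n + 1 + j0))) \<le> \<rho> * sin (pi / q)" if "j0 < q - 1"
        proof (cases "q dvd n + (j0 + 1)")
          case True
          have eq: "n * \<phi> + (j0 + 1) * \<theta> + 0 = real (n + (j0 + 1)) * \<phi> + (j0 + 1) * \<delta>"
            by (simp add: \<delta>_def algebra_simps)
          have "pi / q \<le> pi / 3" using q3 by (intro divide_left_mono) auto
          then have "\<bar>sin ((j0 + 1) * \<delta>)\<bar> \<le> sin (pi / q)"
          proof -
            define y where "y = \<bar>real (j0 + 1) * \<delta>\<bar>"
            have y: "0 \<le> y" "y \<le> pi / q" using small[OF that] by (simp_all add: y_def)
            have piq: "pi / q \<le> pi / 2" "0 < pi" using \<open>pi / q \<le> pi / 3\<close> pi_gt_zero by linarith+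
            have "sin y \<le> sin (pi / q)"
              using y piq by (intro sin_monotone_2pi_le) linarith+
            moreover have "0 \<le> sin y"
              using y piq by (intro sin_ge_zero) linarith+
            ultimately show ?thesis unfolding y_def by (auto simp: abs_if split: if_splits)
          qed
          then have "\<bar>sin (n * \<phi> + (j0 + 1) * \<theta> + 0)\<bar> \<le> sin (pi / q)"
            unfolding eq using frac_angle_multiple(3)[OF q0 True, of p "(j0 + 1) * \<delta>"] by (simp add: \<phi>_def)
          moreover have "\<rho> ^ (j0 + 1) \<le> \<rho>" using \<rho> by (simp add: power_le_one mult_left_le)
          ultimately have "\<rho> ^ (j0 + 1) * \<bar>sin (n * \<phi> + (j0 + 1) * \<theta> + 0)\<bar> \<le> \<rho> * sin (pi / q)"
            using \<rho> by (intro mult_mono) auto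
          then have "\<bar>a (n + 1 + j0) * inner v (X (n + 1 + j0))\<bar> \<le> \<rho> * sin (pi / q)"
            unfolding w using \<rho> by (simp add: abs_mult sign_seqs_abs[OF a] add.commute[of _ 1])
          then show ?thesis by linarith
        next
          case False
          then have "0 \<le> a (n + 1 + j0) * inner v (X (n + 1 + j0))"
            unfolding w using same[of "j0 + 1" 0] small[OF that] by (simp add: add_ac)
          then show ?thesis using \<rho> sp mult_nonneg_nonneg[of \<rho> "sin (pi / q)"] by linarith
        qed
      qed (use \<rho> sp in auto)
      moreover have "\<rho> ^ (q - 1 + 1) \<le> \<rho> ^ (T + 1)" using \<rho> \<open>T \<le> q - 1\<close> by (intro power_decreasing) auto
      then have "\<rho> ^ (q - 1 + 1) / (1 - \<rho>) \<le> \<rho> ^ (T + 1) / (1 - \<rho>)" using \<rho> by (intro divide_right_mono) auto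
      moreover have "(1 - \<rho>) / (2 * q) \<le> (1 - \<rho>) * sin (pi / q)"
      proof -
        have "(1 - \<rho>) / (2 * q) = (1 - \<rho>) * (1 / (2 * q))" by simp
        also have "1 / (2 * q) \<le> 1 / q" using q0 by (simp add: field_simps)
        then have "(1 - \<rho>) * (1 / (2 * q)) \<le> (1 - \<rho>) * sin (pi / q)"
          using sinq(1) \<rho> by (intro mult_left_mono) linarith+
        finally show ?thesis .
      qed
      moreover have "(1 - \<rho>) * sin (pi / q) = sin (pi / q) - \<rho> * sin (pi / q)" by (simp add: algebra_simps)
      ultimately have "c \<le> a n * inner v (X n) - mismatch_cost a (\<lambda>k. inner v (X k)) n"
        using geometric_shift_suminf(2)[of \<rho> "q - 1"] \<rho> unfolding c_def by linarith
      then show ?thesis using v(1) by blast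
    qed
  qed
qed

section \<open>Rational angles\<close>


text \<open>At multiples of q the sine vanishes; the cosine, which is 1 or -1 there, takes over as
  reference sign.\<close>

definition frac_base :: "int \<Rightarrow> nat \<Rightarrow> nat \<Rightarrow> real" where
  "frac_base p q m = (if q dvd m then cos (real m * (pi * p / q)) else sgn (sin (real m * (pi * p / q))))"

lemma frac_base_sign_seqs:
  assumes "coprime p (int q)" "0 < q"
  shows "frac_base p q \<in> sign_seqs"
proof -
  have "frac_base p q m = 1 \<or> frac_base p q m = - 1" for m
  proof (cases "q dvd m")
    case True
    then show ?thesis using frac_angle_multiple(2)[OF assms(2) True, of p]
      by (auto simp: frac_base_def abs_if split: if_splits)
  next
    case False
    then show ?thesis using sin_frac_same_sign[OF assms(1) False assms(2), of 0] assms
      by (auto simp: frac_base_def sgn_if)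
  qed
  then show ?thesis by (auto simp: sign_seqs_def)
qed

lemma sin_frac_lower_bound:
  assumes "coprime p (int q)" "0 < q"
  obtains \<sigma> where "0 < \<sigma>" "\<sigma> \<le> 1" "\<And>m. \<not> q dvd m \<Longrightarrow> \<sigma> \<le> \<bar>sin (real m * (pi * p / q))\<bar>"
proof (cases "q = 1")
  case True then show ?thesis using that[of 1] by simp
next
  case False
  then have "2 \<le> real q" using assms by linarith
  then have "pi / q \<le> pi / 2" by (intro divide_left_mono) auto
  moreover have "0 < pi / q" using assms by simp
  ultimately have "0 < sin (pi / q)" using pi_gt_zero by (intro sin_gt_zero) linarith+
  then show ?thesis using that[of "sin (pi / q)"] sin_frac_abs_ge[OF assms(1) _ assms(2)] by simp
qed

lemma Re_Complex_rcis_power: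
  assumes "0 < \<rho>"
  shows "Re (Complex (\<alpha> / \<rho> ^ n) (- (\<beta> / \<rho> ^ n)) * rcis \<rho> \<phi> ^ (n + k))
    = \<rho> ^ k * (\<alpha> * cos (real (n + k) * \<phi>) + \<beta> * sin (real (n + k) * \<phi>))"
  unfolding DeMoivre2 using assms by (simp add: rcis_def power_add field_simps)

lemma frac_base_multiple:
  assumes "0 < q" "q dvd m"
  shows "sin (real m * (pi * p / q)) = 0" "frac_base p q m = cos (real m * (pi * p / q))"
    "frac_base p q m * cos (real m * (pi * p / q)) = 1"
  using assms(2) frac_angle_multiple(1,2)[OF assms, of p]
  by (auto simp: frac_base_def abs_if split: if_splits)

lemma frac_base_nonmultiple:
  assumes "\<not> q dvd m"
  shows "frac_base p q m * sin (real m * (pi * p / q)) = \<bar>sin (real m * (pi * p / q))\<bar>"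
  using assms by (simp add: frac_base_def abs_sgn mult.commute)

text \<open>\<open>flip\<close> supplies, at every position divisible by \<open>q\<close>, a functional whose leading sign is opposite to
  the base sequence although all its later signs agree with it.\<close>

lemma hausdorff_dim_pos_rational:
  fixes X :: "nat \<Rightarrow> 'a::{banach,real_inner}" and p :: int and q :: nat
  assumes sm: "summable (\<lambda>k. norm (X k))"
    and re: "realizes X (\<lambda>k. (rcis \<rho> (pi * p / q)) ^ k) B"
    and \<rho>: "0 < \<rho>" "\<rho> < 1" and cop: "coprime p (int q)" and q0: "0 < q"
    and r: "0 < r" "r \<le> \<rho>" and c: "0 < c" and sg: "summable g" and g0: "\<And>j. 0 \<le> g j"
    and flip: "\<And>n. q dvd n \<Longrightarrow> \<exists>v. r ^ n * norm v \<le> C \<and> frac_base p q n * inner v (X n) \<le> - c \<and>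
      (\<forall>j. 0 \<le> frac_base p q (n + 1 + j) * inner v (X (n + 1 + j))) \<and>
      (\<forall>j. q dvd n + 1 + j \<longrightarrow> \<bar>inner v (X (n + 1 + j))\<bar> \<le> g j)"
  shows "0 < hausdorff_dim (unique_sums X)"
proof -
  note witness = flip
  define \<phi> where "\<phi> = pi * p / q"
  define s where "s = frac_base p q"
  have s: "s \<in> sign_seqs" unfolding s_def by (rule frac_base_sign_seqs[OF cop q0])
  obtain \<sigma> where \<sigma>: "0 < \<sigma>" "\<sigma> \<le> 1" "\<And>m. \<not> q dvd m \<Longrightarrow> \<sigma> \<le> \<bar>sin (real m * \<phi>)\<bar>"
    using sin_frac_lower_bound[OF cop q0] unfolding \<phi>_def by blast
  \<comment> \<open>With this factor the sine term outweighs the cosine wherever q does not divide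
    the index.\<close>
  define K where "K = 1 / \<sigma>"
  have K: "0 < K" "\<And>m. \<not> q dvd m \<Longrightarrow> 1 \<le> K * \<bar>sin (real m * \<phi>)\<bar>"
    using \<sigma> by (auto simp: K_def field_simps)
  have "0 < c / 2" "0 < (1 - \<rho>) / 2" using c \<rho> by auto
  from suminf_exist_split[OF this(1) sg] suminf_exist_split[OF this(2) geometric_shift_suminf(1)[of \<rho>]] \<rho>
  obtain T1 T2 where T1: "\<And>T. T1 \<le> T \<Longrightarrow> norm (\<Sum>j. g (j + T)) < c / 2"
    and T2: "\<And>T. T2 \<le> T \<Longrightarrow> norm (\<Sum>j. \<rho> ^ (j + T + 1)) < (1 - \<rho>) / 2" by auto
  \<comment> \<open>A multiple of q, so large that the tails from position n + L on are
    negligible.\<close>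
  define L where "L = q * (T1 + T2 + 1)"
  define T where "T = L - 1"
  have L0: "0 < L" and qL: "q dvd L" using q0 by (simp_all add: L_def)
  have "1 * (T1 + T2 + 1) \<le> L" unfolding L_def using q0 by (intro mult_right_mono) auto
  then have T12: "T1 \<le> T" "T2 \<le> T" by (simp_all add: T_def)
  have tail1: "(\<Sum>j. g (j + T)) < c / 2" using T1[OF T12(1)] by simp
  have tail2: "(\<Sum>j. \<rho> ^ (j + T + 1)) < (1 - \<rho>) / 2" using T2[OF T12(2)] by simp
  define c0 where "c0 = min (c / 2) (min \<sigma> ((1 - \<rho>) / 2))"
  have c00: "0 < c0" "c0 \<le> c / 2" "c0 \<le> \<sigma>" "c0 \<le> (1 - \<rho>) / 2"
    using c \<sigma> \<rho> unfolding c0_def by (simp, linarith+)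
  have B: "0 \<le> B" using re by (rule realizes_nonneg)
  define C' where "C' = max C (B * (1 + K))"
  have functional: "\<exists>v. r ^ n * norm v \<le> C' \<and>
      (\<forall>k. inner v (X (n + k)) = \<rho> ^ k * (\<alpha> * cos (real (n + k) * \<phi>) + K * sin (real (n + k) * \<phi>)))"
    if \<alpha>: "\<alpha> = 0 \<or> \<alpha> = 1" for n \<alpha>
  proof -
    define d where "d = Complex (\<alpha> / \<rho> ^ n) (- (K / \<rho> ^ n))"
    obtain v where v: "norm v \<le> B * cmod d" "\<And>k. inner v (X k) = Re (d * rcis \<rho> \<phi> ^ k)"
      using realizesE[OF re] unfolding \<phi>_def by blast
    have "cmod d \<le> \<bar>\<alpha> / \<rho> ^ n\<bar> + \<bar>K / \<rho> ^ n\<bar>" using cmod_le[of d] by (simp add: d_def)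
    also have "\<dots> \<le> (1 + K) / \<rho> ^ n" using \<alpha> \<rho> K(1) by (auto simp: add_divide_distrib)
    finally have "norm v \<le> B * ((1 + K) / \<rho> ^ n)" using v(1) B by (meson mult_left_mono order_trans)
    then have "r ^ n * norm v \<le> \<rho> ^ n * (B * ((1 + K) / \<rho> ^ n))"
      using r \<rho> by (intro mult_mono power_mono) auto
    also have "\<dots> = B * (1 + K)" using \<rho> by simp
    finally have "r ^ n * norm v \<le> C'" by (simp add: C'_def)
    moreover have "inner v (X (n + k)) = \<rho> ^ k * (\<alpha> * cos (real (n + k) * \<phi>) + K * sin (real (n + k) * \<phi>))" for k
      unfolding v(2) d_def by (rule Re_Complex_rcis_power[OF \<rho>(1)])
    ultimately show ?thesis by blast
  qed
  have s_mult: "s m = cos (real m * \<phi>)" "sin (real m * \<phi>) = 0" "s m * cos (real m * \<phi>) = 1" if "q dvd m" for m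
    using that frac_angle_multiple(1,2)[OF q0 that, of p]
    by (auto simp: s_def frac_base_def \<phi>_def abs_if split: if_splits)
  have s_nmult: "s m = sgn (sin (real m * \<phi>))" if "\<not> q dvd m" for m
    using that by (simp add: s_def frac_base_def \<phi>_def)
  have nonneg: "0 \<le> s m * (\<rho> ^ k * (\<alpha> * cos (real m * \<phi>) + K * sin (real m * \<phi>)))"
    if \<alpha>: "\<alpha> = 0 \<or> \<alpha> = 1" for m k \<alpha>
  proof (cases "q dvd m")
    case True
    have "s m * (\<rho> ^ k * (\<alpha> * cos (real m * \<phi>) + K * sin (real m * \<phi>))) = \<rho> ^ k * \<alpha> * (s m * cos (real m * \<phi>))"
      using s_mult(2)[OF True] by simp
    also have "\<dots> = \<rho> ^ k * \<alpha>" using s_mult(3)[OF True] by simp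
    finally have eq: "s m * (\<rho> ^ k * (\<alpha> * cos (real m * \<phi>) + K * sin (real m * \<phi>))) = \<rho> ^ k * \<alpha>" .
    show ?thesis unfolding eq using \<alpha> \<rho> by auto
  next
    case False
    have "\<bar>\<alpha> * (s m * cos (real m * \<phi>))\<bar> \<le> 1"
      using \<alpha> by (auto simp: abs_mult sign_seqs_abs[OF s])
    moreover have "s m * (K * sin (real m * \<phi>)) = K * \<bar>sin (real m * \<phi>)\<bar>"
      unfolding s_nmult[OF False] by (simp add: abs_sgn mult_ac)
    ultimately have "0 \<le> \<alpha> * (s m * cos (real m * \<phi>)) + s m * (K * sin (real m * \<phi>))"
      using K(2)[OF False] by linarith
    then have "0 \<le> \<rho> ^ k * (\<alpha> * (s m * cos (real m * \<phi>)) + s m * (K * sin (real m * \<phi>)))" using \<rho> by simp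
    then show ?thesis by (simp add: algebra_simps)
  qed
  show ?thesis
  proof (rule hausdorff_dim_pos_free_at_multiples[OF sm s L0 c00(1) r(1)])
    show "r < 1" using r \<rho> by simp
    fix a n assume a: "a \<in> sign_seqs" and as: "\<And>k. \<not> L dvd k \<Longrightarrow> a k = s k"
    have asq: "a k = s k" if "\<not> q dvd k" for k using as that qL dvd_trans by blast
    consider (generic) "\<not> q dvd n" | (keep) "q dvd n" "a n = s n" | (flip) "q dvd n" "a n = - s n"
    proof -
      have "a n = s n \<or> a n = - s n"
        using sign_seqs_cases[OF a, of n] sign_seqs_cases[OF s, of n] by auto
      then show ?thesis using that by blast
    qed
    then show "\<exists>v. r ^ n * norm v \<le> C' \<and> c0 \<le> a n * inner v (X n) - mismatch_cost a (\<lambda>k. inner v (X k)) n"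
    proof cases
      \<comment> \<open>The pure sine functional vanishes at all multiples of q, so it never meets a
        free sign and has no mismatch at all.\<close>
      case generic
      obtain v where v: "r ^ n * norm v \<le> C'" "\<And>k. inner v (X (n + k)) = \<rho> ^ k * (0 * cos (real (n + k) * \<phi>) + K * sin (real (n + k) * \<phi>))"
        using functional[of 0] by blast
      have w: "inner v (X (n + 1 + j)) = \<rho> ^ (j + 1) * (0 * cos (real (n + 1 + j) * \<phi>) + K * sin (real (n + 1 + j) * \<phi>))" for j
        using v(2)[of "j + 1"] by (simp add: add_ac)
      have "0 \<le> a (n + 1 + j) * inner v (X (n + 1 + j))" for j
      proof (cases "q dvd n + 1 + j")
        case True then show ?thesis unfolding w using s_mult(2)[OF True] by simp
      next
        case False
        then show ?thesis unfolding w asq[OF False] by (intro nonneg) simp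
      qed
      then have "max 0 (- (a (n + 1 + j) * inner v (X (n + 1 + j)))) = 0" for j
        by (simp only: max_absorb1 neg_le_0_iff_le)
      then have "mismatch_cost a (\<lambda>k. inner v (X k)) n = 0" by (simp only: mismatch_cost_def suminf_zero)
      moreover have "a n * inner v (X n) = K * \<bar>sin (real n * \<phi>)\<bar>"
        using v(2)[of 0] unfolding asq[OF generic] s_nmult[OF generic] by (simp add: abs_sgn mult_ac)
      moreover have "\<sigma> \<le> K * \<bar>sin (real n * \<phi>)\<bar>" using K(2)[OF generic] \<sigma>(2) by linarith
      ultimately have "c0 \<le> a n * inner v (X n) - mismatch_cost a (\<lambda>k. inner v (X k)) n"
        using c00(3) by linarith
      then show ?thesis using v(1) by blast
    next
      \<comment> \<open>The leading value is 1, the next multiple of L costs at most \<rho>, and the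
        tail costs less than half of the remaining 1 - \<rho>.\<close>
      case keep
      obtain v where v: "r ^ n * norm v \<le> C'" "\<And>k. inner v (X (n + k)) = \<rho> ^ k * (1 * cos (real (n + k) * \<phi>) + K * sin (real (n + k) * \<phi>))"
        using functional[of 1] by blast
      have w: "inner v (X (n + 1 + j)) = \<rho> ^ (j + 1) * (1 * cos (real (n + 1 + j) * \<phi>) + K * sin (real (n + 1 + j) * \<phi>))" for j
        using v(2)[of "j + 1"] by (simp add: add_ac)
      have bd: "- (a (n + 1 + j) * inner v (X (n + 1 + j))) \<le> \<rho> ^ (j + 1)" for j
      proof (cases "q dvd n + 1 + j")
        case True
        have "\<bar>cos (real (n + 1 + j) * \<phi>)\<bar> = 1" using frac_angle_multiple(2)[OF q0 True, of p] by (simp add: \<phi>_def)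
        then have "\<bar>a (n + 1 + j) * inner v (X (n + 1 + j))\<bar> = \<rho> ^ (j + 1)"
          unfolding w using s_mult(2)[OF True] \<rho> sign_seqs_abs[OF a, of "n + 1 + j"] by (simp add: abs_mult)
        then show ?thesis by linarith
      next
        case False
        then have "0 \<le> a (n + 1 + j) * inner v (X (n + 1 + j))" unfolding w asq[OF False] by (intro nonneg) simp
        moreover have "0 \<le> \<rho> ^ (j + 1)" using \<rho> by simp
        ultimately show ?thesis by linarith
      qed
      obtain j0 where j0: "j0 < L" "\<And>j. j < L \<Longrightarrow> L dvd n + 1 + j \<Longrightarrow> j = j0"
        using next_multiple[OF L0] by blast
      have "mismatch_cost a (\<lambda>k. inner v (X k)) n \<le> \<rho> + (\<Sum>j. \<rho> ^ (j + T + 1))"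
      proof (rule mismatch_cost_le[OF summable_inner_right[OF sm] a geometric_shift_suminf(1), where l = j0])
        show "max 0 (- (a (n + 1 + j) * inner v (X (n + 1 + j)))) \<le> \<rho> ^ (j + 1)" for j
          using bd[of j] \<rho> by simp
        show "0 \<le> a (n + 1 + j) * inner v (X (n + 1 + j))" if "j < T" "j \<noteq> j0" for j
        proof -
          have "j < L" using that(1) by (simp add: T_def)
          then have "\<not> L dvd n + 1 + j" using j0(2)[of j] that(2) by blast
          from as[OF this] show ?thesis unfolding w by (simp only:) (intro nonneg, simp)
        qed
        have "\<rho> ^ (j0 + 1) \<le> \<rho>" using \<rho> by (simp add: power_le_one mult_left_le)
        then show "- (a (n + 1 + j0) * inner v (X (n + 1 + j0))) \<le> \<rho>" using bd[of j0] by linarith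
      qed (use \<rho> in auto)
      moreover have "a n * inner v (X n) = 1"
        using v(2)[of 0] s_mult[OF keep(1)] unfolding keep(2) by simp
      moreover have "\<rho> + (\<Sum>j. \<rho> ^ (j + T + 1)) \<le> 1 - c0"
        using tail2 c00(4) by (simp add: field_simps)
      ultimately have "c0 \<le> a n * inner v (X n) - mismatch_cost a (\<lambda>k. inner v (X k)) n"
        by simp
      then show ?thesis using v(1) by blast
    next
      \<comment> \<open>A deviation from the base sign puts n at a multiple of L, so the next free
        sign lies L steps ahead, where only the tail of \<open>g\<close> is left.\<close>
      case flip
      then obtain v where v: "r ^ n * norm v \<le> C" "s n * inner v (X n) \<le> - c"
        "\<And>j. 0 \<le> s (n + 1 + j) * inner v (X (n + 1 + j))"
        "\<And>j. q dvd n + 1 + j \<Longrightarrow> \<bar>inner v (X (n + 1 + j))\<bar> \<le> g j"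
        using witness[of n] unfolding s_def by blast
      have "a n \<noteq> s n" using flip(2) sign_seqs_cases[OF s, of n] by auto
      then have Ln: "L dvd n" using as by blast
      have "mismatch_cost a (\<lambda>k. inner v (X k)) n \<le> 0 + (\<Sum>j. g (j + T))"
      proof (rule mismatch_cost_le[OF summable_inner_right[OF sm] a sg, where l = T])
        show "max 0 (- (a (n + 1 + j) * inner v (X (n + 1 + j)))) \<le> g j" for j
        proof (cases "L dvd n + 1 + j")
          case True
          then have "\<bar>a (n + 1 + j) * inner v (X (n + 1 + j))\<bar> \<le> g j"
            using v(4)[of j] qL dvd_trans by (auto simp: abs_mult sign_seqs_abs[OF a])
          then show ?thesis using g0[of j] by linarith
        next
          case False
          then show ?thesis using v(3)[of j] g0[of j] as[OF False] by simp
        qed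
        show "0 \<le> a (n + 1 + j) * inner v (X (n + 1 + j))" if "j < T" for j
        proof -
          have "\<not> L dvd j + 1" using that by (intro nat_dvd_not_less) (auto simp: T_def)
          then have "\<not> L dvd n + 1 + j" using Ln dvd_add_right_iff[OF Ln, of "j + 1"] by (simp add: add_ac)
          then show ?thesis using as v(3) by simp
        qed
      qed auto
      moreover have "c \<le> a n * inner v (X n)" using v(2) flip(2) by simp
      ultimately have "c0 \<le> a n * inner v (X n) - mismatch_cost a (\<lambda>k. inner v (X k)) n"
        using tail1 c00(2) by linarith
      then show ?thesis using v(1) unfolding C'_def by (metis max.coboundedI1)
    qed
  qed
qed

lemma rational_angle:
  assumes "Arg \<kappa> / pi \<in> \<rat>"
  obtains p :: int and q :: nat where "coprime p (int q)" "0 < q" "\<kappa> = rcis (cmod \<kappa>) (pi * p / q)"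
proof -
  obtain p b :: int where pb: "Arg \<kappa> / pi = p / b" "b > 0" "coprime p b"
    using Rats_cases'[OF assms] by metis
  have "Arg \<kappa> = pi * p / real (nat b)" using pb by (simp add: field_simps)
  then have "\<kappa> = rcis (cmod \<kappa>) (pi * p / real (nat b))" by (metis rcis_cmod_Arg)
  then show ?thesis using that[of p "nat b"] pb by simp
qed

text \<open>Subtracting the component of the smaller eigenvalue reverses the sign at n, where it has
  size 1 against \<delta>. It decays faster: at the next multiple of q, at least q steps later, it
  is at most \<delta> times the modulus of the larger component. This dictates \<delta> = (r /
  \<rho>)^q.\<close>

lemma hausdorff_dim_pos_distinct_moduli:
  fixes X :: "nat \<Rightarrow> 'a::{banach,real_inner}" and \<kappa>\<^sub>1 \<kappa>\<^sub>2 :: complex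
  assumes sm: "summable (\<lambda>k. norm (X k))"
    and re1: "realizes X (\<lambda>k. \<kappa>\<^sub>1 ^ k) B1" and re2: "realizes X (\<lambda>k. \<kappa>\<^sub>2 ^ k) B2"
    and \<kappa>: "0 < cmod \<kappa>\<^sub>2" "cmod \<kappa>\<^sub>2 < cmod \<kappa>\<^sub>1" "cmod \<kappa>\<^sub>1 < 1" and rat: "Arg \<kappa>\<^sub>1 / pi \<in> \<rat>"
  shows "0 < hausdorff_dim (unique_sums X)"
proof -
  define \<rho> r where "\<rho> = cmod \<kappa>\<^sub>1" and "r = cmod \<kappa>\<^sub>2"
  have \<rho>: "0 < \<rho>" "\<rho> < 1" and r: "0 < r" "r < \<rho>" using \<kappa> by (auto simp: \<rho>_def r_def)
  obtain p :: int and q :: nat where cop: "coprime p (int q)" and q0: "0 < q" and \<kappa>1: "\<kappa>\<^sub>1 = rcis \<rho> (pi * p / q)"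
    using rational_angle[OF rat] unfolding \<rho>_def by blast
  obtain \<sigma> where \<sigma>: "0 < \<sigma>" "\<And>m. \<not> q dvd m \<Longrightarrow> \<sigma> \<le> \<bar>sin (real m * (pi * p / q))\<bar>"
    using sin_frac_lower_bound[OF cop q0] by blast
  \<comment> \<open>The factor 2 lets the sine outweigh both the cosine and the second eigenvalue
    off the multiples of q.\<close>
  define K where "K = 2 / \<sigma>"
  have K: "0 < K" "\<And>m. \<not> q dvd m \<Longrightarrow> 2 \<le> K * \<bar>sin (real m * (pi * p / q))\<bar>"
    using \<sigma> by (auto simp: K_def field_simps)
  define \<delta> where "\<delta> = (r / \<rho>) ^ q"
  have \<delta>: "0 < \<delta>" "\<delta> < 1" using r \<rho> q0 by (auto simp: \<delta>_def power_less_one_iff)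
  let ?s = "frac_base p q"
  have s1: "\<bar>?s m\<bar> = 1" for m using sign_seqs_abs[OF frac_base_sign_seqs[OF cop q0]] by blast
  show ?thesis
  proof (rule hausdorff_dim_pos_rational[OF sm re1[unfolded \<kappa>1] \<rho> cop q0 r(1) less_imp_le[OF r(2)],
        where c = "1 - \<delta>" and g = "\<lambda>j. 2 * \<rho> ^ (j + 1)" and C = "B1 * (1 + K) + B2"])
    show "0 < 1 - \<delta>" using \<delta> by simp
    show "summable (\<lambda>j. 2 * \<rho> ^ (j + 1))" by (intro summable_mult geometric_shift_suminf) (use \<rho> in auto)
    show "0 \<le> 2 * \<rho> ^ (j + 1)" for j using \<rho> by simp
    fix n assume n: "q dvd n"
    let ?c = "Complex (\<delta> / \<rho> ^ n) (- (K / \<rho> ^ n))" and ?d = "- of_real (?s n) / \<kappa>\<^sub>2 ^ n"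
    obtain v where v: "norm v \<le> B1 * cmod ?c + B2 * cmod ?d" "\<And>k. inner v (X k) = Re (?c * \<kappa>\<^sub>1 ^ k) + Re (?d * \<kappa>\<^sub>2 ^ k)"
      using realizes2E[OF re1 re2] by blast
    have w: "inner v (X (n + k)) = \<rho> ^ k * (\<delta> * cos (real (n + k) * (pi * p / q)) + K * sin (real (n + k) * (pi * p / q)))
        - ?s n * Re (\<kappa>\<^sub>2 ^ k)" for k
    proof -
      have "?d * \<kappa>\<^sub>2 ^ (n + k) = of_real (- ?s n) * \<kappa>\<^sub>2 ^ k" using \<kappa>(1) by (simp add: power_add)
      then have "Re (?d * \<kappa>\<^sub>2 ^ (n + k)) = - ?s n * Re (\<kappa>\<^sub>2 ^ k)" by simp
      then show ?thesis unfolding v(2) \<kappa>1 Re_Complex_rcis_power[OF \<rho>(1)] by simp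
    qed
    have "cmod ?c \<le> \<bar>\<delta> / \<rho> ^ n\<bar> + \<bar>K / \<rho> ^ n\<bar>" using cmod_le[of ?c] by simp
    also have "\<dots> \<le> (1 + K) / \<rho> ^ n" using \<delta> \<rho> K(1) by (auto simp: add_divide_distrib intro!: divide_right_mono)
    finally have "B1 * cmod ?c \<le> B1 * ((1 + K) / \<rho> ^ n)" using realizes_nonneg[OF re1] by (intro mult_left_mono)
    moreover have "cmod ?d = 1 / r ^ n" using s1[of n] by (simp add: norm_divide norm_power r_def)
    ultimately have "norm v \<le> B1 * ((1 + K) / \<rho> ^ n) + B2 / r ^ n" using v(1) by simp
    then have "r ^ n * norm v \<le> r ^ n * (B1 * ((1 + K) / \<rho> ^ n) + B2 / r ^ n)" using r by (intro mult_left_mono) auto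
    also have "\<dots> = B1 * (1 + K) * (r ^ n / \<rho> ^ n) + B2" using r by (simp add: algebra_simps)
    also have "\<dots> \<le> B1 * (1 + K) * 1 + B2"
    proof -
      have "r ^ n / \<rho> ^ n \<le> 1" using r \<rho> by (simp add: power_mono)
      then show ?thesis using realizes_nonneg[OF re1] K(1) by (intro add_right_mono mult_left_mono) auto
    qed
    finally have "r ^ n * norm v \<le> B1 * (1 + K) + B2" by simp
    moreover have "?s n * inner v (X n) \<le> - (1 - \<delta>)"
    proof -
      have "inner v (X n) = \<delta> * cos (real n * (pi * p / q)) - ?s n"
        using w[of 0] frac_base_multiple(1)[OF q0 n, of p] by simp
      then have "?s n * inner v (X n) = \<delta> * (?s n * cos (real n * (pi * p / q))) - ?s n * ?s n"
        by (simp only: right_diff_distrib mult.left_commute)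
      also have "?s n * ?s n = 1" using s1[of n] by (metis abs_mult_self_eq mult_1)
      finally show ?thesis using frac_base_multiple(3)[OF q0 n, of p] by simp
    qed
    moreover have "0 \<le> ?s (n + 1 + j) * inner v (X (n + 1 + j)) \<and>
      (q dvd n + 1 + j \<longrightarrow> \<bar>inner v (X (n + 1 + j))\<bar> \<le> 2 * \<rho> ^ (j + 1))" for j
    proof -
      define m where "m = n + (j + 1)"
      let ?x = "real m * (pi * p / q)"
      have wm: "inner v (X m) = \<rho> ^ (j + 1) * (\<delta> * cos ?x + K * sin ?x) - ?s n * Re (\<kappa>\<^sub>2 ^ (j + 1))"
        unfolding m_def by (rule w)
      have sRe: "\<bar>?s n * Re (\<kappa>\<^sub>2 ^ (j + 1))\<bar> \<le> r ^ (j + 1)"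
        unfolding abs_mult s1 using abs_Re_le_cmod[of "\<kappa>\<^sub>2 ^ (j + 1)"] by (simp add: norm_power r_def norm_mult)
      then have ssRe: "\<bar>?s m * (?s n * Re (\<kappa>\<^sub>2 ^ (j + 1)))\<bar> \<le> r ^ (j + 1)" using s1[of m] by (simp add: abs_mult)
      have rr: "r ^ (j + 1) \<le> \<rho> ^ (j + 1)" using r by (intro power_mono) auto
      have sw: "?s m * inner v (X m) = \<rho> ^ (j + 1) * (\<delta> * (?s m * cos ?x) + K * (?s m * sin ?x)) - ?s m * (?s n * Re (\<kappa>\<^sub>2 ^ (j + 1)))"
        unfolding wm by (simp add: algebra_simps)
      have "0 \<le> ?s m * inner v (X m) \<and> (q dvd m \<longrightarrow> \<bar>inner v (X m)\<bar> \<le> 2 * \<rho> ^ (j + 1))"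
      proof (cases "q dvd m")
        case True
        then have "q dvd j + 1" using dvd_add_right_iff[OF n] unfolding m_def by blast
        then have "q \<le> j + 1" by (rule dvd_imp_le) simp
        then have "(r / \<rho>) ^ (j + 1) \<le> \<delta>" unfolding \<delta>_def using r \<rho> by (intro power_decreasing) auto
        then have rd: "r ^ (j + 1) \<le> \<rho> ^ (j + 1) * \<delta>" using \<rho> by (simp add: power_divide divide_le_eq mult.commute)
        have "?s m * inner v (X m) = \<rho> ^ (j + 1) * \<delta> - ?s m * (?s n * Re (\<kappa>\<^sub>2 ^ (j + 1)))"
          unfolding sw using frac_base_multiple[OF q0 True, of p] by simp
        then have "0 \<le> ?s m * inner v (X m)" using rd ssRe by linarith
        moreover have "\<bar>cos ?x\<bar> = 1" using frac_angle_multiple(2)[OF q0 True] .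
        then have "\<bar>\<rho> ^ (j + 1) * (\<delta> * cos ?x)\<bar> \<le> \<rho> ^ (j + 1)"
          using \<delta> \<rho> by (simp add: abs_mult mult_left_le)
        then have "\<bar>inner v (X m)\<bar> \<le> 2 * \<rho> ^ (j + 1)"
          unfolding wm using frac_base_multiple(1)[OF q0 True, of p] sRe rr by auto
        ultimately show ?thesis by simp
      next
        case False
        have "\<bar>\<delta> * (?s m * cos ?x)\<bar> \<le> 1" using \<delta> s1[of m] by (simp add: abs_mult mult_le_one)
        then have "1 \<le> \<delta> * (?s m * cos ?x) + K * (?s m * sin ?x)"
          unfolding frac_base_nonmultiple[OF False] using K(2)[OF False] by linarith
        then have "\<rho> ^ (j + 1) * 1 \<le> \<rho> ^ (j + 1) * (\<delta> * (?s m * cos ?x) + K * (?s m * sin ?x))"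
          using \<rho> by (intro mult_left_mono) auto
        then show ?thesis unfolding sw using ssRe rr False by linarith
      qed
      then show ?thesis by (simp add: m_def add_ac)
    qed
    ultimately show "\<exists>v. r ^ n * norm v \<le> B1 * (1 + K) + B2 \<and> ?s n * inner v (X n) \<le> - (1 - \<delta>) \<and>
      (\<forall>j. 0 \<le> ?s (n + 1 + j) * inner v (X (n + 1 + j))) \<and>
      (\<forall>j. q dvd n + 1 + j \<longrightarrow> \<bar>inner v (X (n + 1 + j))\<bar> \<le> 2 * \<rho> ^ (j + 1))" by blast
  qed
qed

text \<open>The functional with values \<rho>^k ((k - 1/2) cos + K k sin) at n + k opposes the base
  sign at k = 0 and agrees with it for k \<ge> 1, because the linear factor of the cosine changes
  sign between 0 and 1.\<close>

lemma hausdorff_dim_pos_jordan: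
  fixes X :: "nat \<Rightarrow> 'a::{banach,real_inner}" and \<kappa> :: complex
  assumes sm: "summable (\<lambda>k. norm (X k))"
    and re1: "realizes X (\<lambda>k. \<kappa> ^ k) B1" and re2: "realizes X (\<lambda>k. of_nat k * \<kappa> ^ k) B2"
    and \<kappa>: "\<kappa> \<noteq> 0" "cmod \<kappa> < 1" and rat: "Arg \<kappa> / pi \<in> \<rat>"
  shows "0 < hausdorff_dim (unique_sums X)"
proof -
  define \<rho> where "\<rho> = cmod \<kappa>"
  have \<rho>: "0 < \<rho>" "\<rho> < 1" using \<kappa> by (auto simp: \<rho>_def)
  obtain p :: int and q :: nat where cop: "coprime p (int q)" and q0: "0 < q" and \<kappa>1: "\<kappa> = rcis \<rho> (pi * p / q)"
    using rational_angle[OF rat] unfolding \<rho>_def by blast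
  obtain \<sigma> where \<sigma>: "0 < \<sigma>" "\<And>m. \<not> q dvd m \<Longrightarrow> \<sigma> \<le> \<bar>sin (real m * (pi * p / q))\<bar>"
    using sin_frac_lower_bound[OF cop q0] by blast
  define K where "K = 1 / \<sigma>"
  have K: "0 < K" "\<And>m. \<not> q dvd m \<Longrightarrow> 1 \<le> K * \<bar>sin (real m * (pi * p / q))\<bar>"
    using \<sigma> by (auto simp: K_def field_simps)
  let ?s = "frac_base p q"
  have s1: "\<bar>?s m\<bar> = 1" for m using sign_seqs_abs[OF frac_base_sign_seqs[OF cop q0]] by blast
  have sg: "summable (\<lambda>j. real (j + 1) * \<rho> ^ (j + 1))"
  proof -
    have "summable (\<lambda>n. diffs (\<lambda>_. 1) n * \<rho> ^ n)"
      by (rule termdiff_converges[of _ 1]) (use \<rho> in \<open>auto intro: summable_geometric\<close>)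
    then have "summable (\<lambda>n. \<rho> * (diffs (\<lambda>_. 1) n * \<rho> ^ n))" by (rule summable_mult)
    then show ?thesis by (simp add: diffs_def mult_ac)
  qed
  have B: "0 \<le> B1" "0 \<le> B2" using re1 re2 by (auto intro: realizes_nonneg)
  show ?thesis
  \<comment> \<open>The coefficients grow like n / \<rho>^n; the smaller rate \<rho> / 2 absorbs the
    polynomial factor by n + 1 \<le> 2^n.\<close>
  proof (rule hausdorff_dim_pos_rational[OF sm re1[unfolded \<kappa>1] \<rho> cop q0, where r = "\<rho> / 2"
        and c = "1 / 2" and g = "\<lambda>j. real (j + 1) * \<rho> ^ (j + 1)" and C = "(B2 + B1) * (1 + K)"])
    show "summable (\<lambda>j. real (j + 1) * \<rho> ^ (j + 1))" by (rule sg)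
    show "0 \<le> real (j + 1) * \<rho> ^ (j + 1)" for j using \<rho> by simp
    fix n assume n: "q dvd n"
    \<comment> \<open>\<open>?c\<close> acts on k \<kappa>^k and \<open>?d\<close> on \<kappa>^k;
      the correction moves the zero of the linear factor to n + 1/2 for the cosine and to n for the
      sine. The double sign in \<open>?d\<close> matches the shape of
      \<open>Re_Complex_rcis_power\<close>.\<close>
    let ?c = "Complex (1 / \<rho> ^ n) (- (K / \<rho> ^ n))" and ?d = "Complex (- (n + 1/2) / \<rho> ^ n) (- (- (K * n) / \<rho> ^ n))"
    obtain v where v: "norm v \<le> B2 * cmod ?c + B1 * cmod ?d"
        "\<And>k. inner v (X k) = Re (?c * (of_nat k * \<kappa> ^ k)) + Re (?d * \<kappa> ^ k)"
      using realizes2E[OF re2 re1] by blast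
    have w: "inner v (X (n + k)) = \<rho> ^ k * ((k - 1/2) * cos (real (n + k) * (pi * p / q)) + K * k * sin (real (n + k) * (pi * p / q)))" for k
    proof -
      have "?c * (of_nat (n + k) * \<kappa> ^ (n + k)) = of_real (real (n + k)) * (?c * \<kappa> ^ (n + k))" by simp
      then have "Re (?c * (of_nat (n + k) * \<kappa> ^ (n + k))) = real (n + k) * Re (?c * \<kappa> ^ (n + k))"
        by (simp only: Re_complex_of_real Im_complex_of_real times_complex.sel)
      then show ?thesis unfolding v(2) \<kappa>1 Re_Complex_rcis_power[OF \<rho>(1)] by (simp add: algebra_simps)
    qed
    have "cmod ?c \<le> \<bar>1 / \<rho> ^ n\<bar> + \<bar>K / \<rho> ^ n\<bar>" using cmod_le[of ?c] by simp
    also have "\<dots> = (1 + K) / \<rho> ^ n" using \<rho> K(1) by (auto simp: add_divide_distrib)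
    finally have c1: "B2 * cmod ?c \<le> B2 * ((1 + K) / \<rho> ^ n)" using B by (intro mult_left_mono)
    have "cmod ?d \<le> \<bar>(n + 1/2) / \<rho> ^ n\<bar> + \<bar>K * n / \<rho> ^ n\<bar>"
      using cmod_le[of ?d] by (simp add: add.commute)
    also have "\<dots> = (n + 1/2 + K * n) / \<rho> ^ n" using \<rho> K(1) by (simp add: add_divide_distrib)
    also have "\<dots> \<le> ((n + 1) * (1 + K)) / \<rho> ^ n"
      using \<rho> K(1) by (intro divide_right_mono) (auto simp: algebra_simps)
    finally have "B1 * cmod ?d \<le> B1 * (((n + 1) * (1 + K)) / \<rho> ^ n)" using B by (intro mult_left_mono)
    with c1 v(1) have nv: "norm v \<le> B2 * ((1 + K) / \<rho> ^ n) + B1 * (((n + 1) * (1 + K)) / \<rho> ^ n)" by linarith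
    have "n + 1 \<le> 2 ^ n" using less_exp[of n] by (simp add: Suc_leI)
    then have n2: "real (n + 1) \<le> 2 ^ n" by (metis of_nat_le_iff of_nat_numeral of_nat_power)
    have "(\<rho> / 2) ^ n * norm v \<le> (\<rho> / 2) ^ n * (B2 * ((1 + K) / \<rho> ^ n) + B1 * (((n + 1) * (1 + K)) / \<rho> ^ n))"
      using nv \<rho> by (intro mult_left_mono) auto
    also have "\<dots> = (B2 * (1 + K) + B1 * ((n + 1) * (1 + K))) / 2 ^ n"
      using \<rho> by (simp add: power_divide field_simps)
    also have "\<dots> \<le> (B2 * (1 + K) * 2 ^ n + B1 * (2 ^ n * (1 + K))) / 2 ^ n"
    proof (intro divide_right_mono add_mono mult_left_mono mult_right_mono)
      show "B2 * (1 + K) \<le> B2 * (1 + K) * 2 ^ n" using B K(1) mult_left_mono[of 1 "2 ^ n" "B2 * (1 + K)"] by simp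
    qed (use B K(1) n2 in auto)
    also have "\<dots> = (B2 + B1) * (1 + K)" by (simp add: field_simps)
    finally have "(\<rho> / 2) ^ n * norm v \<le> (B2 + B1) * (1 + K)" .
    moreover have "?s n * inner v (X n) \<le> - (1 / 2)"
      using w[of 0] frac_base_multiple(1,3)[OF q0 n, of p] by (simp add: algebra_simps)
    moreover have "0 \<le> ?s (n + 1 + j) * inner v (X (n + 1 + j)) \<and>
      (q dvd n + 1 + j \<longrightarrow> \<bar>inner v (X (n + 1 + j))\<bar> \<le> real (j + 1) * \<rho> ^ (j + 1))" for j
    proof -
      define m where "m = n + (j + 1)"
      let ?x = "real m * (pi * p / q)"
      have wm: "inner v (X m) = \<rho> ^ (j + 1) * ((real (j + 1) - 1/2) * cos ?x + K * real (j + 1) * sin ?x)"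
        unfolding m_def by (rule w)
      have sw: "?s m * inner v (X m) = \<rho> ^ (j + 1) * ((real (j + 1) - 1/2) * (?s m * cos ?x) + K * real (j + 1) * (?s m * sin ?x))"
        unfolding wm by (simp add: algebra_simps)
      have "0 \<le> ?s m * inner v (X m) \<and> (q dvd m \<longrightarrow> \<bar>inner v (X m)\<bar> \<le> real (j + 1) * \<rho> ^ (j + 1))"
      proof (cases "q dvd m")
        case True
        have "?s m * inner v (X m) = \<rho> ^ (j + 1) * (real (j + 1) - 1/2)"
          unfolding sw using frac_base_multiple[OF q0 True, of p] by simp
        then have "0 \<le> ?s m * inner v (X m)" using \<rho> by simp
        moreover have "\<bar>cos ?x\<bar> = 1" using frac_angle_multiple(2)[OF q0 True] .
        then have "\<bar>inner v (X m)\<bar> = \<rho> ^ (j + 1) * \<bar>real (j + 1) - 1/2\<bar>"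
          unfolding wm using frac_base_multiple(1)[OF q0 True, of p] \<rho> by (simp add: abs_mult)
        then have "\<bar>inner v (X m)\<bar> \<le> \<rho> ^ (j + 1) * real (j + 1)"
          using \<rho> by (simp only:) (intro mult_left_mono, auto)
        ultimately show ?thesis by (simp add: mult.commute)
      next
        case False
        have "\<bar>?s m * cos ?x\<bar> \<le> 1" using s1[of m] by (simp add: abs_mult)
        then have 1: "(real (j + 1) - 1/2) * (- 1) \<le> (real (j + 1) - 1/2) * (?s m * cos ?x)"
          by (intro mult_left_mono) linarith+
        have 2: "real (j + 1) * 1 \<le> real (j + 1) * (K * \<bar>sin ?x\<bar>)"
          using K(2)[OF False] by (intro mult_left_mono) auto
        have "0 \<le> (real (j + 1) - 1/2) * (- 1) + real (j + 1) * 1" by simp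
        also note add_mono[OF 1 2]
        also have "real (j + 1) * (K * \<bar>sin ?x\<bar>) = K * real (j + 1) * (?s m * sin ?x)"
          unfolding frac_base_nonmultiple[OF False] by simp
        finally have "0 \<le> (real (j + 1) - 1/2) * (?s m * cos ?x) + K * real (j + 1) * (?s m * sin ?x)" .
        then show ?thesis unfolding sw using \<rho> False by simp
      qed
      then show ?thesis by (simp add: m_def add_ac)
    qed
    ultimately show "\<exists>v. (\<rho> / 2) ^ n * norm v \<le> (B2 + B1) * (1 + K) \<and> ?s n * inner v (X n) \<le> - (1 / 2) \<and>
      (\<forall>j. 0 \<le> ?s (n + 1 + j) * inner v (X (n + 1 + j))) \<and>
      (\<forall>j. q dvd n + 1 + j \<longrightarrow> \<bar>inner v (X (n + 1 + j))\<bar> \<le> real (j + 1) * \<rho> ^ (j + 1))" by blast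
  qed (use \<rho> in auto)
qed

section \<open>Functionals from eigenvalues and Jordan blocks\<close>


definition cvec :: "real^'n \<Rightarrow> complex Matrix.vec" where
  "cvec x = Matrix.vec CARD('n) (\<lambda>i. complex_of_real (vec_nth x (index_enum i)))"

lemma dim_cvec: "cvec (x :: real^'n) \<in> carrier_vec CARD('n)"
  by (simp add: cvec_def)

lemma complex_mat_carrier: "complex_mat (M :: real^'n^'n) \<in> carrier_mat CARD('n) CARD('n)"
  by (simp add: complex_mat_def)

lemma sum_index_enum:
  "(\<Sum>j\<in>{0..<CARD('n)}. f (index_enum j)) = (\<Sum>j\<in>(UNIV :: 'n::finite set). f j)"
  by (rule sum.reindex_bij_betw[OF bij_betw_index_enum])

lemma complex_mat_mult_cvec:
  fixes M :: "real^'n^'n"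
  shows "complex_mat M *\<^sub>v cvec x = cvec (M *v x)"
proof (rule eq_vecI)
  fix i assume "i < dim_vec (cvec (M *v x))"
  then have i: "i < CARD('n)" by (simp add: cvec_def)
  have "vec_index (complex_mat M *\<^sub>v cvec x) i
      = (\<Sum>j\<in>{0..<CARD('n)}. complex_of_real (vec_nth (vec_nth M (index_enum i)) (index_enum j) * vec_nth x (index_enum j)))"
    using i by (simp add: complex_mat_def cvec_def scalar_prod_def)
  also have "\<dots> = (\<Sum>j\<in>UNIV. complex_of_real (vec_nth (vec_nth M (index_enum i)) j * vec_nth x j))"
    by (rule sum_index_enum)
  finally show "vec_index (complex_mat M *\<^sub>v cvec x) i = vec_index (cvec (M *v x)) i"
    using i by (simp add: cvec_def matrix_vector_mult_def)
qed (simp add: cvec_def complex_mat_def)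

definition orbit :: "real^'n^'n \<Rightarrow> real^'n \<Rightarrow> nat \<Rightarrow> real^'n" where
  "orbit M u k = ((\<lambda>v. M *v v) ^^ k) u"

lemma orbit_0: "orbit M u 0 = u" and orbit_Suc: "orbit M u (Suc k) = M *v orbit M u k"
  by (simp_all add: orbit_def)

lemma uniqueness_set_eq: "uniqueness_set M u = unique_sums (orbit M u)"
  by (auto simp: uniqueness_set_def unique_sums_def attractor_def address_map_def signed_sum_def orbit_def)

definition row_value :: "complex Matrix.vec \<Rightarrow> real^'n \<Rightarrow> complex" where
  "row_value r x = scalar_prod r (cvec x)"

lemma row_value_sum:
  fixes x :: "real^'n"
  shows "row_value r x = (\<Sum>i\<in>{0..<CARD('n)}. vec_index r i * complex_of_real (vec_nth x (index_enum i)))"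
  by (simp add: row_value_def scalar_prod_def cvec_def)

lemma realizes_row:
  fixes X :: "nat \<Rightarrow> real^'n"
  shows "\<exists>B. realizes X (\<lambda>k. row_value r (X k)) B"
proof -
  define B where "B = (\<Sum>i\<in>{0..<CARD('n)}. cmod (vec_index r i))"
  define idx :: "'n \<Rightarrow> nat" where "idx = the_inv_into {0..<CARD('n)} index_enum"
  have idx: "idx (index_enum i) = i" if "i \<in> {0..<CARD('n)}" for i
    unfolding idx_def using bij_betw_index_enum that by (intro the_inv_into_f_f) (auto simp: bij_betw_def)
  have "realizes X (\<lambda>k. row_value r (X k)) B"
    unfolding realizes_def
  proof (intro conjI allI)
    show "0 \<le> B" by (simp add: B_def sum_nonneg)
    fix c
    define v :: "real^'n" where "v = (\<chi> j. Re (c * vec_index r (idx j)))"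
    have "norm v \<le> (\<Sum>j\<in>UNIV. \<bar>vec_nth v j\<bar>)" by (rule norm_le_l1_cart)
    also have "\<dots> = (\<Sum>i\<in>{0..<CARD('n)}. \<bar>vec_nth v (index_enum i)\<bar>)" by (rule sum_index_enum[symmetric])
    also have "\<dots> \<le> (\<Sum>i\<in>{0..<CARD('n)}. cmod (vec_index r i) * cmod c)"
    proof (rule sum_mono)
      fix i assume "i \<in> {0..<CARD('n)}"
      then show "\<bar>vec_nth v (index_enum i)\<bar> \<le> cmod (vec_index r i) * cmod c"
        using abs_Re_le_cmod[of "c * vec_index r i"] idx[of i] by (simp add: v_def norm_mult mult.commute)
    qed
    also have "\<dots> = B * cmod c" by (simp add: B_def sum_distrib_right)
    finally have "norm v \<le> B * cmod c" .
    moreover have "inner v (X k) = Re (c * row_value r (X k))" for k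
    proof -
      have "inner v (X k) = (\<Sum>j\<in>UNIV. vec_nth v j * vec_nth (X k) j)" by (simp add: inner_vec_def)
      also have "\<dots> = (\<Sum>i\<in>{0..<CARD('n)}. vec_nth v (index_enum i) * vec_nth (X k) (index_enum i))"
        by (rule sum_index_enum[symmetric])
      also have "\<dots> = (\<Sum>i\<in>{0..<CARD('n)}. Re (c * (vec_index r i * complex_of_real (vec_nth (X k) (index_enum i)))))"
        by (rule sum.cong) (auto simp: v_def idx algebra_simps)
      finally show ?thesis by (simp add: row_value_sum sum_distrib_left)
    qed
    ultimately show "\<exists>v. norm v \<le> B * cmod c \<and> (\<forall>k. inner v (X k) = Re (c * row_value r (X k)))" by blast
  qed
  then show ?thesis by blast
qed

lemma realizes_combination:
  assumes "realizes X f B" "realizes X g D"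
  shows "realizes X (\<lambda>k. \<alpha> * f k + \<beta> * g k) (B * cmod \<alpha> + D * cmod \<beta>)"
  unfolding realizes_def
proof (intro conjI allI)
  show "0 \<le> B * cmod \<alpha> + D * cmod \<beta>" using assms by (auto dest!: realizes_nonneg)
  fix c
  obtain v where "norm v \<le> B * cmod (c * \<alpha>) + D * cmod (c * \<beta>)"
    "\<And>k. inner v (X k) = Re (c * \<alpha> * f k) + Re (c * \<beta> * g k)"
    using realizes2E[OF assms] by metis
  then show "\<exists>v. norm v \<le> (B * cmod \<alpha> + D * cmod \<beta>) * cmod c \<and> (\<forall>k. inner v (X k) = Re (c * (\<alpha> * f k + \<beta> * g k)))"
    by (intro exI[of _ v]) (simp add: norm_mult algebra_simps)
qed

text \<open>A row that vanishes along the orbit vanishes on its span, which is the whole space. In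
  this way cyclicity makes each eigenvalue visible on the orbit.\<close>

lemma row_value_cyclic:
  fixes M :: "real^'n^'n"
  assumes cyc: "cyclic_vector M u" and r: "r \<in> carrier_vec CARD('n)" "r \<noteq> 0\<^sub>v CARD('n)"
  shows "\<exists>k. row_value r (orbit M u k) \<noteq> 0"
proof (rule ccontr)
  assume "\<not> (\<exists>k. row_value r (orbit M u k) \<noteq> 0)"
  then have "range (orbit M u) \<subseteq> {x. row_value r x = 0}" by auto
  moreover have "Real_Vector_Spaces.subspace {x :: real^'n. row_value r x = 0}"
    by (auto simp: real_vector.subspace_def row_value_sum algebra_simps sum.distrib simp flip: sum_distrib_left)
  ultimately have "Real_Vector_Spaces.span (range (orbit M u)) \<subseteq> {x. row_value r x = 0}"
    by (rule real_vector.span_minimal)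
  then have zero: "row_value r x = 0" for x :: "real^'n"
    using cyc unfolding cyclic_vector_def orbit_def[abs_def] by auto
  have "vec_index r i = 0" if i: "i < CARD('n)" for i
  proof -
    have inj: "index_enum j = (index_enum i :: 'n) \<longleftrightarrow> j = i" if "j < CARD('n)" for j
      using bij_betw_index_enum[where 'n = 'n] that i by (auto simp: bij_betw_def inj_on_def)
    have "row_value r (axis (index_enum i) 1 :: real^'n) = (\<Sum>j\<in>{0..<CARD('n)}. if j = i then vec_index r i else 0)"
      unfolding row_value_sum by (rule sum.cong) (auto simp: axis_def inj)
    then show ?thesis using zero[of "axis (index_enum i) 1"] i by simp
  qed
  then show False using r by (metis carrier_vecD eq_vecI index_zero_vec(1,2))
qed

text \<open>A left eigenvector evaluates the orbit to a constant times \<kappa>^k. The constant is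
  nonzero by cyclicity and can be divided out.\<close>

lemma realizes_eigenvalue:
  fixes M :: "real^'n^'n"
  assumes cyc: "cyclic_vector M u" and \<kappa>: "\<kappa> \<in> spectrum (complex_mat M)"
  shows "\<exists>B. realizes (orbit M u) (\<lambda>k. \<kappa> ^ k) B"
proof -
  let ?A = "complex_mat M"
  have A: "?A \<in> carrier_mat CARD('n) CARD('n)" by (rule complex_mat_carrier)
  then have AT: "transpose_mat ?A \<in> carrier_mat CARD('n) CARD('n)" by simp
  have "eigenvalue (transpose_mat ?A) \<kappa>"
    using \<kappa> unfolding spectrum_def eigenvalue_root_char_poly[OF AT] char_poly_transpose_mat[OF A]
    by (simp add: eigenvalue_root_char_poly[OF A])
  then obtain r where r: "r \<in> carrier_vec CARD('n)" "r \<noteq> 0\<^sub>v CARD('n)" "transpose_mat ?A *\<^sub>v r = \<kappa> \<cdot>\<^sub>v r"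
    using A by (auto simp: eigenvalue_def eigenvector_def)
  have step: "row_value r (M *v x) = \<kappa> * row_value r x" for x
  proof -
    have "row_value r (M *v x) = scalar_prod r (?A *\<^sub>v cvec x)" by (simp add: row_value_def complex_mat_mult_cvec)
    also have "\<dots> = scalar_prod (transpose_mat ?A *\<^sub>v r) (cvec x)"
      by (rule transpose_vec_mult_scalar[OF A dim_cvec r(1), symmetric])
    also have "\<dots> = \<kappa> * row_value r x" unfolding r(3) row_value_def
      by (rule smult_scalar_prod_distrib[OF r(1) dim_cvec])
    finally show ?thesis .
  qed
  have pow: "row_value r (orbit M u k) = \<kappa> ^ k * row_value r u" for k
    by (induction k) (simp_all add: orbit_0 orbit_Suc step)
  have nz: "row_value r u \<noteq> 0" using row_value_cyclic[OF cyc r(1,2)] pow by auto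
  obtain B where B: "realizes (orbit M u) (\<lambda>k. row_value r (orbit M u k)) B" using realizes_row by blast
  have "(\<lambda>k. (1 / row_value r u) * row_value r (orbit M u k) + 0 * row_value r (orbit M u k)) = (\<lambda>k. \<kappa> ^ k)"
    using nz by (simp add: pow)
  then show ?thesis using realizes_combination[OF B B, of "1 / row_value r u" 0] by (metis (no_types, lifting))
qed

lemma bounded_orbit:
  fixes M :: "real^'n^'n"
  assumes "\<forall>\<kappa>\<in>spectrum (complex_mat M). cmod \<kappa> < 1"
  shows "\<exists>C. \<forall>k. norm (orbit M u k) \<le> C"
proof -
  let ?A = "complex_mat M"
  have A: "?A \<in> carrier_mat CARD('n) CARD('n)" by (rule complex_mat_carrier)
  have "spectral_radius ?A \<in> norm ` spectrum ?A" by (rule spectral_radius_mem_max(1)[OF A]) simp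
  then have "spectral_radius ?A < 1" using assms by auto
  from spectral_radius_jnf_norm_bound_less_1_upper_triangular[OF A this]
  obtain c where c: "\<And>k. norm_bound (?A ^\<^sub>m k) c" by blast
  have pow: "?A ^\<^sub>m k *\<^sub>v cvec u = cvec (orbit M u k)" for k
  proof (induction k)
    case 0
    then show ?case using A dim_cvec[of u] by (simp add: orbit_0 complex_mat_def)
  next
    case (Suc k)
    have Ak: "?A ^\<^sub>m k \<in> carrier_mat CARD('n) CARD('n)" using A by simp
    have comm: "?A ^\<^sub>m Suc k = ?A * ?A ^\<^sub>m k"
      by (induction k) (use A in \<open>simp_all add: assoc_mult_mat[of _ "CARD('n)" "CARD('n)" _ "CARD('n)" _ "CARD('n)"]\<close>)
    have "?A ^\<^sub>m Suc k *\<^sub>v cvec u = ?A *\<^sub>v (?A ^\<^sub>m k *\<^sub>v cvec u)"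
      unfolding comm by (rule assoc_mult_mat_vec[OF A Ak dim_cvec])
    then show ?case by (simp add: Suc complex_mat_mult_cvec orbit_Suc)
  qed
  define C where "C = (\<Sum>i\<in>{0..<CARD('n)}. \<Sum>j\<in>{0..<CARD('n)}. \<bar>c\<bar> * cmod (vec_index (cvec u) j))"
  have "norm (orbit M u k) \<le> C" for k
  proof -
    have Ak: "?A ^\<^sub>m k \<in> carrier_mat CARD('n) CARD('n)" using A by simp
    have "norm (orbit M u k) \<le> (\<Sum>j\<in>UNIV. \<bar>vec_nth (orbit M u k) j\<bar>)" by (rule norm_le_l1_cart)
    also have "\<dots> = (\<Sum>i\<in>{0..<CARD('n)}. \<bar>vec_nth (orbit M u k) (index_enum i)\<bar>)" by (rule sum_index_enum[symmetric])
    also have "\<dots> \<le> C" unfolding C_def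
    proof (rule sum_mono)
      fix i assume i: "i \<in> {0..<CARD('n)}"
      have "\<bar>vec_nth (orbit M u k) (index_enum i)\<bar> = cmod (vec_index (cvec (orbit M u k)) i)"
        using i by (simp add: cvec_def)
      also have "\<dots> = cmod (\<Sum>j\<in>{0..<CARD('n)}. (?A ^\<^sub>m k) $$ (i, j) * vec_index (cvec u) j)"
        unfolding pow[symmetric] using i carrier_matD[OF Ak] carrier_vecD[OF dim_cvec[of u]] by (simp add: scalar_prod_def)
      also have "\<dots> \<le> (\<Sum>j\<in>{0..<CARD('n)}. cmod ((?A ^\<^sub>m k) $$ (i, j) * vec_index (cvec u) j))" by (rule norm_sum)
      also have "\<dots> \<le> (\<Sum>j\<in>{0..<CARD('n)}. \<bar>c\<bar> * cmod (vec_index (cvec u) j))"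
      proof (rule sum_mono)
        fix j assume "j \<in> {0..<CARD('n)}"
        then have "cmod ((?A ^\<^sub>m k) $$ (i, j)) \<le> \<bar>c\<bar>"
          using c[of k, unfolded norm_bound_def, rule_format, of i j] i carrier_matD[OF Ak] by simp
        then show "cmod ((?A ^\<^sub>m k) $$ (i, j) * vec_index (cvec u) j) \<le> \<bar>c\<bar> * cmod (vec_index (cvec u) j)"
          by (simp add: norm_mult mult_right_mono)
      qed
      finally show "\<bar>vec_nth (orbit M u k) (index_enum i)\<bar> \<le> (\<Sum>j\<in>{0..<CARD('n)}. \<bar>c\<bar> * cmod (vec_index (cvec u) j))" .
    qed
    finally show ?thesis .
  qed
  then show ?thesis by blast
qed

text \<open>Dividing M by some r strictly between its spectral radius and 1 leaves it contracting,
  so the rescaled orbit is bounded and the original one decays like r^k.\<close>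

lemma summable_orbit:
  fixes M :: "real^'n^'n"
  assumes sp: "\<forall>\<kappa>\<in>spectrum (complex_mat M). cmod \<kappa> < 1"
  shows "summable (\<lambda>k. norm (orbit M u k))"
proof -
  let ?A = "complex_mat M"
  have A: "?A \<in> carrier_mat CARD('n) CARD('n)" by (rule complex_mat_carrier)
  define m where "m = spectral_radius ?A"
  have "m \<in> norm ` spectrum ?A" unfolding m_def by (rule spectral_radius_mem_max(1)[OF A]) simp
  then have m: "0 \<le> m" "m < 1" using sp by auto
  have mm: "cmod \<kappa> \<le> m" if "\<kappa> \<in> spectrum ?A" for \<kappa>
    unfolding m_def by (rule spectral_radius_mem_max(2)[OF A]) (use that in auto)
  define r where "r = (1 + m) / 2"
  have r: "m < r" "0 < r" "r < 1" using m by (simp_all add: r_def)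
  define M' where "M' = (\<chi> i j. vec_nth (vec_nth M i) j / r)"
  have A': "complex_mat M' \<in> carrier_mat CARD('n) CARD('n)" by (rule complex_mat_carrier)
  have AA: "?A = of_real r \<cdot>\<^sub>m complex_mat M'"
    using r by (intro eq_matI) (auto simp: complex_mat_def M'_def)
  have "\<forall>\<kappa>\<in>spectrum (complex_mat M'). cmod \<kappa> < 1"
  proof
    fix \<kappa> assume "\<kappa> \<in> spectrum (complex_mat M')"
    then obtain v where v: "v \<in> carrier_vec CARD('n)" "v \<noteq> 0\<^sub>v CARD('n)" "complex_mat M' *\<^sub>v v = \<kappa> \<cdot>\<^sub>v v"
      using A' by (auto simp: spectrum_def eigenvalue_def eigenvector_def)
    have "?A *\<^sub>v v = of_real r \<cdot>\<^sub>v (complex_mat M' *\<^sub>v v)"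
      unfolding AA using A' v(1) by (intro eq_vecI) (auto simp: scalar_prod_def sum_distrib_left mult.assoc)
    also have "\<dots> = (of_real r * \<kappa>) \<cdot>\<^sub>v v" by (simp add: v(3) smult_smult_assoc)
    finally have "of_real r * \<kappa> \<in> spectrum ?A"
      using v A by (auto simp: spectrum_def eigenvalue_def eigenvector_def)
    from mm[OF this] have "r * cmod \<kappa> \<le> m" using r by (simp add: norm_mult)
    then have "cmod \<kappa> \<le> m / r" using r by (simp add: field_simps)
    also have "\<dots> < 1" using r by simp
    finally show "cmod \<kappa> < 1" .
  qed
  from bounded_orbit[OF this] obtain C where C: "\<And>k. norm (orbit M' u k) \<le> C" by blast
  have Mv: "M *v x = r *\<^sub>R (M' *v x)" for x
    using r by (simp add: Finite_Cartesian_Product.vec_eq_iff matrix_vector_mult_def M'_def sum_distrib_left)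
  have "orbit M u k = r ^ k *\<^sub>R orbit M' u k" for k
    by (induction k) (simp_all add: orbit_0 orbit_Suc Mv matrix_vector_mult_scaleR)
  then have le: "norm (orbit M u k) \<le> C * r ^ k" for k
    using C[of k] r by (simp add: mult.commute mult_left_mono)
  show ?thesis
    by (rule summable_comparison_test'[OF summable_mult[OF summable_geometric[of r], of C]]) (use le r in auto)
qed

text \<open>The last two rows of a block suffice: the last one yields a geometric sequence, and the
  one above it is driven by that sequence, which produces the factor k.\<close>

lemma jordan_matrix_block_rows:
  assumes "(n, \<kappa>) \<in> set n_as" "2 \<le> n"
  shows "\<exists>i. Suc i < sum_list (map fst n_as) \<and>
    (\<forall>j < sum_list (map fst n_as). jordan_matrix n_as $$ (i, j) = (if j = i then \<kappa> else if j = Suc i then 1 else 0)) \<and>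
    (\<forall>j < sum_list (map fst n_as). jordan_matrix n_as $$ (Suc i, j) = (if j = Suc i then \<kappa> else 0))"
  using assms(1)
proof (induction n_as)
  case (Cons na n_as)
  obtain m a where na: "na = (m, a)" by (cases na)
  let ?s = "sum_list (map fst n_as)"
  have J: "jordan_matrix (na # n_as) $$ (i, j) = (if i < m then if j < m then jordan_block m a $$ (i, j) else 0
      else if j < m then 0 else jordan_matrix n_as $$ (i - m, j - m))" if "i < m + ?s" "j < m + ?s" for i j
    unfolding na jordan_matrix_Cons using that by auto
  show ?case
  proof (cases "(n, \<kappa>) = na")
    case True
    then have "m = n" "a = \<kappa>" using na by auto
    then show ?thesis using assms(2) J na
      by (intro exI[of _ "n - 2"]) auto
  next
    case False
    then obtain i where i: "Suc i < ?s" "\<And>j. j < ?s \<Longrightarrow> jordan_matrix n_as $$ (i, j) = (if j = i then \<kappa> else if j = Suc i then 1 else 0)"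
      "\<And>j. j < ?s \<Longrightarrow> jordan_matrix n_as $$ (Suc i, j) = (if j = Suc i then \<kappa> else 0)" using Cons by auto
    have "jordan_matrix (na # n_as) $$ (m + i, j) = (if j = m + i then \<kappa> else if j = Suc (m + i) then 1 else 0)"
      "jordan_matrix (na # n_as) $$ (Suc (m + i), j) = (if j = Suc (m + i) then \<kappa> else 0)" if "j < m + ?s" for j
      using J[of "m + i" j] J[of "Suc (m + i)" j] i(1) i(2,3)[of "j - m"] that by (auto simp: Suc_diff_le)
    then show ?thesis using i(1) na by (intro exI[of _ "m + i"]) simp
  qed
qed simp

lemma jordan_matrix_diagonal:
  assumes "\<And>n a. (n, a) \<in> set n_as \<Longrightarrow> n = 1"
    and "i < sum_list (map fst n_as)"
  shows "\<exists>a \<in> snd ` set n_as. \<forall>j < sum_list (map fst n_as). jordan_matrix n_as $$ (i, j) = (if j = i then a else 0)"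
  using assms
proof (induction n_as arbitrary: i)
  case (Cons na n_as)
  obtain a where na: "na = (1, a)" using Cons.prems(1) by (cases na) auto
  let ?s = "sum_list (map fst n_as)"
  have J: "jordan_matrix (na # n_as) $$ (i, j) = (if i < 1 then if j < 1 then jordan_block 1 a $$ (i, j) else 0
      else if j < 1 then 0 else jordan_matrix n_as $$ (i - 1, j - 1))" if "i < 1 + ?s" "j < 1 + ?s" for i j
    unfolding na jordan_matrix_Cons using that by auto
  show ?case
  proof (cases "i = 0")
    case True
    then show ?thesis using J na by auto
  next
    case False
    then have "i - 1 < ?s" using Cons.prems(2) na by auto
    then obtain b where b: "b \<in> snd ` set n_as" "\<And>j. j < ?s \<Longrightarrow> jordan_matrix n_as $$ (i - 1, j) = (if j = i - 1 then b else 0)"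
      using Cons.IH[of "i - 1"] Cons.prems(1) by (metis list.set_intros(2))
    have "jordan_matrix (na # n_as) $$ (i, j) = (if j = i then b else 0)" if "j < 1 + ?s" for j
      using J[of i j] b(2)[of "j - 1"] that False Cons.prems(2) na by auto
    then show ?thesis using b(1) na by (intro bexI[of _ b]) auto
  qed
qed simp

lemma jordan_coordinates:
  fixes M :: "real^'n^'n"
  assumes "jordan_nf (complex_mat M) n_as"
  obtains P Q where "sum_list (map fst n_as) = CARD('n)" "Q \<in> carrier_mat CARD('n) CARD('n)"
    "P \<in> carrier_mat CARD('n) CARD('n)" "P * Q = 1\<^sub>m CARD('n)" "Q * P = 1\<^sub>m CARD('n)"
    "\<And>i x. i < CARD('n) \<Longrightarrow> row_value (Matrix.row Q i) (M *v x) =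
      (\<Sum>j\<in>{0..<CARD('n)}. jordan_matrix n_as $$ (i, j) * row_value (Matrix.row Q j) x)"
proof -
  let ?A = "complex_mat M" and ?J = "jordan_matrix n_as"
  have A: "?A \<in> carrier_mat CARD('n) CARD('n)" by (rule complex_mat_carrier)
  from assms obtain P Q where wit: "similar_mat_wit ?A ?J P Q"
    unfolding jordan_nf_def similar_mat_def by blast
  from similar_mat_witD2[OF A wit] have w: "P * Q = 1\<^sub>m CARD('n)" "Q * P = 1\<^sub>m CARD('n)" "?A = P * ?J * Q"
    "?J \<in> carrier_mat CARD('n) CARD('n)" "P \<in> carrier_mat CARD('n) CARD('n)" "Q \<in> carrier_mat CARD('n) CARD('n)" by auto
  have "sum_list (map fst n_as) = CARD('n)" using w(4) by (metis carrier_matD(1) jordan_matrix_dim(1))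
  moreover have "row_value (Matrix.row Q i) (M *v x) = (\<Sum>j\<in>{0..<CARD('n)}. ?J $$ (i, j) * row_value (Matrix.row Q j) x)"
    if i: "i < CARD('n)" for i x
  proof -
    have "Q * ?A = (Q * P) * (?J * Q)"
      unfolding w(3) using w(4-6) by (simp add: assoc_mult_mat[of _ "CARD('n)" "CARD('n)" _ "CARD('n)" _ "CARD('n)"])
    moreover have "?J * Q \<in> carrier_mat CARD('n) CARD('n)" using w by simp
    ultimately have QA: "Q * ?A = ?J * Q" using w(2) by (simp only: left_mult_one_mat)
    have "row_value (Matrix.row Q i) (M *v x) = vec_index (Q *\<^sub>v (?A *\<^sub>v cvec x)) i"
      using i w(6) by (simp add: row_value_def complex_mat_mult_cvec)
    also have "Q *\<^sub>v (?A *\<^sub>v cvec x) = (Q * ?A) *\<^sub>v cvec x"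
      using assoc_mult_mat_vec[OF w(6) A dim_cvec] by simp
    also have "\<dots> = ?J *\<^sub>v (Q *\<^sub>v cvec x)" unfolding QA by (rule assoc_mult_mat_vec[OF w(4,6) dim_cvec])
    also have "vec_index \<dots> i = (\<Sum>j\<in>{0..<CARD('n)}. ?J $$ (i, j) * row_value (Matrix.row Q j) x)"
      using i carrier_matD[OF w(4)] carrier_matD[OF w(6)] by (simp add: scalar_prod_def[of "Matrix.row ?J i"] row_value_def)
    finally show ?thesis .
  qed
  ultimately show ?thesis using that w by blast
qed

lemma row_of_invertible_nonzero:
  fixes Q :: "complex mat"
  assumes "Q \<in> carrier_mat n n" "P \<in> carrier_mat n n" "Q * P = 1\<^sub>m n" "i < n"
  shows "Matrix.row Q i \<noteq> 0\<^sub>v n"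
proof
  assume zero: "Matrix.row Q i = 0\<^sub>v n"
  have "(Q * P) $$ (i, i) = scalar_prod (Matrix.row Q i) (col P i)" using assms(1,2,4) by simp
  then have "1 = scalar_prod (0\<^sub>v n) (col P i)" using assms(3,4) zero by simp
  then show False using assms by simp
qed

text \<open>The coordinate belonging to the last row of the block is geometric, and nonzero by
  cyclicity. The coordinate above it contains k \<kappa>^(k-1); subtracting its geometric part and
  rescaling leaves k \<kappa>^k.\<close>

lemma realizes_jordan:
  fixes M :: "real^'n^'n"
  assumes cyc: "cyclic_vector M u" and jnf: "jordan_nf (complex_mat M) n_as"
    and blk: "(n, \<kappa>) \<in> set n_as" "2 \<le> n" and \<kappa>0: "\<kappa> \<noteq> 0"
  shows "\<exists>B. realizes (orbit M u) (\<lambda>k. \<kappa> ^ k) B" "\<exists>B. realizes (orbit M u) (\<lambda>k. of_nat k * \<kappa> ^ k) B"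
proof -
  obtain P Q where dim: "sum_list (map fst n_as) = CARD('n)" and Q: "Q \<in> carrier_mat CARD('n) CARD('n)"
    and P: "P \<in> carrier_mat CARD('n) CARD('n)" and PQ: "P * Q = 1\<^sub>m CARD('n)" and QP: "Q * P = 1\<^sub>m CARD('n)"
    and step: "\<And>i x. i < CARD('n) \<Longrightarrow> row_value (Matrix.row Q i) (M *v x) =
      (\<Sum>j\<in>{0..<CARD('n)}. jordan_matrix n_as $$ (i, j) * row_value (Matrix.row Q j) x)"
    by (rule jordan_coordinates[OF jnf]) (rule that, assumption+)
  obtain i where i: "Suc i < CARD('n)"
    and Ji: "\<And>j. j < CARD('n) \<Longrightarrow> jordan_matrix n_as $$ (i, j) = (if j = i then \<kappa> else if j = Suc i then 1 else 0)"
    and JS: "\<And>j. j < CARD('n) \<Longrightarrow> jordan_matrix n_as $$ (Suc i, j) = (if j = Suc i then \<kappa> else 0)"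
    using jordan_matrix_block_rows[OF blk] unfolding dim by blast
  define f g where "f k = row_value (Matrix.row Q (Suc i)) (orbit M u k)"
    and "g k = row_value (Matrix.row Q i) (orbit M u k)" for k
  have fS: "f (Suc k) = \<kappa> * f k" for k
  proof -
    have "f (Suc k) = (\<Sum>j\<in>{0..<CARD('n)}. if j = Suc i then \<kappa> * f k else 0)"
      unfolding f_def orbit_Suc step[OF i] by (rule sum.cong) (auto simp: JS)
    then show ?thesis using i by simp
  qed
  have gS: "g (Suc k) = \<kappa> * g k + f k" for k
  proof -
    have "g (Suc k) = (\<Sum>j\<in>{0..<CARD('n)}. (if j = i then \<kappa> * g k else 0) + (if j = Suc i then f k else 0))"
      unfolding g_def orbit_Suc step[OF Suc_lessD[OF i]] by (rule sum.cong) (auto simp: Ji f_def)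
    then show ?thesis using i by (simp add: sum.distrib)
  qed
  have f: "f k = \<kappa> ^ k * f 0" for k by (induction k) (simp_all add: fS)
  \<comment> \<open>Multiplying by \<kappa> avoids the exponent k - 1, which would need a separate
    case k = 0.\<close>
  have g: "\<kappa> * g k = \<kappa> ^ k * (\<kappa> * g 0) + of_nat k * \<kappa> ^ k * f 0" for k
  proof (induction k)
    case (Suc k)
    have "\<kappa> * g (Suc k) = \<kappa> * (\<kappa> * g k) + \<kappa> * (\<kappa> ^ k * f 0)" using f[of k] by (simp add: gS algebra_simps)
    then show ?case unfolding Suc by (simp add: algebra_simps)
  qed simp
  have "Matrix.row Q (Suc i) \<in> carrier_vec CARD('n)"
    using row_carrier[of Q "Suc i"] carrier_matD[OF Q] by simp
  from row_value_cyclic[OF cyc this row_of_invertible_nonzero[OF Q P QP i]]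
  obtain k where "f k \<noteq> 0" unfolding f_def by blast
  then have f0: "f 0 \<noteq> 0" using f[of k] by auto
  obtain B where B: "realizes (orbit M u) f B" using realizes_row unfolding f_def by blast
  obtain D where D: "realizes (orbit M u) g D" using realizes_row unfolding g_def by blast
  have "(\<lambda>k. (1 / f 0) * f k + 0 * g k) = (\<lambda>k. \<kappa> ^ k)"
  proof
    fix k show "(1 / f 0) * f k + 0 * g k = \<kappa> ^ k" using f[of k] f0 by simp
  qed
  then show "\<exists>B. realizes (orbit M u) (\<lambda>k. \<kappa> ^ k) B"
    using realizes_combination[OF B D, of "1 / f 0" 0] by (metis (no_types, lifting))
  have "(\<lambda>k. (- \<kappa> * g 0 / (f 0)\<^sup>2) * f k + (\<kappa> / f 0) * g k) = (\<lambda>k. of_nat k * \<kappa> ^ k)"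
  proof
    fix k
    have "(\<kappa> / f 0) * g k = (\<kappa> ^ k * (\<kappa> * g 0) + of_nat k * \<kappa> ^ k * f 0) / f 0" using g[of k] by simp
    then show "(- \<kappa> * g 0 / (f 0)\<^sup>2) * f k + (\<kappa> / f 0) * g k = of_nat k * \<kappa> ^ k"
      using f[of k] f0 by (simp add: power2_eq_square field_simps)
  qed
  then show "\<exists>B. realizes (orbit M u) (\<lambda>k. of_nat k * \<kappa> ^ k) B"
    using realizes_combination[OF B D, of "- \<kappa> * g 0 / (f 0)\<^sup>2" "\<kappa> / f 0"] by (metis (no_types, lifting))
qed

text \<open>Simple roots force all Jordan blocks to have size 1, so M^N multiplies each coordinate
  by an N-th power of an eigenvalue, and these all equal \<gamma>.\<close>

lemma orbit_periodic:
  fixes M :: "real^'n^'n"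
  assumes simple: "\<And>\<kappa>. \<kappa> \<in> spectrum (complex_mat M) \<Longrightarrow> Polynomial.order \<kappa> (char_poly (complex_mat M)) = 1"
    and pow: "\<And>\<kappa>. \<kappa> \<in> spectrum (complex_mat M) \<Longrightarrow> \<kappa> ^ N = complex_of_real \<gamma>"
  shows "orbit M u N = \<gamma> *\<^sub>R u"
proof -
  let ?A = "complex_mat M"
  have A: "?A \<in> carrier_mat CARD('n) CARD('n)" by (rule complex_mat_carrier)
  obtain as where "char_poly ?A = (\<Prod>a\<leftarrow>as. [:- a, 1:])" using char_poly_factorized[OF A] by blast
  then obtain n_as where jnf: "jordan_nf ?A n_as" using jordan_nf_exists[OF A] by blast
  have cp0: "char_poly ?A \<noteq> 0" using degree_monic_char_poly[OF A] by auto
  have blocks: "n = 1 \<and> a \<in> spectrum ?A" if "(n, a) \<in> set n_as" for n a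
  proof -
    have "n \<noteq> 0" using jnf that unfolding jordan_nf_def by (metis fst_conv image_eqI)
    have le: "n \<le> Polynomial.order a (char_poly ?A)" by (rule jordan_nf_block_size_order_bound[OF jnf that])
    then have "poly (char_poly ?A) a = 0" using \<open>n \<noteq> 0\<close> order_root[of "char_poly ?A" a] by auto
    then have "a \<in> spectrum ?A" unfolding spectrum_root_char_poly[OF A] by simp
    then show ?thesis using simple[of a] le \<open>n \<noteq> 0\<close> by simp
  qed
  obtain P Q where dim: "sum_list (map fst n_as) = CARD('n)" and Q: "Q \<in> carrier_mat CARD('n) CARD('n)"
    and P: "P \<in> carrier_mat CARD('n) CARD('n)" and PQ: "P * Q = 1\<^sub>m CARD('n)" and QP: "Q * P = 1\<^sub>m CARD('n)"
    and step: "\<And>i x. i < CARD('n) \<Longrightarrow> row_value (Matrix.row Q i) (M *v x) =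
      (\<Sum>j\<in>{0..<CARD('n)}. jordan_matrix n_as $$ (i, j) * row_value (Matrix.row Q j) x)"
    by (rule jordan_coordinates[OF jnf]) (rule that, assumption+)
  have eq: "row_value (Matrix.row Q i) (orbit M u N) = of_real \<gamma> * row_value (Matrix.row Q i) u" if i: "i < CARD('n)" for i
  proof -
    have "i < sum_list (map fst n_as)" using i dim by simp
    moreover have "n = 1" if "(n, a) \<in> set n_as" for n a using blocks[OF that] by simp
    ultimately have "\<exists>a \<in> snd ` set n_as. \<forall>j < CARD('n). jordan_matrix n_as $$ (i, j) = (if j = i then a else 0)"
      using jordan_matrix_diagonal[of n_as i] unfolding dim by metis
    then
    obtain a where a: "a \<in> snd ` set n_as"
      and "\<forall>j < CARD('n). jordan_matrix n_as $$ (i, j) = (if j = i then a else 0)"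
      by (elim bexE)
    then have Jij: "jordan_matrix n_as $$ (i, j) = (if j = i then a else 0)" if "j < CARD('n)" for j
      using that by simp
    have st: "row_value (Matrix.row Q i) (M *v x) = a * row_value (Matrix.row Q i) x" for x
    proof -
      have "row_value (Matrix.row Q i) (M *v x) = (\<Sum>j\<in>{0..<CARD('n)}. if j = i then a * row_value (Matrix.row Q i) x else 0)"
        unfolding step[OF i] by (rule sum.cong) (auto simp: Jij)
      then show ?thesis using i by simp
    qed
    have "row_value (Matrix.row Q i) (orbit M u k) = a ^ k * row_value (Matrix.row Q i) u" for k
      by (induction k) (simp_all add: orbit_0 orbit_Suc st)
    moreover have "a ^ N = of_real \<gamma>" using a blocks pow by force
    ultimately show ?thesis by simp
  qed
  have sc: "cvec (\<gamma> *\<^sub>R u) = of_real \<gamma> \<cdot>\<^sub>v cvec u" by (intro eq_vecI) (auto simp: cvec_def)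
  have "Q *\<^sub>v cvec (orbit M u N) = Q *\<^sub>v cvec (\<gamma> *\<^sub>R u)"
  proof (rule eq_vecI)
    fix i assume "i < dim_vec (Q *\<^sub>v cvec (\<gamma> *\<^sub>R u))"
    then have i: "i < CARD('n)" using Q by simp
    then show "vec_index (Q *\<^sub>v cvec (orbit M u N)) i = vec_index (Q *\<^sub>v cvec (\<gamma> *\<^sub>R u)) i"
      using eq[OF i] Q dim_cvec[of u] unfolding sc by (simp add: row_value_def)
  qed simp
  then have "P *\<^sub>v (Q *\<^sub>v cvec (orbit M u N)) = P *\<^sub>v (Q *\<^sub>v cvec (\<gamma> *\<^sub>R u))" by simp
  then have "(P * Q) *\<^sub>v cvec (orbit M u N) = (P * Q) *\<^sub>v cvec (\<gamma> *\<^sub>R u)"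
    by (simp add: assoc_mult_mat_vec[OF P Q dim_cvec])
  then have ceq: "cvec (orbit M u N) = cvec (\<gamma> *\<^sub>R u)" using dim_cvec[of "orbit M u N"] dim_cvec[of "\<gamma> *\<^sub>R u"] by (simp add: PQ)
  have "vec_nth (orbit M u N) j = vec_nth (\<gamma> *\<^sub>R u) j" for j
  proof -
    obtain i where "i < CARD('n)" "index_enum i = j"
      using bij_betw_index_enum[where 'n = 'n] unfolding bij_betw_def by (metis (no_types, opaque_lifting) UNIV_I atLeastLessThan_iff imageE)
    then show ?thesis using arg_cong[OF ceq, of "\<lambda>v. vec_index v i"] by (simp add: cvec_def flip: of_real_mult)
  qed
  then show ?thesis by (simp add: Finite_Cartesian_Product.vec_eq_iff)
qed

section \<open>Scalar powers\<close>


text \<open>If compensation reaches 1 at digit n, this digit can be switched: the value y + d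
  required of the new tail stays in [0, 1 / (\<beta> - 1)], and for \<beta> \<le> 2 every point of
  that interval has an expansion.\<close>

lemma not_univoque_ambiguous:
  assumes \<beta>: "1 < \<beta>" "\<beta> \<le> 2" and e: "e \<notin> univoque \<beta>"
  shows "\<exists>e'. e' \<noteq> e \<and> beta_val \<beta> e' = beta_val \<beta> e"
proof -
  from e obtain n where n: "1 \<le> beta_val \<beta> (flips e n)" by (auto simp: univoque_def not_less)
  define y where "y = beta_val \<beta> (\<lambda>k. e (n + 1 + k))"
  define d :: real where "d = (if e n then 1 else - 1)"
  have y: "0 \<le> y + d \<and> y + d \<le> 1 / (\<beta> - 1)"
  proof (cases "e n")
    case True
    have "(\<lambda>k. 1 / \<beta> ^ (k + 1) - of_bool (e (n + 1 + k)) / \<beta> ^ (k + 1)) sums (1 / (\<beta> - 1) - y)"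
      unfolding y_def by (intro sums_diff geometric_tail_sums beta_val_sums \<beta>)
    also have "(\<lambda>k. 1 / \<beta> ^ (k + 1) - of_bool (e (n + 1 + k)) / \<beta> ^ (k + 1)) = (\<lambda>k. of_bool (flips e n k) / \<beta> ^ (k + 1))"
      using True by (auto simp: flips_def fun_eq_iff)
    finally have "beta_val \<beta> (flips e n) = 1 / (\<beta> - 1) - y" using beta_val_sums[OF \<beta>(1)] sums_unique2 by metis
    then show ?thesis using n True beta_val_nonneg[OF \<beta>(1), of "\<lambda>k. e (n + 1 + k)"] by (simp add: d_def y_def)
  next
    case False
    then have "flips e n = (\<lambda>k. e (n + 1 + k))" by (auto simp: flips_def)
    then show ?thesis using n False beta_val_le[OF \<beta>(1), of "\<lambda>k. e (n + 1 + k)"] by (simp add: d_def y_def)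
  qed
  then obtain z where z: "beta_val \<beta> z = y + d" using beta_val_onto[OF \<beta>] by blast
  define e' where "e' k = (if k < n then e k else if k = n then \<not> e n else z (k - (n + 1)))" for k
  have split: "beta_val \<beta> x = (\<Sum>k<n. of_bool (x k) / \<beta> ^ (k + 1)) + (of_bool (x n) + beta_val \<beta> (\<lambda>k. x (n + 1 + k))) / \<beta> ^ (n + 1)" for x
    using beta_val_split[OF \<beta>(1), of x "n + 1"] by (simp add: add_divide_distrib)
  have "beta_val \<beta> (\<lambda>k. e' (n + 1 + k)) = y + d" using z by (simp add: e'_def)
  moreover have "(\<Sum>k<n. of_bool (e' k) / \<beta> ^ (k + 1)) = (\<Sum>k<n. of_bool (e k) / \<beta> ^ (k + 1))"
    by (rule sum.cong) (auto simp: e'_def)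
  moreover have "e' n = (\<not> e n)" by (simp add: e'_def)
  ultimately have "beta_val \<beta> e' = beta_val \<beta> e"
    unfolding split[of e'] split[of e] y_def[symmetric] by (simp add: d_def)
  moreover have "e' \<noteq> e" using \<open>e' n = (\<not> e n)\<close> by metis
  ultimately show ?thesis by blast
qed

definition sg :: "bool \<Rightarrow> real" where
  "sg b = (if b then 1 else - 1)"

lemma sg_simps: "\<bar>sg b\<bar> = 1" "sg b * sg b = 1" "sg b = sg c \<longleftrightarrow> b = c" "sg (x = 1) = x \<longleftrightarrow> x = 1 \<or> x = - 1"
  by (auto simp: sg_def)

text \<open>Each residue class modulo N is a copy of base \<beta> up to the sign \<sigma>. Since v
  vanishes on class 0 and nowhere else, it controls all other classes and leaves class 0
  free.\<close>

locale scaled_orbit =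
  fixes X :: "nat \<Rightarrow> 'a::euclidean_space" and N :: nat and \<sigma> \<beta> :: real and v :: 'a
  assumes sm: "summable (\<lambda>k. norm (X k))"
    and N: "0 < N" and \<sigma>: "\<sigma> = 1 \<or> \<sigma> = - 1" and \<beta>: "1 < \<beta>"
    and period: "\<And>k. X (k + N) = (\<sigma> / \<beta>) *\<^sub>R X k"
    and X0: "X 0 \<noteq> 0" and v0: "inner v (X 0) = 0"
    and vr: "\<And>k. 0 < k \<Longrightarrow> k < N \<Longrightarrow> inner v (X k) \<noteq> 0"
begin

section \<open>Residue classes as expansions in base \<beta>\<close>

lemma X_mult: "X (N * m + r) = (\<sigma> / \<beta>) ^ m *\<^sub>R X r"
proof (induction m)
  case (Suc m)
  have "X (N * Suc m + r) = X ((N * m + r) + N)" by (simp add: add_ac)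
  then show ?case by (simp only: period Suc) simp
qed simp

lemma X_divmod: "X k = (\<sigma> / \<beta>) ^ (k div N) *\<^sub>R X (k mod N)"
  using X_mult[of "k div N" "k mod N"] by simp

lemma \<sigma>_pow: "\<sigma> ^ m * \<sigma> ^ m = 1" "\<bar>\<sigma> ^ m\<bar> = 1"
proof -
  have "\<sigma> * \<sigma> = 1" "\<bar>\<sigma>\<bar> = 1" using \<sigma> by auto
  then show "\<sigma> ^ m * \<sigma> ^ m = 1" "\<bar>\<sigma> ^ m\<bar> = 1"
    by (metis power_mult_distrib power_one, simp add: power_abs)
qed

lemma \<sigma>_nz: "\<sigma> ^ m \<noteq> 0"
  using \<sigma>_pow(2)[of m] by linarith

lemma mod_pos: "\<not> N dvd k \<Longrightarrow> 0 < k mod N"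
  by (simp add: dvd_eq_mod_eq_0)

text \<open>The factor \<open>\<sigma> ^ m\<close> undoes the sign of \<open>(\<sigma> / \<beta>) ^ m\<close>, so that each residue class modulo \<open>N\<close> is a digit
  sequence in the positive base \<open>\<beta>\<close>.\<close>

definition address :: "(nat \<Rightarrow> nat \<Rightarrow> bool) \<Rightarrow> nat \<Rightarrow> real" where
  "address f k = \<sigma> ^ (k div N) * sg (f (k mod N) (k div N))"

definition digits :: "(nat \<Rightarrow> real) \<Rightarrow> nat \<Rightarrow> nat \<Rightarrow> bool" where
  "digits a r m \<longleftrightarrow> \<sigma> ^ m * a (N * m + r) = 1"

lemma address_sign_seqs: "address f \<in> sign_seqs"
proof -
  have "\<bar>address f k\<bar> = 1" for k by (simp add: address_def abs_mult \<sigma>_pow sg_simps)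
  then have "address f k \<in> {-1, 1}" for k by (metis abs_minus_cancel abs_of_nonneg abs_of_nonpos insertI1 insertI2 le_cases minus_minus)
  then show ?thesis by (simp add: sign_seqs_def)
qed

lemma address_digits:
  assumes a: "a \<in> sign_seqs"
  shows "address (digits a) = a"
proof
  fix k
  have "\<sigma> ^ (k div N) * a k = 1 \<or> \<sigma> ^ (k div N) * a k = - 1"
    using sign_seqs_abs[OF a, of k] \<sigma>_pow(2)[of "k div N"] by (metis abs_eq_iff abs_minus_cancel abs_mult abs_one mult_1)
  then have "sg (\<sigma> ^ (k div N) * a k = 1) = \<sigma> ^ (k div N) * a k" by (simp add: sg_simps)
  then show "address (digits a) k = a k"
    unfolding address_def digits_def by (simp add: mult.assoc[symmetric] \<sigma>_pow)
qed

lemma digits_address: "r < N \<Longrightarrow> digits (address f) r = f r"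
  by (rule ext) (simp add: digits_def address_def mult.assoc[symmetric] \<sigma>_pow sg_def)

text \<open>A class enters the sum only through the \<open>beta_val\<close> of its digits, so
  another expansion of the same number yields the same point.\<close>

lemma signed_sum_address_upd:
  assumes r: "r < N" and eq: "beta_val \<beta> e = beta_val \<beta> (f r)"
  shows "signed_sum X (address (f(r := e))) = signed_sum X (address f)"
proof -
  define D where "D k = (address (f(r := e)) k - address f k) *\<^sub>R X k" for k
  have D: "D sums (signed_sum X (address (f(r := e))) - signed_sum X (address f))"
    unfolding D_def signed_sum_def scaleR_diff_left
    by (intro sums_diff summable_sums summable_signed sm address_sign_seqs)
  have z: "D k = 0" if "k \<notin> range (\<lambda>m. N * m + r)" for k
  proof -
    have "k mod N \<noteq> r" using that by (metis mult_div_mod_eq rangeI)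
    then show ?thesis by (simp add: D_def address_def)
  qed
  have "strict_mono (\<lambda>m. N * m + r)" using N by (simp add: strict_mono_def)
  then have "(\<lambda>m. D (N * m + r)) sums (signed_sum X (address (f(r := e))) - signed_sum X (address f))"
    using sums_mono_reindex[of "\<lambda>m. N * m + r" D] z D by blast
  \<comment> \<open>Two signs differ by 2 where digits differ by 1, and digit m weighs \<beta>^-m
    here but \<beta>^-(m+1) in \<open>beta_val\<close>: hence the factor
    \<open>2 * \<beta>\<close>.\<close>
  moreover have "D (N * m + r) = ((2 * \<beta>) * (of_bool (e m) / \<beta> ^ (m + 1) - of_bool (f r m) / \<beta> ^ (m + 1))) *\<^sub>R X r" for m
  proof -
    have "D (N * m + r) = (\<sigma> ^ m * (sg (e m) - sg (f r m)) * (\<sigma> / \<beta>) ^ m) *\<^sub>R X r"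
      using r by (simp add: D_def address_def X_mult right_diff_distrib)
    also have "\<sigma> ^ m * (sg (e m) - sg (f r m)) * (\<sigma> / \<beta>) ^ m = (\<sigma> ^ m * \<sigma> ^ m) * (sg (e m) - sg (f r m)) / \<beta> ^ m"
      by (simp add: power_divide)
    also have "\<dots> = (2 * \<beta>) * (of_bool (e m) / \<beta> ^ (m + 1) - of_bool (f r m) / \<beta> ^ (m + 1))"
      using \<beta> by (simp add: \<sigma>_pow sg_def)
    finally show ?thesis .
  qed
  moreover have "(\<lambda>m. ((2 * \<beta>) * (of_bool (e m) / \<beta> ^ (m + 1) - of_bool (f r m) / \<beta> ^ (m + 1))) *\<^sub>R X r) sums
      (((2 * \<beta>) * (beta_val \<beta> e - beta_val \<beta> (f r))) *\<^sub>R X r)"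
    by (intro sums_scaleR_left sums_mult sums_diff beta_val_sums \<beta>)
  ultimately show ?thesis using eq sums_unique2 by fastforce
qed

text \<open>An ambiguous expansion in one class would give the point a second address. All upper
  bounds on the size of the uniqueness set rest on this inclusion.\<close>

lemma unique_sums_subset:
  assumes "\<beta> \<le> 2"
  shows "unique_sums X \<subseteq> (\<lambda>f. signed_sum X (address f)) ` ({..<N} \<rightarrow>\<^sub>E univoque \<beta>)"
proof
  fix x assume "x \<in> unique_sums X"
  then obtain a where a: "a \<in> sign_seqs" "x = signed_sum X a"
    and uniq: "\<And>b. b \<in> sign_seqs \<Longrightarrow> x = signed_sum X b \<Longrightarrow> b = a" unfolding unique_sums_def by blast
  define f where "f = restrict (digits a) {..<N}"
  have "address f = address (digits a)" using N by (auto simp: address_def f_def)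
  then have af: "address f = a" using address_digits[OF a(1)] by simp
  have "f r \<in> univoque \<beta>" if r: "r < N" for r
  proof (rule ccontr)
    assume "f r \<notin> univoque \<beta>"
    then obtain e where e: "e \<noteq> f r" "beta_val \<beta> e = beta_val \<beta> (f r)"
      using not_univoque_ambiguous[OF \<beta> assms] by blast
    have "address (f(r := e)) = a"
      using signed_sum_address_upd[of r e f, OF r e(2)] af a(2) by (intro uniq address_sign_seqs) simp
    then have "digits (address (f(r := e))) r = digits (address f) r" using af by simp
    then show False using e(1) r by (simp add: digits_address)
  qed
  then have "f \<in> {..<N} \<rightarrow>\<^sub>E univoque \<beta>" by (auto simp: f_def)
  then show "x \<in> (\<lambda>f. signed_sum X (address f)) ` ({..<N} \<rightarrow>\<^sub>E univoque \<beta>)"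
    using af a(2) by (intro image_eqI) auto
qed

text \<open>Outside class 0 the signs are those of v, so v alone separates addresses whose first
  difference lies there.\<close>

definition embed :: "(nat \<Rightarrow> bool) \<Rightarrow> nat \<Rightarrow> real" where
  "embed e k = (if N dvd k then \<sigma> ^ (k div N) * sg (e (k div N)) else sgn (inner v (X k)))"

lemma v_X: "inner v (X k) = (\<sigma> / \<beta>) ^ (k div N) * inner v (X (k mod N))"
  by (subst X_divmod) simp

lemma v_X_zero: "N dvd k \<Longrightarrow> inner v (X k) = 0"
  by (subst v_X) (simp add: v0)

lemma v_X_nonzero: "\<not> N dvd k \<Longrightarrow> inner v (X k) \<noteq> 0"
  using vr[OF mod_pos] N \<sigma>_nz[of "k div N"] \<beta> by (subst v_X) (simp add: power_divide)

lemma \<sigma>\<beta>_abs: "\<bar>(\<sigma> / \<beta>) ^ m\<bar> = 1 / \<beta> ^ m"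
  using \<sigma>_pow(2)[of m] \<beta> by (simp add: power_divide)

lemma embed_sign_seqs: "embed e \<in> sign_seqs"
proof -
  have "\<bar>embed e k\<bar> = 1" for k
    using v_X_nonzero[of k] by (auto simp: embed_def abs_mult \<sigma>_pow sg_simps abs_sgn_eq)
  then have "embed e k \<in> {-1, 1}" for k by (metis abs_minus_cancel abs_of_nonneg abs_of_nonpos insertI1 insertI2 le_cases minus_minus)
  then show ?thesis by (simp add: sign_seqs_def)
qed

lemma embed_mult: "embed e (N * m) = \<sigma> ^ m * sg (e m)"
  using N by (simp add: embed_def)

definition v_min :: real where
  "v_min = Min (insert 1 ((\<lambda>k. \<bar>inner v (X k)\<bar>) ` {0<..<N}))"

lemma v_min: "0 < v_min" "\<And>k. 0 < k \<Longrightarrow> k < N \<Longrightarrow> v_min \<le> \<bar>inner v (X k)\<bar>"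
  using vr by (auto simp: v_min_def)

definition coord :: 'a where
  "coord = (1 / (norm (X 0))\<^sup>2) *\<^sub>R X 0"

lemma coord: "inner coord (X (N * m)) = (\<sigma> / \<beta>) ^ m"
proof -
  have "inner coord (X 0) = 1" using X0 by (simp add: coord_def power2_norm_eq_inner)
  then show ?thesis using X_mult[of m 0] by simp
qed

text \<open>Large enough for \<open>weight *\<^sub>R v\<close> to outvote \<open>coord\<close> at
  every position outside class 0.\<close>

definition weight :: real where
  "weight = (\<Sum>k\<in>{0<..<N}. \<bar>inner coord (X k)\<bar> / \<bar>inner v (X k)\<bar>)"

lemma weight_nonneg: "0 \<le> weight"
  by (simp add: weight_def sum_nonneg)

lemma weight: "\<not> N dvd k \<Longrightarrow> \<bar>inner coord (X k)\<bar> \<le> weight * \<bar>inner v (X k)\<bar>"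
proof -
  assume k: "\<not> N dvd k"
  define r where "r = k mod N"
  have r: "0 < r" "r < N" using mod_pos[OF k] N by (auto simp: r_def)
  have "\<bar>inner coord (X r)\<bar> / \<bar>inner v (X r)\<bar> \<le> weight"
    unfolding weight_def by (rule member_le_sum) (use r in auto)
  then have "\<bar>inner coord (X r)\<bar> \<le> weight * \<bar>inner v (X r)\<bar>" using vr[OF r] by (simp add: field_simps)
  then have "\<bar>(\<sigma> / \<beta>) ^ (k div N)\<bar> * \<bar>inner coord (X r)\<bar> \<le> \<bar>(\<sigma> / \<beta>) ^ (k div N)\<bar> * (weight * \<bar>inner v (X r)\<bar>)"
    by (intro mult_left_mono) auto
  then show ?thesis
    by (subst (1 2) X_divmod) (simp add: r_def abs_mult mult.left_commute)
qed

text \<open>Outside class 0 a multiple of v has no mismatch. Inside, \<open>coord\<close> is added: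
  the v-part prevails outside the class and vanishes on it, so the mismatch is exactly the value of
  \<open>flips e\<close>. Scaling by \<beta>^m undoes the decay up to position n, and m =
  \<open>n div N\<close> \<le> n keeps the norm within \<beta>^n.\<close>

lemma embed_witness:
  "\<exists>w. (1 / \<beta>) ^ n * norm w \<le> (1 + weight) * norm v + norm coord \<and>
    min v_min (1 - beta_val \<beta> (flips e (n div N)))
      \<le> embed e n * inner w (X n) - mismatch_cost (embed e) (\<lambda>k. inner w (X k)) n"
proof -
  define m where "m = n div N"
  let ?a = "embed e"
  have decay: "(1 / \<beta>) ^ n * \<beta> ^ m \<le> 1"
  proof -
    have "m \<le> n" by (simp add: m_def)
    then have "(1 / \<beta>) ^ n \<le> (1 / \<beta>) ^ m" using \<beta> by (intro power_decreasing) auto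
    then have "(1 / \<beta>) ^ n * \<beta> ^ m \<le> (1 / \<beta>) ^ m * \<beta> ^ m" using \<beta> by (intro mult_right_mono) auto
    then show ?thesis using \<beta> by (simp add: power_mult_distrib[symmetric])
  qed
  have av: "?a k * inner v (X k) = \<bar>inner v (X k)\<bar>" for k
    using v_X_zero[of k] by (auto simp: embed_def abs_sgn mult.commute)
  show ?thesis
  proof (cases "N dvd n")
    case False
    define w where "w = \<beta> ^ m *\<^sub>R v"
    have aw: "?a k * inner w (X k) = \<beta> ^ m * \<bar>inner v (X k)\<bar>" for k
      using av[of k] by (simp add: w_def mult.left_commute)
    have "max 0 (- (?a k * inner w (X k))) = 0" for k unfolding aw using \<beta> by simp
    then have "mismatch_cost ?a (\<lambda>k. inner w (X k)) n = 0" by (simp only: mismatch_cost_def suminf_zero)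
    moreover have "?a n * inner w (X n) = \<bar>inner v (X (n mod N))\<bar>"
      unfolding aw using \<beta> by (subst v_X) (simp add: abs_mult \<sigma>\<beta>_abs m_def)
    moreover have "v_min \<le> \<bar>inner v (X (n mod N))\<bar>"
      using mod_pos[OF False] N by (intro v_min(2)) auto
    moreover have "(1 / \<beta>) ^ n * norm w \<le> (1 + weight) * norm v + norm coord"
    proof -
      have "(1 / \<beta>) ^ n * norm w = ((1 / \<beta>) ^ n * \<beta> ^ m) * norm v" using \<beta> by (simp add: w_def)
      also have "\<dots> \<le> 1 * norm v" by (rule mult_right_mono[OF decay]) simp
      also have "\<dots> \<le> (1 + weight) * norm v" using weight_nonneg by (intro mult_right_mono) auto
      finally show ?thesis using norm_ge_zero[of coord] by linarith
    qed
    ultimately show ?thesis by (intro exI[of _ w]) (auto simp: min_le_iff_disj)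
  next
    case True
    then have n: "n = N * m" by (simp add: m_def)
    define s where "s = sg (e m)"
    define w where "w = \<beta> ^ m *\<^sub>R (weight *\<^sub>R v + s *\<^sub>R coord)"
    have s: "\<bar>s\<bar> = 1" "s * s = 1" by (simp_all add: s_def sg_simps)
    have aw: "?a k * inner w (X k) = \<beta> ^ m * (weight * \<bar>inner v (X k)\<bar> + s * (?a k * inner coord (X k)))" for k
      using av[of k] by (simp add: w_def inner_add_left algebra_simps)
    have off: "0 \<le> ?a k * inner w (X k)" if "\<not> N dvd k" for k
    proof -
      have "\<bar>s * (?a k * inner coord (X k))\<bar> \<le> weight * \<bar>inner v (X k)\<bar>"
        using weight[OF that] s sign_seqs_abs[OF embed_sign_seqs, of e k] by (simp add: abs_mult)
      then have "0 \<le> weight * \<bar>inner v (X k)\<bar> + s * (?a k * inner coord (X k))" by linarith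
      then show ?thesis unfolding aw using \<beta> by simp
    qed
    have on: "?a (N * l) * inner w (X (N * l)) = \<beta> ^ m / \<beta> ^ l * (s * sg (e l))" for l
    proof -
      have "?a (N * l) * inner coord (X (N * l)) = (\<sigma> ^ l * \<sigma> ^ l) * sg (e l) / \<beta> ^ l"
        unfolding coord embed_mult by (simp add: power_divide)
      then show ?thesis unfolding aw using v_X_zero[of "N * l"] by (simp add: \<sigma>_pow)
    qed
    have "?a n * inner w (X n) = 1" unfolding n on using \<beta> s by (simp add: s_def)
    moreover have "mismatch_cost ?a (\<lambda>k. inner w (X k)) n = beta_val \<beta> (flips e m)"
    proof -
      define F where "F j = max 0 (- (?a (n + 1 + j) * inner w (X (n + 1 + j))))" for j
      \<comment> \<open>\<open>h\<close> enumerates the later positions of class 0, counted from n +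
        1; all other positions contribute 0 to the cost.\<close>
      define h where "h i = N * (i + 1) - 1" for i
      have h: "n + 1 + h i = N * (m + 1 + i)" for i using N by (simp add: h_def n algebra_simps)
      have "strict_mono h" unfolding strict_mono_def
      proof (intro allI impI)
        fix x y :: nat assume "x < y"
        then have "N * (x + 1) < N * (y + 1)" using N by simp
        then show "h x < h y" using N unfolding h_def by (simp add: diff_less_mono)
      qed
      moreover have "F j = 0" if "j \<notin> range h" for j
      proof -
        have "\<not> N dvd n + 1 + j"
        proof
          assume "N dvd n + 1 + j"
          then obtain l where l: "n + 1 + j = N * l" by blast
          then have "N * m < N * l" unfolding n by linarith
          then have "m + 1 \<le> l" by simp
          then obtain i where "l = m + 1 + i" using le_Suc_ex by blast
          then have "n + 1 + j = n + 1 + h i" using l h by simp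
          then show False using that by auto
        qed
        then show ?thesis using off by (simp add: F_def)
      qed
      ultimately have "(\<lambda>i. F (h i)) sums c \<longleftrightarrow> F sums c" for c
        using sums_mono_reindex[of h F c] by blast
      moreover have "F (h i) = of_bool (flips e m i) / \<beta> ^ (i + 1)" for i
      proof -
        have "F (h i) = max 0 (- (\<beta> ^ m / \<beta> ^ (m + 1 + i) * (s * sg (e (m + 1 + i)))))"
          unfolding F_def h on ..
        also have "\<beta> ^ m / \<beta> ^ (m + 1 + i) = 1 / \<beta> ^ (i + 1)" using \<beta> by (simp add: power_add)
        finally show ?thesis using \<beta> by (auto simp: flips_def s_def sg_def)
      qed
      ultimately have "F sums beta_val \<beta> (flips e m)" using beta_val_sums[OF \<beta>, of "flips e m"] by simp
      then show ?thesis unfolding mismatch_cost_def F_def by (rule sums_unique[symmetric])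
    qed
    moreover have "(1 / \<beta>) ^ n * norm w \<le> (1 + weight) * norm v + norm coord"
    proof -
      have "(1 / \<beta>) ^ n * norm w = ((1 / \<beta>) ^ n * \<beta> ^ m) * norm (weight *\<^sub>R v + s *\<^sub>R coord)" using \<beta> by (simp add: w_def)
      also have "\<dots> \<le> 1 * norm (weight *\<^sub>R v + s *\<^sub>R coord)" by (rule mult_right_mono[OF decay]) simp
      also have "\<dots> \<le> norm (weight *\<^sub>R v) + norm (s *\<^sub>R coord)" using norm_triangle_ineq[of "weight *\<^sub>R v" "s *\<^sub>R coord"] by simp
      also have "\<dots> = weight * norm v + norm coord" using weight_nonneg s by simp
      finally show ?thesis unfolding distrib_right using norm_ge_zero[of v] by linarith
    qed
    ultimately show ?thesis by (intro exI[of _ w]) (simp add: m_def)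
  qed
qed

lemma embed_unique:
  assumes e: "e \<in> univoque \<beta>"
  shows "signed_sum X (embed e) \<in> unique_sums X"
  unfolding unique_sums_def mem_Collect_eq
proof (rule ex1I[of _ "embed e"])
  fix b assume b: "b \<in> sign_seqs \<and> signed_sum X (embed e) = signed_sum X b"
  show "b = embed e"
  proof (rule ccontr)
    assume "b \<noteq> embed e"
    then obtain n where n: "\<forall>i<n. embed e i = b i" "embed e n \<noteq> b n" using first_difference[of "embed e" b] by metis
    obtain w where w: "min v_min (1 - beta_val \<beta> (flips e (n div N)))
      \<le> embed e n * inner w (X n) - mismatch_cost (embed e) (\<lambda>k. inner w (X k)) n"
      using embed_witness by blast
    have "0 < min v_min (1 - beta_val \<beta> (flips e (n div N)))"
      using v_min(1) e by (simp add: univoque_def)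
    from less_le_trans[OF this w]
    have "0 < 2 * (embed e n * inner w (X n) - mismatch_cost (embed e) (\<lambda>k. inner w (X k)) n)" by simp
    also have "\<dots> \<le> norm w * norm (signed_sum X (embed e) - signed_sum X b)"
      using b by (intro signed_sum_separation[OF sm embed_sign_seqs _ n]) simp
    finally show False using b by simp
  qed
qed (simp add: embed_sign_seqs)

lemma embed_inj_on: "inj_on (\<lambda>e. signed_sum X (embed e)) (univoque \<beta>)"
proof (rule inj_onI)
  fix e e' assume e: "e \<in> univoque \<beta>" "e' \<in> univoque \<beta>" "signed_sum X (embed e) = signed_sum X (embed e')"
  from embed_unique[OF e(1)] have eq: "embed e = embed e'"
    using e(3) embed_sign_seqs unfolding unique_sums_def by blast
  have "sg (e m) = sg (e' m)" for m
    using fun_cong[OF eq, of "N * m"] unfolding embed_mult by (simp only: mult_left_cancel[OF \<sigma>_nz])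
  then show "e = e'" by (auto simp: sg_simps)
qed

lemma unique_sums_small_base:
  assumes "\<beta> \<le> golden_ratio"
  shows "finite (unique_sums X)" "unique_sums X \<noteq> {}"
proof -
  have "\<beta>\<^sup>2 \<le> \<beta> + 1" using golden_ratio_le_iff[OF \<beta>] assms by simp
  moreover have "2 * \<beta> < \<beta>\<^sup>2" if "2 < \<beta>"
    unfolding power2_eq_square using that by (intro mult_strict_right_mono) auto
  ultimately have "\<beta> \<le> 2" using \<beta> by linarith
  have "univoque \<beta> \<subseteq> range (\<lambda>d _. d)"
  proof
    fix e assume "e \<in> univoque \<beta>"
    from univoque_trivial[OF \<beta> assms this] show "e \<in> range (\<lambda>d _. d)" by (rule range_eqI)
  qed
  then have "finite (univoque \<beta>)" by (rule finite_subset) simp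
  then have "finite ({..<N} \<rightarrow>\<^sub>E univoque \<beta>)" by (intro finite_PiE) auto
  then show "finite (unique_sums X)" using unique_sums_subset[OF \<open>\<beta> \<le> 2\<close>] finite_subset by blast
  show "unique_sums X \<noteq> {}" using embed_unique[OF const_in_univoque] by blast
qed

lemma unique_sums_medium_base:
  assumes "golden_ratio < \<beta>" "\<beta> < komornik_loreti"
  shows "infinite (unique_sums X)" "countable (unique_sums X)"
proof -
  have "infinite ((\<lambda>e. signed_sum X (embed e)) ` univoque \<beta>)"
    using infinite_univoque[OF assms(1)] embed_inj_on finite_image_iff by blast
  then show "infinite (unique_sums X)" using embed_unique by (meson finite_subset image_subsetI)
  have "countable ({..<N} \<rightarrow>\<^sub>E univoque \<beta>)" using countable_univoque[OF \<beta> assms(2)] by (intro countable_PiE) auto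
  then show "countable (unique_sums X)"
    using countable_subset[OF unique_sums_subset] komornik_loreti(2) assms(2) by simp
qed

lemma uncountable_unique_sums:
  assumes "\<beta> = komornik_loreti"
  shows "uncountable (unique_sums X)"
proof
  assume "countable (unique_sums X)"
  then have "countable ((\<lambda>e. signed_sum X (embed e)) ` univoque \<beta>)"
    using embed_unique by (meson countable_subset image_subsetI)
  then have "countable (univoque \<beta>)" using embed_inj_on by (rule countable_image_inj_on)
  then show False using uncountable_univoque_komornik_loreti assms by simp
qed

text \<open>Class 0 is filled with Thue-Morse blocks, whose uniform bound gives a gap independent of
  the code and of n. One code letter governs 2^n digits, that is, \<open>N * 2 ^ n\<close> positions
  of the address.\<close>

lemma hausdorff_dim_large_base:
  assumes "komornik_loreti < \<beta>"
  shows "0 < hausdorff_dim (unique_sums X)"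
proof -
  obtain n \<mu> where \<mu>: "\<mu> < 1" "\<And>e i. beta_val \<beta> (flips (tm_blocks n e) i) \<le> \<mu>"
    using tm_blocks_bound[OF assms] by blast
  show ?thesis
  proof (rule hausdorff_dim_unique_sums_pos[OF sm, where \<Phi> = "\<lambda>e. embed (tm_blocks n e)" and L = "N * 2 ^ n"
      and c = "min v_min (1 - \<mu>)" and r = "1 / \<beta>" and C = "(1 + weight) * norm v + norm coord"])
    show "embed (tm_blocks n e) \<in> sign_seqs" for e by (rule embed_sign_seqs)
    show "0 < min v_min (1 - \<mu>)" using v_min \<mu> by simp
    show "0 < 1 / \<beta>" "1 / \<beta> < 1" using \<beta> by auto
    show "\<exists>w. (1 / \<beta>) ^ k * norm w \<le> (1 + weight) * norm v + norm coord \<and> min v_min (1 - \<mu>)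
      \<le> embed (tm_blocks n e) k * inner w (X k) - mismatch_cost (embed (tm_blocks n e)) (\<lambda>k. inner w (X k)) k" for e k
    proof -
      have "min v_min (1 - \<mu>) \<le> min v_min (1 - beta_val \<beta> (flips (tm_blocks n e) (k div N)))"
        using \<mu>(2)[of e "k div N"] by simp
      then show ?thesis using embed_witness[of k "tm_blocks n e"] order_trans by blast
    qed
    fix e e' :: "nat \<Rightarrow> bool" and j
    assume e: "\<forall>i<j. e i = e' i" "e j \<noteq> e' j"
    have same: "tm_blocks n e i = tm_blocks n e' i" if "i < 2 ^ n * j" for i
    proof -
      have "i div 2 ^ n < j" using that by (simp add: less_mult_imp_div_less mult.commute)
      then show ?thesis using e by (simp add: tm_blocks_def)
    qed
    have "embed (tm_blocks n e) i = embed (tm_blocks n e') i" if "i < N * (2 ^ n * j)" for i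
    proof -
      have "i div N < 2 ^ n * j" using that by (simp add: less_mult_imp_div_less mult.commute)
      then show ?thesis using same by (simp add: embed_def)
    qed
    moreover have "embed (tm_blocks n e) (N * (2 ^ n * j)) \<noteq> embed (tm_blocks n e') (N * (2 ^ n * j))"
    proof -
      have "tm_blocks n e (2 ^ n * j) \<noteq> tm_blocks n e' (2 ^ n * j)" using e(2) by (simp add: tm_blocks_def)
      then show ?thesis unfolding embed_mult using \<sigma>_nz by (simp add: sg_simps)
    qed
    ultimately show "\<exists>k\<le>N * 2 ^ n * Suc j. (\<forall>i<k. embed (tm_blocks n e) i = embed (tm_blocks n e') i) \<and>
        embed (tm_blocks n e) k \<noteq> embed (tm_blocks n e') k"
      by (intro exI[of _ "N * (2 ^ n * j)"]) (auto simp: mult.assoc)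
  qed
qed

text \<open>The difference starts at position \<open>N * n\<close>, and by periodicity the vectors
  from there on are the whole orbit scaled by \<beta>^-n in norm.\<close>

lemma signed_sum_prefix_dist:
  assumes f: "\<And>r m. r < N \<Longrightarrow> m < n \<Longrightarrow> f r m = g r m"
  shows "dist (signed_sum X (address f)) (signed_sum X (address g)) \<le> 2 * (\<Sum>k. norm (X k)) / \<beta> ^ n"
proof -
  define D where "D k = (address f k - address g k) *\<^sub>R X k" for k
  have D: "D sums (signed_sum X (address f) - signed_sum X (address g))"
    unfolding D_def signed_sum_def scaleR_diff_left
    by (intro sums_diff summable_sums summable_signed sm address_sign_seqs)
  have "D k = 0" if "k < N * n" for k
  proof -
    have "k div N < n" using that by (simp add: less_mult_imp_div_less mult.commute)
    then show ?thesis using f[of "k mod N" "k div N"] N by (simp add: D_def address_def)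
  qed
  then have "(\<Sum>k<N * n. D k) = 0" by simp
  then have D': "(\<lambda>k. D (k + N * n)) sums (signed_sum X (address f) - signed_sum X (address g))"
    using sums_split_initial_segment[OF D, of "N * n"] by simp
  have le: "norm (D (k + N * n)) \<le> 2 / \<beta> ^ n * norm (X k)" for k
  proof -
    have "X (k + N * n) = (\<sigma> / \<beta>) ^ n *\<^sub>R X k" using X_mult[of n k] by (simp add: add.commute)
    then have "norm (D (k + N * n)) = \<bar>address f (k + N * n) - address g (k + N * n)\<bar> * (norm (X k) / \<beta> ^ n)"
      unfolding D_def by (simp only: norm_scaleR \<sigma>\<beta>_abs) simp
    also have "\<dots> \<le> 2 * (norm (X k) / \<beta> ^ n)"
    proof (rule mult_right_mono)
      show "\<bar>address f (k + N * n) - address g (k + N * n)\<bar> \<le> 2"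
        using sign_seqs_abs[OF address_sign_seqs, of f "k + N * n"] sign_seqs_abs[OF address_sign_seqs, of g "k + N * n"] by linarith
    qed (use \<beta> in auto)
    finally show ?thesis by simp
  qed
  have "norm (\<Sum>k. D (k + N * n)) \<le> (\<Sum>k. 2 / \<beta> ^ n * norm (X k))"
    by (rule norm_suminf_le[OF le]) (intro summable_mult sm)
  then show ?thesis using sums_unique[OF D'] suminf_mult[OF sm, of "2 / \<beta> ^ n"] by (simp add: dist_norm)
qed

text \<open>The covering sets are cylinders given by N admissible words of length n = 2^j, of
  diameter at most C / \<beta>^n. There are at most 2^(N (j+2)^2) of them, and (j+2)^2 is negligible
  against 2^j, so the sum of s-th powers of diameters tends to 0 for every s > 0.\<close>

lemma hausdorff_dim_komornik_loreti:
  assumes kl: "\<beta> = komornik_loreti"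
  shows "hausdorff_dim (unique_sums X) = 0"
proof (rule hausdorff_dim_eq_0_if_finite_covers)
  fix s \<delta> \<epsilon> :: real assume s: "0 < s" and \<delta>: "0 < \<delta>" and \<epsilon>: "0 < \<epsilon>"
  define C where "C = 2 * (\<Sum>k. norm (X k)) + 1"
  have C: "1 \<le> C" using suminf_nonneg[OF sm] by (simp add: C_def)
  \<comment> \<open>Half of the decay: \<beta>^(-s n) is x^n times x^n, one factor to absorb the
    number of cylinders and one to become small.\<close>
  define x where "x = \<beta> powr (- (s / 2))"
  have x: "0 < x" "x < 1" using \<beta> s by (auto simp: x_def powr_less_one)
  define c where "c = s / 2 * ln \<beta>"
  have c: "0 < c" using s \<beta> by (simp add: c_def)
  \<comment> \<open>The quotient (j+2)^2 / 2^j is written as a square, so that the limit of j z^j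
    with z = 1 / sqrt 2 applies.\<close>
  have "(\<lambda>j. (real j * (1 / sqrt 2) ^ j + 2 * (1 / sqrt 2) ^ j)\<^sup>2) \<longlonglongrightarrow> (0 + 2 * 0)\<^sup>2"
    by (intro tendsto_intros powser_times_n_limit_0 LIMSEQ_power_zero) (auto simp: real_less_rsqrt)
  moreover have "(real j * (1 / sqrt 2) ^ j + 2 * (1 / sqrt 2) ^ j)\<^sup>2 = (real j + 2)\<^sup>2 / 2 ^ j" for j
  proof -
    define y where "y = (1 / sqrt 2) ^ j"
    have yy: "y * y = 1 / 2 ^ j" by (simp add: y_def power_mult_distrib[symmetric] power_one_over)
    have "(real j * y + 2 * y)\<^sup>2 = (real j + 2)\<^sup>2 * (y * y)"
      by (simp add: power2_eq_square algebra_simps)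
    then show ?thesis unfolding yy by (simp add: y_def)
  qed
  ultimately have "(\<lambda>j. (real j + 2)\<^sup>2 / 2 ^ j) \<longlonglongrightarrow> 0" by simp
  then have "(\<lambda>j. real N * ln 2 * ((real j + 2)\<^sup>2 / 2 ^ j)) \<longlonglongrightarrow> real N * ln 2 * 0" by (intro tendsto_mult tendsto_const)
  then have "(\<lambda>j. real N * ln 2 * ((real j + 2)\<^sup>2 / 2 ^ j)) \<longlonglongrightarrow> 0" by simp
  from order_tendstoD(2)[OF this c] have e1: "\<forall>\<^sub>F j in sequentially. real N * ln 2 * ((real j + 2)\<^sup>2 / 2 ^ j) < c" .
  have "(\<lambda>j. C powr s * x ^ j) \<longlonglongrightarrow> C powr s * 0" using x by (intro tendsto_mult tendsto_const LIMSEQ_power_zero) auto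
  then have "(\<lambda>j. C powr s * x ^ j) \<longlonglongrightarrow> 0" by simp
  from order_tendstoD(2)[OF this \<epsilon>] have e2: "\<forall>\<^sub>F j in sequentially. C powr s * x ^ j < \<epsilon>" .
  have "(\<lambda>j. C * (1 / \<beta>) ^ j) \<longlonglongrightarrow> C * 0" using \<beta> by (intro tendsto_mult tendsto_const LIMSEQ_power_zero) auto
  then have "(\<lambda>j. C * (1 / \<beta>) ^ j) \<longlonglongrightarrow> 0" by simp
  from order_tendstoD(2)[OF this \<delta>] have e3: "\<forall>\<^sub>F j in sequentially. C * (1 / \<beta>) ^ j < \<delta>" .
  from eventually_conj[OF e1 eventually_conj[OF e2 e3]]
  obtain j where j: "real N * ln 2 * ((real j + 2)\<^sup>2 / 2 ^ j) < c" "C powr s * x ^ j < \<epsilon>" "C * (1 / \<beta>) ^ j < \<delta>"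
    by (auto simp: eventually_sequentially)
  define n :: nat where "n = 2 ^ j"
  have jn: "j \<le> n" unfolding n_def using less_exp[of j] by simp
  define W where "W = {..<N} \<rightarrow>\<^sub>E admissible_words n"
  define S where "S w = {signed_sum X (address f) | f. \<forall>r<N. \<forall>m<n. f r m = w r ! m}" for w :: "nat \<Rightarrow> bool list"
  have finW: "finite W" unfolding W_def by (intro finite_PiE finite_admissible_words) auto
  have cardW: "real (card W) \<le> (2 ^ ((j + 2)\<^sup>2)) ^ N"
  proof -
    have "card W = card (admissible_words n) ^ N" by (simp add: W_def card_PiE)
    also have "\<dots> \<le> (2 ^ ((j + 2)\<^sup>2)) ^ N" unfolding n_def by (intro power_mono card_admissible_words_power) auto
    finally have "real (card W) \<le> real ((2 ^ ((j + 2)\<^sup>2)) ^ N)" by (rule of_nat_mono)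
    then show ?thesis by simp
  qed
  have dS: "dist y z \<le> C / \<beta> ^ n" if yz: "y \<in> S w" "z \<in> S w" for w y z
  proof -
    obtain f g where fg: "y = signed_sum X (address f)" "z = signed_sum X (address g)"
      "\<forall>r<N. \<forall>m<n. f r m = w r ! m" "\<forall>r<N. \<forall>m<n. g r m = w r ! m"
      using yz unfolding S_def by blast
    then have "dist y z \<le> 2 * (\<Sum>k. norm (X k)) / \<beta> ^ n" using signed_sum_prefix_dist[of n f g] by simp
    also have "\<dots> \<le> C / \<beta> ^ n" using \<beta> by (intro divide_right_mono) (auto simp: C_def)
    finally show ?thesis .
  qed
  have bS: "bounded (S w)" for w
  proof (cases "S w = {}")
    case False
    then obtain y where "y \<in> S w" by blast
    then show ?thesis unfolding bounded_def using dS by blast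
  qed simp
  have diamS: "diameter (S w) \<le> C / \<beta> ^ n" for w
    by (rule diameter_le) (use dS C \<beta> in \<open>auto simp: dist_norm\<close>)
  have "unique_sums X \<subseteq> \<Union> (S ` W)"
  proof
    fix y assume "y \<in> unique_sums X"
    then obtain f where f: "f \<in> {..<N} \<rightarrow>\<^sub>E univoque \<beta>" "y = signed_sum X (address f)"
      using unique_sums_subset komornik_loreti(2) kl by auto
    define w where "w = restrict (\<lambda>r. map (f r) [0..<n]) {..<N}"
    have "map (f r) [0..<n] \<in> admissible_words n" if "r < N" for r
    proof -
      have "f r \<in> univoque \<beta>" using f that by auto
      then have "\<forall>m. admissible m (f r)" using univoque_admissible[OF \<beta>] kl by auto
      then show ?thesis unfolding admissible_words_def by (intro imageI) simp
    qed
    then have "w \<in> W" by (auto simp: w_def W_def)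
    moreover have "y \<in> S w" using f(2) by (auto simp: S_def w_def)
    ultimately show "y \<in> \<Union> (S ` W)" by blast
  qed
  moreover have "diameter U \<le> \<delta>" if "U \<in> S ` W" for U
  proof -
    have "diameter U \<le> C * (1 / \<beta>) ^ n" using that diamS by (auto simp: power_one_over)
    also have "\<dots> \<le> C * (1 / \<beta>) ^ j" using C \<beta> jn by (intro mult_left_mono power_decreasing) auto
    finally show ?thesis using j(3) by simp
  qed
  moreover have "(\<Sum>U\<in>S ` W. diameter U powr s) \<le> \<epsilon>"
  proof -
    have "(\<Sum>U\<in>S ` W. diameter U powr s) \<le> (\<Sum>U\<in>S ` W. (C / \<beta> ^ n) powr s)"
    proof (rule sum_mono)
      fix U assume "U \<in> S ` W"
      then show "diameter U powr s \<le> (C / \<beta> ^ n) powr s"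
        using s diamS bS by (intro powr_mono2) (auto simp: diameter_ge_0)
    qed
    also have "\<dots> = real (card (S ` W)) * (C / \<beta> ^ n) powr s" by simp
    also have "\<dots> \<le> (2 ^ ((j + 2)\<^sup>2)) ^ N * (C / \<beta> ^ n) powr s"
      using card_image_le[OF finW, of S] cardW by (intro mult_right_mono) auto
    also have "(C / \<beta> ^ n) powr s = C powr s * (x ^ n * x ^ n)"
    proof -
      have "x * x = \<beta> powr (- s)" by (simp add: x_def powr_add[symmetric])
      then have "x ^ n * x ^ n = (\<beta> powr (- s)) ^ n" by (simp add: power_mult_distrib[symmetric])
      also have "\<dots> = (\<beta> ^ n) powr (- s)" using \<beta> by (simp add: powr_power powr_realpow[symmetric] powr_powr mult.commute)
      finally have xx: "x ^ n * x ^ n = (\<beta> ^ n) powr (- s)" .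
      have "(C / \<beta> ^ n) powr s = C powr s / (\<beta> ^ n) powr s" by (rule powr_divide)
      then show ?thesis unfolding xx by (simp add: powr_minus_divide)
    qed
    also have "(2 ^ ((j + 2)\<^sup>2)) ^ N * (C powr s * (x ^ n * x ^ n)) = C powr s * ((2 ^ ((j + 2)\<^sup>2)) ^ N * x ^ n * x ^ n)"
      by simp
    also have "\<dots> \<le> C powr s * (1 * x ^ n)"
    proof (intro mult_left_mono mult_right_mono)
      have "(2 ^ ((j + 2)\<^sup>2)) ^ N * x ^ n = exp (real N * ln 2 * (real j + 2)\<^sup>2 - c * 2 ^ j)"
      proof -
        have "(2 :: real) ^ ((j + 2)\<^sup>2) = exp (ln 2 * (real j + 2)\<^sup>2)"
          using powr_realpow[of 2 "(j + 2)\<^sup>2"] by (simp add: powr_def mult.commute add.commute)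
        then have "((2 :: real) ^ ((j + 2)\<^sup>2)) ^ N = exp (real N * (ln 2 * (real j + 2)\<^sup>2))"
          by (simp add: exp_of_nat_mult)
        moreover have "x ^ n = exp (real n * (- c))"
          unfolding exp_of_nat_mult x_def using \<beta> by (simp add: powr_def c_def)
        ultimately show ?thesis by (simp add: exp_diff exp_minus n_def divide_inverse mult_ac)
      qed
      also have "\<dots> \<le> 1" using j(1) by (simp add: field_simps)
      finally show "(2 ^ ((j + 2)\<^sup>2)) ^ N * x ^ n \<le> 1" .
    qed (use x in auto)
    also have "\<dots> \<le> C powr s * x ^ j" using x jn by (auto intro!: mult_left_mono power_decreasing)
    finally show ?thesis using j(2) by simp
  qed
  ultimately show "\<exists>F. finite F \<and> unique_sums X \<subseteq> \<Union>F \<and> (\<forall>U\<in>F. bounded U \<and> diameter U \<le> \<delta>) \<and> (\<Sum>U\<in>F. diameter U powr s) \<le> \<epsilon>"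
    using finW bS by (intro exI[of _ "S ` W"]) auto
qed

end

section \<open>The theorem\<close>


lemma perpendicular_witness:
  fixes a x :: "'a::real_inner"
  assumes "\<And>c. x \<noteq> c *\<^sub>R a"
  shows "\<exists>v. inner v a = 0 \<and> inner v x \<noteq> 0"
proof (cases "a = 0")
  case True
  then show ?thesis using assms[of 0] by (intro exI[of _ x]) auto
next
  case False
  define c where "c = inner x a / inner a a"
  define v where "v = x - c *\<^sub>R a"
  have va: "inner v a = 0" using False by (simp add: v_def c_def inner_diff_left)
  have "v \<noteq> 0" using assms[of c] by (simp add: v_def)
  moreover have "inner v x = inner v v" using va by (simp add: v_def inner_diff_right)
  ultimately show ?thesis using va by auto
qed

text \<open>Finitely many proper subspaces do not exhaust a real vector space: adding t v' to v
  meets the old and the new conditions for all but finitely many t.\<close>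

lemma generic_perpendicular:
  fixes x :: "'b \<Rightarrow> 'a::real_inner"
  assumes "finite K" "\<And>k. k \<in> K \<Longrightarrow> \<exists>v. inner v a = 0 \<and> inner v (x k) \<noteq> 0"
  shows "\<exists>v. inner v a = 0 \<and> (\<forall>k\<in>K. inner v (x k) \<noteq> 0)"
  using assms
proof (induction K rule: finite_induct)
  case empty
  show ?case by (intro exI[of _ 0]) simp
next
  case (insert k K)
  then obtain v v' where v: "inner v a = 0" "\<forall>j\<in>K. inner v (x j) \<noteq> 0"
    and v': "inner v' a = 0" "inner v' (x k) \<noteq> 0" by (metis insertI1 insertI2)
  have "finite ((\<lambda>j. - inner v (x j) / inner v' (x j)) ` insert k K)" using insert.hyps(1) by simp
  then obtain t where t: "t \<notin> (\<lambda>j. - inner v (x j) / inner v' (x j)) ` insert k K"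
    using ex_new_if_finite[OF infinite_UNIV_char_0] by blast
  have "inner (v + t *\<^sub>R v') (x j) \<noteq> 0" if j: "j \<in> insert k K" for j
  proof
    assume "inner (v + t *\<^sub>R v') (x j) = 0"
    then have eq: "inner v (x j) + t * inner v' (x j) = 0" by (simp add: inner_add_left)
    have nz: "inner v' (x j) \<noteq> 0"
    proof
      assume "inner v' (x j) = 0"
      then show False using eq v(2) v'(2) j by auto
    qed
    then have "t = - inner v (x j) / inner v' (x j)" using eq by (simp add: field_simps eq_neg_iff_add_eq_0)
    then show False using t j by blast
  qed
  then show ?case using v(1) v'(1) by (intro exI[of _ "v + t *\<^sub>R v'"]) (simp add: inner_add_left)
qed

text \<open>The coefficients 1 and -i read off the real and imaginary parts of \<kappa>^k, so a
  parallel orbit point imposes the same real scalar on every realized eigenvalue.\<close>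

lemma realizes_not_parallel:
  assumes "realizes X (\<lambda>k. \<kappa> ^ k) B" "X k = c *\<^sub>R X 0"
  shows "\<kappa> ^ k = complex_of_real c"
proof -
  obtain v where v: "\<And>k. inner v (X k) = Re (1 * \<kappa> ^ k)" using realizesE[OF assms(1), of 1] by metis
  obtain w where w: "\<And>k. inner w (X k) = Re (- \<i> * \<kappa> ^ k)" using realizesE[OF assms(1), of "- \<i>"] by metis
  have "Re (\<kappa> ^ k) = c" using v[of k] v[of 0] assms(2) by simp
  moreover have "Im (\<kappa> ^ k) = 0" using w[of k] w[of 0] assms(2) by simp
  ultimately show ?thesis by (simp add: complex_eq_iff)
qed

lemma orbit_add_period:
  assumes "orbit M u N = \<gamma> *\<^sub>R u"
  shows "orbit M u (k + N) = \<gamma> *\<^sub>R orbit M u k"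
  by (induction k) (simp_all add: assms orbit_0 orbit_Suc matrix_vector_mult_scaleR)

text \<open>N is 2q if the q-th powers of the eigenvalues have both signs, and q otherwise. In both
  cases N is the least positive exponent at which all eigenvalues have the same real power, so no
  earlier orbit point is parallel to u.\<close>

lemma scaled_orbit_equal_moduli:
  fixes M :: "real^'n^'n"
  assumes dim: "CARD('n) \<ge> 2"
    and contracting: "\<forall>\<kappa>\<in>spectrum (complex_mat M). cmod \<kappa> < 1"
    and cyclic: "cyclic_vector M u"
    and spec: "spectrum (complex_mat M) = \<kappa> ` {1..CARD('n)}"
    and inj: "inj_on \<kappa> {1..CARD('n)}"
    and simple: "\<forall>j\<in>{1..CARD('n)}. Polynomial.order (\<kappa> j) (char_poly (complex_mat M)) = 1"
    and rat: "\<forall>j\<in>{1..CARD('n)}. Arg (\<kappa> j) / pi \<in> \<rat>"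
    and moduli: "\<forall>j\<in>{1..CARD('n)}. cmod (\<kappa> j) = cmod (\<kappa> 1)"
    and q: "q = (LEAST r. 1 \<le> r \<and> (\<forall>j\<in>{1..CARD('n)}. \<kappa> j ^ r \<in> \<real>))"
    and \<beta>: "\<beta> = (if \<exists>j\<in>{1..CARD('n)}. \<exists>k\<in>{1..CARD('n)}. Re (\<kappa> j ^ q * \<kappa> k ^ q) < 0
             then 1 / cmod (\<kappa> 1) ^ (2 * q) else 1 / cmod (\<kappa> 1) ^ q)"
  shows "\<exists>N \<sigma> v. scaled_orbit (orbit M u) N \<sigma> \<beta> v"
proof -
  let ?J = "{1..CARD('n)}" and ?X = "orbit M u"
  define \<rho> where "\<rho> = cmod (\<kappa> 1)"
  have one: "1 \<in> ?J" and two: "2 \<in> ?J" using dim by auto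
  have mod\<rho>: "cmod (\<kappa> j) = \<rho>" if "j \<in> ?J" for j using moduli that unfolding \<rho>_def by blast
  \<comment> \<open>If all moduli were 0, the distinct eigenvalues \<open>\<kappa> 1\<close> and
    \<open>\<kappa> 2\<close> would coincide; dimension at least 2 is needed here.\<close>
  have "\<rho> \<noteq> 0"
  proof
    assume "\<rho> = 0"
    then have "\<kappa> 1 = \<kappa> 2" using mod\<rho>[OF one] mod\<rho>[OF two] by simp
    then show False using inj_onD[OF inj _ one two] by simp
  qed
  then have \<rho>: "0 < \<rho>" "\<rho> < 1" using contracting spec one by (auto simp: \<rho>_def)
  have re: "\<exists>B. realizes ?X (\<lambda>k. \<kappa> j ^ k) B" if "j \<in> ?J" for j
    using realizes_eigenvalue[OF cyclic] spec that by auto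
  have real_mult: "\<exists>r\<ge>1. \<kappa> j ^ r \<in> \<real>" if "j \<in> ?J" for j
  proof -
    have "Arg (\<kappa> j) / pi \<in> \<rat>" using rat that by blast
    from rational_angle[OF this]
    obtain p :: int and b :: nat where b: "0 < b" "\<kappa> j = rcis (cmod (\<kappa> j)) (pi * p / b)" by blast
    have "\<kappa> j ^ b = rcis (cmod (\<kappa> j) ^ b) (real b * (pi * p / b))" by (subst b(2)) (simp add: DeMoivre2)
    also have "real b * (pi * p / b) = pi * p" using b(1) by simp
    finally have "Im (\<kappa> j ^ b) = 0" using sin_pi_int_plus[of p 0] by simp
    then show ?thesis using b(1) by (intro exI[of _ b]) (auto simp: complex_is_Real_iff)
  qed
  then obtain b where b: "\<And>j. j \<in> ?J \<Longrightarrow> 1 \<le> b j" "\<And>j. j \<in> ?J \<Longrightarrow> \<kappa> j ^ b j \<in> \<real>" by metis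
  define r where "r = prod b ?J"
  have "1 \<le> r" unfolding r_def using b(1) by (intro prod_ge_1) auto
  moreover have "\<kappa> j ^ r \<in> \<real>" if j: "j \<in> ?J" for j
  proof -
    have "b j dvd r" unfolding r_def using j by (intro dvd_prodI) auto
    then obtain l where "r = b j * l" by blast
    then show ?thesis using b(2)[OF j] by (simp add: power_mult)
  qed
  ultimately have "1 \<le> r \<and> (\<forall>j\<in>?J. \<kappa> j ^ r \<in> \<real>)" by blast
  then have q1: "1 \<le> q \<and> (\<forall>j\<in>?J. \<kappa> j ^ q \<in> \<real>)" unfolding q by (rule LeastI)
  have qmin: "q \<le> t" if "1 \<le> t" "\<And>j. j \<in> ?J \<Longrightarrow> \<kappa> j ^ t \<in> \<real>" for t
    unfolding q using that by (intro Least_le) blast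
  define g where "g j = Re (\<kappa> j ^ q)" for j
  have g: "\<kappa> j ^ q = complex_of_real (g j)" if "j \<in> ?J" for j
    using q1 that unfolding g_def by (simp add: of_real_Re)
  have absg: "\<bar>g j\<bar> = \<rho> ^ q" if "j \<in> ?J" for j
    using arg_cong[OF g[OF that], of cmod] mod\<rho>[OF that] by (simp add: norm_power)
  have Reg: "Re (\<kappa> j ^ q * \<kappa> k ^ q) = g j * g k" if "j \<in> ?J" "k \<in> ?J" for j k
    unfolding g[OF that(1)] g[OF that(2)] by simp
  have common: "\<exists>N \<sigma> v. scaled_orbit ?X N \<sigma> \<beta> v"
    if N: "0 < N" and \<sigma>: "\<sigma> = 1 \<or> \<sigma> = - 1" and \<beta>N: "\<beta> = 1 / \<rho> ^ N"
      and pw: "\<And>j. j \<in> ?J \<Longrightarrow> \<kappa> j ^ N = complex_of_real (\<sigma> / \<beta>)"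
      and npar: "\<And>k c. 0 < k \<Longrightarrow> k < N \<Longrightarrow> \<not> (\<forall>j\<in>?J. \<kappa> j ^ k = complex_of_real c)" for N \<sigma>
  proof -
    have "orbit M u N = (\<sigma> / \<beta>) *\<^sub>R u"
      using simple pw spec by (intro orbit_periodic) auto
    note per = orbit_add_period[OF this]
    have nparX: "?X k \<noteq> c *\<^sub>R ?X 0" if k: "k \<in> {0<..<N}" for k c
    proof
      assume par: "?X k = c *\<^sub>R ?X 0"
      have "\<kappa> j ^ k = complex_of_real c" if "j \<in> ?J" for j
        using re[OF that] realizes_not_parallel[OF _ par] by blast
      then show False using npar[of k c] k by auto
    qed
    have "\<exists>v. inner v (?X 0) = 0 \<and> (\<forall>k\<in>{0<..<N}. inner v (?X k) \<noteq> 0)"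
      by (rule generic_perpendicular) (use nparX in \<open>auto intro: perpendicular_witness\<close>)
    then obtain v where v: "inner v (?X 0) = 0" "\<And>k. 0 < k \<Longrightarrow> k < N \<Longrightarrow> inner v (?X k) \<noteq> 0" by auto
    have X0: "?X 0 \<noteq> 0"
    proof -
      obtain B where "realizes ?X (\<lambda>k. \<kappa> 1 ^ k) B" using re[OF one] by blast
      then obtain w where "\<And>k. inner w (?X k) = Re (1 * \<kappa> 1 ^ k)" using realizesE[of ?X _ B 1] by metis
      from this[of 0] show ?thesis by auto
    qed
    have "1 < \<beta>" unfolding \<beta>N using \<rho> N by (simp add: power_less_one_iff)
    then have "scaled_orbit ?X N \<sigma> \<beta> v"
      using summable_orbit[OF contracting] N \<sigma> per X0 v by unfold_locales auto
    then show ?thesis by blast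
  qed
  show ?thesis
  proof (cases "\<exists>j\<in>?J. \<exists>k\<in>?J. Re (\<kappa> j ^ q * \<kappa> k ^ q) < 0")
    case True
    then obtain j0 k0 where jk0: "j0 \<in> ?J" "k0 \<in> ?J" "Re (\<kappa> j0 ^ q * \<kappa> k0 ^ q) < 0" by blast
    then have jk: "j0 \<in> ?J" "k0 \<in> ?J" "g j0 * g k0 < 0" by (simp_all only: Reg)
    have \<beta>2: "\<beta> = 1 / \<rho> ^ (2 * q)" using \<beta> True unfolding \<rho>_def by (simp only: if_True)
    show ?thesis
    proof (rule common[OF _ disjI1[OF refl] \<beta>2])
      show "0 < 2 * q" using q1 by simp
      fix j assume j: "j \<in> ?J"
      have "\<kappa> j ^ (2 * q) = (\<kappa> j ^ q)\<^sup>2" by (simp add: power_mult[symmetric] mult.commute)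
      also have "\<dots> = complex_of_real (\<bar>g j\<bar>\<^sup>2)" unfolding g[OF j] by simp
      also have "\<bar>g j\<bar>\<^sup>2 = 1 / \<beta>" unfolding absg[OF j] \<beta>2 by (simp add: power_mult[symmetric] mult.commute)
      finally show "\<kappa> j ^ (2 * q) = complex_of_real (1 / \<beta>)" .
    next
      fix k c assume k: "0 < k" "k < 2 * q"
      show "\<not> (\<forall>j\<in>?J. \<kappa> j ^ k = complex_of_real c)"
      proof
        assume all: "\<forall>j\<in>?J. \<kappa> j ^ k = complex_of_real c"
        \<comment> \<open>Write k = q + t with t < q. Then all \<open>\<kappa> j ^ t\<close> are
          real, so t = 0 by minimality of q; but then all \<open>g j\<close> are equal, against the
          opposite signs.\<close>
        then have "q \<le> k" using k by (intro qmin) auto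
        then obtain t where t: "k = q + t" using le_Suc_ex by blast
        have "\<kappa> j ^ t \<in> \<real>" if j: "j \<in> ?J" for j
        proof -
          have "\<kappa> j ^ q * \<kappa> j ^ t = complex_of_real c" using all j unfolding t power_add by blast
          then have "complex_of_real (g j) * \<kappa> j ^ t = complex_of_real c" unfolding g[OF j] .
          moreover have "g j \<noteq> 0" using absg[OF j] \<rho> by auto
          ultimately have "\<kappa> j ^ t = complex_of_real (c / g j)" by (simp add: field_simps)
          then show ?thesis by simp
        qed
        then have "t = 0" using qmin[of t] k t by (cases "t = 0") auto
        then have "g j = c" if "j \<in> ?J" for j using all g[OF that] that t by (metis add.right_neutral of_real_eq_iff)
        then have "c * c < 0" using jk by auto
        then show False by (simp add: not_less[symmetric])
      qed
    qed
  next
    case False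
    \<comment> \<open>The common sign of all \<open>g j\<close>: no product of two of them is
      negative, and none is 0.\<close>
    define \<sigma> where "\<sigma> = sgn (g 1)"
    have "g 1 \<noteq> 0" using absg[OF one] \<rho> by auto
    then have \<sigma>: "\<sigma> = 1 \<or> \<sigma> = - 1" by (auto simp: \<sigma>_def sgn_if)
    have \<beta>1: "\<beta> = 1 / \<rho> ^ q" using \<beta> False unfolding \<rho>_def by (simp only: if_False)
    show ?thesis
    proof (rule common[OF _ \<sigma> \<beta>1])
      show "0 < q" using q1 by simp
      fix j assume j: "j \<in> ?J"
      have "0 \<le> g 1 * g j" using False Reg[OF one j] one j by (metis not_less)
      then have "g j = \<sigma> * \<bar>g j\<bar>" using \<open>g 1 \<noteq> 0\<close>
        by (auto simp: \<sigma>_def sgn_if abs_if zero_le_mult_iff)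
      then have "g j = \<sigma> / \<beta>" unfolding absg[OF j] \<beta>1 by simp
      then show "\<kappa> j ^ q = complex_of_real (\<sigma> / \<beta>)" using g[OF j] by simp
    next
      fix k c assume k: "0 < k" "k < q"
      show "\<not> (\<forall>j\<in>?J. \<kappa> j ^ k = complex_of_real c)"
      proof
        assume "\<forall>j\<in>?J. \<kappa> j ^ k = complex_of_real c"
        then have "q \<le> k" using k by (intro qmin) auto
        then show False using k by simp
      qed
    qed
  qed
qed

text \<open>The eigenvalue of larger modulus drives the construction. If its angle is irrational it
  suffices alone; otherwise the smaller one supplies the perturbation.\<close>

lemma hausdorff_dim_pos_two_moduli:
  fixes M :: "real^'n^'n"
  assumes contracting: "\<forall>\<kappa>\<in>spectrum (complex_mat M). cmod \<kappa> < 1"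
    and cyclic: "cyclic_vector M u"
    and \<kappa>: "\<kappa>\<^sub>1 \<in> spectrum (complex_mat M)" "\<kappa>\<^sub>2 \<in> spectrum (complex_mat M)" "\<kappa>\<^sub>2 \<noteq> 0" "cmod \<kappa>\<^sub>2 < cmod \<kappa>\<^sub>1"
  shows "0 < hausdorff_dim (unique_sums (orbit M u))"
proof -
  note sm = summable_orbit[OF contracting, of u]
  obtain B1 B2 where B: "realizes (orbit M u) (\<lambda>k. \<kappa>\<^sub>1 ^ k) B1" "realizes (orbit M u) (\<lambda>k. \<kappa>\<^sub>2 ^ k) B2"
    using realizes_eigenvalue[OF cyclic] \<kappa> by blast
  have c: "cmod \<kappa>\<^sub>1 < 1" using contracting \<kappa> by blast
  show ?thesis
  proof (cases "Arg \<kappa>\<^sub>1 / pi \<in> \<rat>")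
    case True
    show ?thesis by (rule hausdorff_dim_pos_distinct_moduli[OF sm B _ \<kappa>(4) c True]) (use \<kappa> in simp)
  next
    case False
    show ?thesis by (rule hausdorff_dim_pos_irrational[OF sm B(1) c False])
  qed
qed

text \<open>By the choice of q the products \<open>\<kappa> j ^ q * \<kappa> k ^ q\<close> are real,
  so their sign is read off the real part. Simplicity of an eigenvalue is expressed by the order of
  the root of the characteristic polynomial.\<close>

theorem theorem2p5:
  fixes M :: "real^'n^'n" and u :: "real^'n"
  assumes dim: "CARD('n) \<ge> 2"
    and contracting: "\<forall>\<kappa>\<in>spectrum (complex_mat M). cmod \<kappa> < 1"
    and cyclic: "cyclic_vector M u"
  shows
    "((\<exists>n_as. jordan_nf (complex_mat M) n_as \<and> (\<exists>(n, \<kappa>)\<in>set n_as. 2 \<le> n \<and> \<kappa> \<noteq> 0)) \<longrightarrow>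
        hausdorff_dim (uniqueness_set M u) > 0)
   \<and> ((\<exists>\<kappa>\<in>spectrum (complex_mat M). Arg \<kappa> / pi \<notin> \<rat>) \<longrightarrow>
        hausdorff_dim (uniqueness_set M u) > 0)
   \<and> ((\<exists>\<kappa>\<^sub>1\<in>spectrum (complex_mat M). \<exists>\<kappa>\<^sub>2\<in>spectrum (complex_mat M).
          \<kappa>\<^sub>1 \<noteq> 0 \<and> \<kappa>\<^sub>2 \<noteq> 0 \<and> cmod \<kappa>\<^sub>1 \<noteq> cmod \<kappa>\<^sub>2) \<longrightarrow>
        hausdorff_dim (uniqueness_set M u) > 0)
   \<and> (\<forall>(\<kappa> :: nat \<Rightarrow> complex) (q :: nat) (\<beta> :: real).
        spectrum (complex_mat M) = \<kappa> ` {1..CARD('n)} \<longrightarrow>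
        inj_on \<kappa> {1..CARD('n)} \<longrightarrow>
        (\<forall>j\<in>{1..CARD('n)}. Polynomial.order (\<kappa> j) (char_poly (complex_mat M)) = 1) \<longrightarrow>
        (\<forall>j\<in>{1..CARD('n)}. Arg (\<kappa> j) / pi \<in> \<rat>) \<longrightarrow>
        (\<forall>j\<in>{1..CARD('n)}. cmod (\<kappa> j) = cmod (\<kappa> 1)) \<longrightarrow>
        q = (LEAST r. 1 \<le> r \<and> (\<forall>j\<in>{1..CARD('n)}. \<kappa> j ^ r \<in> \<real>)) \<longrightarrow>
        \<beta> = (if \<exists>j\<in>{1..CARD('n)}. \<exists>k\<in>{1..CARD('n)}. Re (\<kappa> j ^ q * \<kappa> k ^ q) < 0
             then 1 / cmod (\<kappa> 1) ^ (2 * q) else 1 / cmod (\<kappa> 1) ^ q) \<longrightarrow>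
        (1 < \<beta> \<and> \<beta> \<le> golden_ratio \<longrightarrow>
           finite (uniqueness_set M u) \<and> uniqueness_set M u \<noteq> {})
      \<and> (golden_ratio < \<beta> \<and> \<beta> < komornik_loreti \<longrightarrow>
           infinite (uniqueness_set M u) \<and> countable (uniqueness_set M u))
      \<and> (\<beta> = komornik_loreti \<longrightarrow>
           uncountable (uniqueness_set M u) \<and> hausdorff_dim (uniqueness_set M u) = 0)
      \<and> (komornik_loreti < \<beta> \<longrightarrow> hausdorff_dim (uniqueness_set M u) > 0))"
  unfolding uniqueness_set_eq
proof (intro conjI allI)
  let ?A = "complex_mat M" and ?U = "unique_sums (orbit M u)"
  note sm = summable_orbit[OF contracting, of u]
  \<comment> \<open>Proved before the claim on Jordan blocks, which falls back on it when the
    eigenvalue of the block has an irrational angle.\<close>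
  show irr: "(\<exists>\<kappa>\<in>spectrum ?A. Arg \<kappa> / pi \<notin> \<rat>) \<longrightarrow> hausdorff_dim ?U > 0"
    using realizes_eigenvalue[OF cyclic] hausdorff_dim_pos_irrational[OF sm] contracting by blast
  show "(\<exists>n_as. jordan_nf ?A n_as \<and> (\<exists>(n, \<kappa>)\<in>set n_as. 2 \<le> n \<and> \<kappa> \<noteq> 0)) \<longrightarrow> hausdorff_dim ?U > 0"
  proof (rule impI, elim exE conjE bexE)
    fix n_as x assume jnf: "jordan_nf ?A n_as" and x: "x \<in> set n_as" "case x of (n, \<kappa>) \<Rightarrow> 2 \<le> n \<and> \<kappa> \<noteq> 0"
    obtain n \<kappa> where blk: "(n, \<kappa>) \<in> set n_as" "2 \<le> n" "\<kappa> \<noteq> 0" using x by (cases x) auto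
    have "n \<le> Polynomial.order \<kappa> (char_poly ?A)" by (rule jordan_nf_block_size_order_bound[OF jnf blk(1)])
    then have "poly (char_poly ?A) \<kappa> = 0" using blk(2) order_root[of "char_poly ?A" \<kappa>] by auto
    then have \<kappa>: "\<kappa> \<in> spectrum ?A" unfolding spectrum_root_char_poly[OF complex_mat_carrier] by simp
    obtain B1 B2 where B: "realizes (orbit M u) (\<lambda>k. \<kappa> ^ k) B1" "realizes (orbit M u) (\<lambda>k. of_nat k * \<kappa> ^ k) B2"
      using realizes_jordan[OF cyclic jnf blk] by blast
    show "hausdorff_dim ?U > 0"
    proof (cases "Arg \<kappa> / pi \<in> \<rat>")
      case True
      show ?thesis
        by (rule hausdorff_dim_pos_jordan[OF sm B blk(3) _ True]) (use contracting \<kappa> in blast)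
    next
      case False
      then show ?thesis using irr \<kappa> by blast
    qed
  qed
  show "(\<exists>\<kappa>\<^sub>1\<in>spectrum ?A. \<exists>\<kappa>\<^sub>2\<in>spectrum ?A. \<kappa>\<^sub>1 \<noteq> 0 \<and> \<kappa>\<^sub>2 \<noteq> 0 \<and> cmod \<kappa>\<^sub>1 \<noteq> cmod \<kappa>\<^sub>2) \<longrightarrow> hausdorff_dim ?U > 0"
    \<comment> \<open>The two eigenvalues are exchanged if necessary, so that the first has the
      larger modulus.\<close>
    using hausdorff_dim_pos_two_moduli[OF contracting cyclic] by (meson linorder_neqE_linordered_idom)
next
  fix \<kappa> :: "nat \<Rightarrow> complex" and q :: nat and \<beta> :: real
  let ?A = "complex_mat M" and ?U = "unique_sums (orbit M u)" and ?J = "{1..CARD('n)}"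
  show "spectrum ?A = \<kappa> ` ?J \<longrightarrow> inj_on \<kappa> ?J \<longrightarrow>
        (\<forall>j\<in>?J. Polynomial.order (\<kappa> j) (char_poly ?A) = 1) \<longrightarrow>
        (\<forall>j\<in>?J. Arg (\<kappa> j) / pi \<in> \<rat>) \<longrightarrow>
        (\<forall>j\<in>?J. cmod (\<kappa> j) = cmod (\<kappa> 1)) \<longrightarrow>
        q = (LEAST r. 1 \<le> r \<and> (\<forall>j\<in>?J. \<kappa> j ^ r \<in> \<real>)) \<longrightarrow>
        \<beta> = (if \<exists>j\<in>?J. \<exists>k\<in>?J. Re (\<kappa> j ^ q * \<kappa> k ^ q) < 0
             then 1 / cmod (\<kappa> 1) ^ (2 * q) else 1 / cmod (\<kappa> 1) ^ q) \<longrightarrow>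
        (1 < \<beta> \<and> \<beta> \<le> golden_ratio \<longrightarrow> finite ?U \<and> ?U \<noteq> {})
      \<and> (golden_ratio < \<beta> \<and> \<beta> < komornik_loreti \<longrightarrow> infinite ?U \<and> countable ?U)
      \<and> (\<beta> = komornik_loreti \<longrightarrow> uncountable ?U \<and> hausdorff_dim ?U = 0)
      \<and> (komornik_loreti < \<beta> \<longrightarrow> hausdorff_dim ?U > 0)" (is "?h1 \<longrightarrow> ?h2 \<longrightarrow> ?h3 \<longrightarrow> ?h4 \<longrightarrow> ?h5 \<longrightarrow> ?h6 \<longrightarrow> ?h7 \<longrightarrow> ?C")
  proof (intro impI)
    assume h: ?h1 ?h2 ?h3 ?h4 ?h5 ?h6 ?h7
    obtain N \<sigma> v where "scaled_orbit (orbit M u) N \<sigma> \<beta> v"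
      using scaled_orbit_equal_moduli[OF dim contracting cyclic h] by blast
    then interpret scaled_orbit "orbit M u" N \<sigma> \<beta> v .
    show ?C
      using unique_sums_small_base unique_sums_medium_base uncountable_unique_sums
        hausdorff_dim_komornik_loreti hausdorff_dim_large_base by blast
  qed
qed

end
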